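(* Let $(\alpha_1,\alpha_2,\phi)$ be a contact pair structure on a manifold $M$ with decomposable $\phi$ and Reeb vector fields $Z_1,Z_2$, and let $g$ be a compatible metric. Then $(\alpha_1,\alpha_2,\phi,g)$ is a normal metric contact pair if and only if, for all $X,Y\in\Gamma(TM)$, $$(\nabla_X\phi)Y=\sum_{i=1}^2\left[g(X_i,Y_i)Z_i-\alpha_i(Y_i)X_i\right],$$ where $\nabla$ is the Levi-Civita connection of $g$ and $X_i$ and $Y_i$, $i=1,2$, are the orthogonal projections of $X$ and $Y$ respectively on (the tangent bundle $T\mathcal{F}_j$ of) the foliation $\mathcal{F}_j$, with $j\ne i$, $j\in\{1,2\}$.
   Context: All objects are smooth; $\Gamma(TM)$ is the space of vector fields. Convention: $d\alpha(X,Y)=\frac12[X\alpha(Y)-Y\alpha(X)-\alpha([X,Y])]$. Contact pair: a contact pair of type $(h,k)$ ($h,k\ge 0$ integers) on a manifold $M$ is a pair $(\alpha_1,\alpha_2)$ of 1-forms such that $\alpha_1\wedge(d\alpha_1)^h\wedge\alpha_2\wedge(d\alpha_2)^k$ is a volume form, $(d\alpha_1)^{h+1}=0$ and $(d\alpha_2)^{k+1}=0$ (so $\dim M=2h+2k+2$). Its Reeb vector fields $Z_1,Z_2$ are the unique vector fields with $\alpha_i(Z_j)=\delta_{ij}$ and $i_{Z_i}d\alpha_j=0$ for $i,j=1,2$. The distribution $\ker\alpha_i\cap\ker d\alpha_i$ is integrable and defines the characteristic foliation $\mathcal{F}_i$ of $\alpha_i$; one has $TM=T\mathcal{F}_1\oplus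 T\mathcal{F}_2$, with $Z_2$ tangent to $\mathcal{F}_1$ and $Z_1$ tangent to $\mathcal{F}_2$. Contact pair structure: a triple $(\alpha_1,\alpha_2,\phi)$ where $(\alpha_1,\alpha_2)$ is a contact pair and $\phi$ is a $(1,1)$-tensor field with $\phi^2=-\mathrm{Id}+\alpha_1\otimes Z_1+\alpha_2\otimes Z_2$ and $\phi Z_1=\phi Z_2=0$. $\phi$ is decomposable if $\phi(T\mathcal{F}_i)\subset T\mathcal{F}_i$ for $i=1,2$. A Riemannian metric $g$ is compatible if $g(\phi X,\phi Y)=g(X,Y)-\alpha_1(X)\alpha_1(Y)-\alpha_2(X)\alpha_2(Y)$ for all $X,Y$. It is associated if $g(X,\phi Y)=(d\alpha_1+d\alpha_2)(X,Y)$ and $g(X,Z_i)=\alpha_i(X)$ for $i=1,2$ and all $X,Y$. A metric contact pair (MCP) is a 4-tuple $(\alpha_1,\alpha_2,\phi,g)$ where $(\alpha_1,\alpha_2,\phi)$ is a contact pair structure and $g$ is an associated metric. It is normal if the two almost complex structures $J=\phi-\alpha_2\otimes Z_1+\alpha_1\otimes Z_2$ and $T=\phi+\alpha_2\otimes Z_1-\alpha_1\otimes Z_2$ are both integrable (equivalently, $[\phi,\phi](X,Y)+2d\alpha_1(X,Y)Z_1+2d\alpha_2(X,Y)Z_2=0$ for all $X,Y$, where $[\phi,\phi](X,Y)=\phi^2[X,Y]-\phi[\phi X,Y]-\phi[X,\phi Y]+[\phi X,\phi Y]$). *)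

theory Defs
  imports "HOL-Analysis.Analysis" "HOL-Combinatorics.Permutations"
begin

section \<open>Smooth manifolds\<close>

text \<open>Used for open \<open>S\<close> only; in finite dimension this is the usual class of \<open>C\<^sup>n\<close> maps.\<close>

primrec ck_on :: "nat \<Rightarrow> 'a::real_normed_vector set \<Rightarrow> ('a \<Rightarrow> 'b::real_normed_vector) \<Rightarrow> bool" where
  "ck_on 0 S f \<longleftrightarrow> continuous_on S f"
| "ck_on (Suc n) S f \<longleftrightarrow>
     (\<forall>x\<in>S. f differentiable (at x)) \<and> (\<forall>v. ck_on n S (\<lambda>x. frechet_derivative f (at x) v))"

definition smooth_on :: "'a::real_normed_vector set \<Rightarrow> ('a \<Rightarrow> 'b::real_normed_vector) \<Rightarrow> bool" where
  "smooth_on S f \<longleftrightarrow> (\<forall>n. ck_on n S f)"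

text \<open>The manifold is a whole type \<open>'m\<close>, modelled on the Euclidean space \<open>'e\<close>. A chart is a
  pair of its domain and its coordinate map (whose values outside the domain are irrelevant).\<close>

type_synonym ('m, 'e) chart = "'m set \<times> ('m \<Rightarrow> 'e)"

abbreviation chart_dom :: "('m, 'e) chart \<Rightarrow> 'm set" where
  "chart_dom C \<equiv> fst C"

abbreviation chart_map :: "('m, 'e) chart \<Rightarrow> 'm \<Rightarrow> 'e" where
  "chart_map C \<equiv> snd C"

definition chart_inv :: "('m, 'e) chart \<Rightarrow> 'e \<Rightarrow> 'm" where
  "chart_inv C = inv_into (chart_dom C) (chart_map C)"

definition is_chart :: "('m::topological_space, 'e::euclidean_space) chart \<Rightarrow> bool" where
  "is_chart C \<longleftrightarrow> open (chart_dom C) \<and> open (chart_map C ` chart_dom C) \<and>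
     homeomorphism (chart_dom C) (chart_map C ` chart_dom C) (chart_map C) (chart_inv C)"

definition smooth_manifold ::
  "('m::{t2_space, second_countable_topology}, 'e::euclidean_space) chart set \<Rightarrow> bool" where
  "smooth_manifold A \<longleftrightarrow>
     (\<forall>C\<in>A. is_chart C) \<and> (\<Union>C\<in>A. chart_dom C) = UNIV \<and>
     (\<forall>C\<in>A. \<forall>D\<in>A.
        smooth_on (chart_map C ` (chart_dom C \<inter> chart_dom D)) (chart_map D \<circ> chart_inv C))"

definition smooth_fun :: "('m, 'e::euclidean_space) chart set \<Rightarrow> ('m \<Rightarrow> real) \<Rightarrow> bool" where
  "smooth_fun A f \<longleftrightarrow> (\<forall>C\<in>A. smooth_on (chart_map C ` chart_dom C) (f \<circ> chart_inv C))"

subsection \<open>Tangent vectors and vector fields\<close>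

text \<open>Each point has a preferred chart, and the tangent space at \<open>p\<close> is the model space \<open>'e\<close>
  itself: \<open>v :: 'e\<close> stands for the tangent vector at \<open>p\<close> whose coordinate representation in the
  preferred chart at \<open>p\<close> is \<open>v\<close>. Thus a field of tangent vectors is a function \<open>'m \<Rightarrow> 'e\<close>, a
  field of endomorphisms a function \<open>'m \<Rightarrow> 'e \<Rightarrow> 'e\<close>, and so on. Such a function is not read off
  in a single chart: the preferred chart may jump from point to point, and smoothness is
  expressed through \<open>local_rep\<close>.\<close>

definition chart_at :: "('m, 'e) chart set \<Rightarrow> 'm \<Rightarrow> ('m, 'e) chart" where
  "chart_at A p = (SOME C. C \<in> A \<and> p \<in> chart_dom C)"

text \<open>Coordinates, in the chart \<open>C\<close>, of the tangent vector \<open>v\<close> at \<open>p\<close>.\<close>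

definition tangent_coord ::
  "('m, 'e::euclidean_space) chart set \<Rightarrow> ('m, 'e) chart \<Rightarrow> 'm \<Rightarrow> 'e \<Rightarrow> 'e" where
  "tangent_coord A C p v =
     frechet_derivative (chart_map C \<circ> chart_inv (chart_at A p)) (at (chart_map (chart_at A p) p)) v"

definition local_rep ::
  "('m, 'e::euclidean_space) chart set \<Rightarrow> ('m, 'e) chart \<Rightarrow> ('m \<Rightarrow> 'e) \<Rightarrow> 'e \<Rightarrow> 'e" where
  "local_rep A C X x = tangent_coord A C (chart_inv C x) (X (chart_inv C x))"

definition vector_fields :: "('m, 'e::euclidean_space) chart set \<Rightarrow> ('m \<Rightarrow> 'e) set" where
  "vector_fields A = {X. \<forall>C\<in>A. smooth_on (chart_map C ` chart_dom C) (local_rep A C X)}"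

definition vf_apply ::
  "('m, 'e::euclidean_space) chart set \<Rightarrow> ('m \<Rightarrow> 'e) \<Rightarrow> ('m \<Rightarrow> real) \<Rightarrow> 'm \<Rightarrow> real" where
  "vf_apply A X f p =
     frechet_derivative (f \<circ> chart_inv (chart_at A p)) (at (chart_map (chart_at A p) p)) (X p)"

text \<open>In coordinates, \<open>[X, Y] = DY(X) - DX(Y)\<close>, so that \<open>[X, Y] f = X (Y f) - Y (X f)\<close>.\<close>

definition lie_bracket ::
  "('m, 'e::euclidean_space) chart set \<Rightarrow> ('m \<Rightarrow> 'e) \<Rightarrow> ('m \<Rightarrow> 'e) \<Rightarrow> 'm \<Rightarrow> 'e" where
  "lie_bracket A X Y p =
     (let C = chart_at A p; x = chart_map C p in
        frechet_derivative (local_rep A C Y) (at x) (X p) -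
        frechet_derivative (local_rep A C X) (at x) (Y p))"

section \<open>Tensor fields\<close>

definition one_form :: "('m, 'e::euclidean_space) chart set \<Rightarrow> ('m \<Rightarrow> 'e \<Rightarrow> real) \<Rightarrow> bool" where
  "one_form A \<alpha> \<longleftrightarrow> (\<forall>p. linear (\<alpha> p)) \<and>
     (\<forall>X\<in>vector_fields A. smooth_fun A (\<lambda>p. \<alpha> p (X p)))"

definition tensor11 :: "('m, 'e::euclidean_space) chart set \<Rightarrow> ('m \<Rightarrow> 'e \<Rightarrow> 'e) \<Rightarrow> bool" where
  "tensor11 A \<phi> \<longleftrightarrow> (\<forall>p. linear (\<phi> p)) \<and>
     (\<forall>X\<in>vector_fields A. (\<lambda>p. \<phi> p (X p)) \<in> vector_fields A)"

definition riemannian_metric ::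
  "('m, 'e::euclidean_space) chart set \<Rightarrow> ('m \<Rightarrow> 'e \<Rightarrow> 'e \<Rightarrow> real) \<Rightarrow> bool" where
  "riemannian_metric A g \<longleftrightarrow>
     (\<forall>p u. linear (g p u)) \<and> (\<forall>p u v. g p u v = g p v u) \<and> (\<forall>p v. v \<noteq> 0 \<longrightarrow> g p v v > 0) \<and>
     (\<forall>X\<in>vector_fields A. \<forall>Y\<in>vector_fields A. smooth_fun A (\<lambda>p. g p (X p) (Y p)))"

subsection \<open>Exterior algebra\<close>

text \<open>The convention for \<open>d\<alpha>\<close> carries the factor \<open>1/2\<close>.\<close>

definition d_fields ::
  "('m, 'e::euclidean_space) chart set \<Rightarrow> ('m \<Rightarrow> 'e \<Rightarrow> real) \<Rightarrow> ('m \<Rightarrow> 'e) \<Rightarrow> ('m \<Rightarrow> 'e) \<Rightarrow> 'm \<Rightarrow> real" where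
  "d_fields A \<alpha> X Y p =
     (1/2) * (vf_apply A X (\<lambda>q. \<alpha> q (Y q)) p - vf_apply A Y (\<lambda>q. \<alpha> q (X q)) p
              - \<alpha> p (lie_bracket A X Y p))"

text \<open>\<open>d\<alpha>\<close> as a bilinear form on the tangent space at \<open>p\<close>: since \<open>d_fields\<close> is tensorial for a
  one-form \<open>\<alpha>\<close>, its value at \<open>p\<close> depends on the values of the two vector fields at \<open>p\<close> only.\<close>

definition ext_d ::
  "('m, 'e::euclidean_space) chart set \<Rightarrow> ('m \<Rightarrow> 'e \<Rightarrow> real) \<Rightarrow> 'm \<Rightarrow> 'e \<Rightarrow> 'e \<Rightarrow> real" where
  "ext_d A \<alpha> p u v =
     (THE r. \<forall>X\<in>vector_fields A. \<forall>Y\<in>vector_fields A.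
        X p = u \<longrightarrow> Y p = v \<longrightarrow> d_fields A \<alpha> X Y p = r)"

text \<open>An exterior form of degree \<open>k\<close> on \<open>'e\<close> is a function of \<open>v :: nat \<Rightarrow> 'e\<close> that depends on
  \<open>v 0, \<dots>, v (k - 1)\<close> only. The normalisation \<open>\<omega> \<and> \<eta> = Alt (\<omega> \<otimes> \<eta>)\<close> is the one that goes
  with the factor \<open>1/2\<close> in \<open>d\<alpha>\<close>.\<close>

type_synonym 'e ext_form = "(nat \<Rightarrow> 'e) \<Rightarrow> real"

definition wedge :: "nat \<Rightarrow> nat \<Rightarrow> 'e ext_form \<Rightarrow> 'e ext_form \<Rightarrow> 'e ext_form" where
  "wedge k l \<omega> \<eta> v =
     (\<Sum>\<sigma> | \<sigma> permutes {..<k + l}.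
        of_int (sign \<sigma>) * \<omega> (\<lambda>i. v (\<sigma> i)) * \<eta> (\<lambda>i. v (\<sigma> (k + i)))) / fact (k + l)"

definition form1 :: "('e \<Rightarrow> real) \<Rightarrow> 'e ext_form" where
  "form1 a v = a (v 0)"

definition form2 :: "('e \<Rightarrow> 'e \<Rightarrow> real) \<Rightarrow> 'e ext_form" where
  "form2 b v = b (v 0) (v 1)"

primrec wedge_power2 :: "('e \<Rightarrow> 'e \<Rightarrow> real) \<Rightarrow> nat \<Rightarrow> 'e ext_form" where
  "wedge_power2 b 0 = (\<lambda>v. 1)"
| "wedge_power2 b (Suc n) = wedge 2 (2 * n) (form2 b) (wedge_power2 b n)"

subsection \<open>Levi-Civita connection\<close>

definition affine_connection ::
  "('m, 'e::euclidean_space) chart set \<Rightarrow> (('m \<Rightarrow> 'e) \<Rightarrow> ('m \<Rightarrow> 'e) \<Rightarrow> 'm \<Rightarrow> 'e) \<Rightarrow> bool" where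
  "affine_connection A nabla \<longleftrightarrow>
     (\<forall>X\<in>vector_fields A. \<forall>Y\<in>vector_fields A. nabla X Y \<in> vector_fields A) \<and>
     (\<forall>X\<in>vector_fields A. \<forall>X'\<in>vector_fields A. \<forall>Y\<in>vector_fields A. \<forall>p.
        nabla (\<lambda>q. X q + X' q) Y p = nabla X Y p + nabla X' Y p) \<and>
     (\<forall>f X. smooth_fun A f \<longrightarrow> X \<in> vector_fields A \<longrightarrow> (\<forall>Y\<in>vector_fields A. \<forall>p.
        nabla (\<lambda>q. f q *\<^sub>R X q) Y p = f p *\<^sub>R nabla X Y p)) \<and>
     (\<forall>X\<in>vector_fields A. \<forall>Y\<in>vector_fields A. \<forall>Y'\<in>vector_fields A. \<forall>p.
        nabla X (\<lambda>q. Y q + Y' q) p = nabla X Y p + nabla X Y' p) \<and>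
     (\<forall>f X. smooth_fun A f \<longrightarrow> X \<in> vector_fields A \<longrightarrow> (\<forall>Y\<in>vector_fields A. \<forall>p.
        nabla X (\<lambda>q. f q *\<^sub>R Y q) p = vf_apply A X f p *\<^sub>R Y p + f p *\<^sub>R nabla X Y p))"

definition levi_civita ::
  "('m, 'e::euclidean_space) chart set \<Rightarrow> ('m \<Rightarrow> 'e \<Rightarrow> 'e \<Rightarrow> real) \<Rightarrow>
   (('m \<Rightarrow> 'e) \<Rightarrow> ('m \<Rightarrow> 'e) \<Rightarrow> 'm \<Rightarrow> 'e) \<Rightarrow> bool" where
  "levi_civita A g nabla \<longleftrightarrow> affine_connection A nabla \<and>
     (\<forall>X\<in>vector_fields A. \<forall>Y\<in>vector_fields A. \<forall>p.
        nabla X Y p - nabla Y X p = lie_bracket A X Y p) \<and>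
     (\<forall>X\<in>vector_fields A. \<forall>Y\<in>vector_fields A. \<forall>W\<in>vector_fields A. \<forall>p.
        vf_apply A X (\<lambda>q. g q (Y q) (W q)) p = g p (nabla X Y p) (W p) + g p (Y p) (nabla X W p))"

definition nabla_tensor11 ::
  "(('m \<Rightarrow> 'e) \<Rightarrow> ('m \<Rightarrow> 'e) \<Rightarrow> 'm \<Rightarrow> 'e) \<Rightarrow> ('m \<Rightarrow> 'e \<Rightarrow> 'e) \<Rightarrow>
   ('m \<Rightarrow> 'e) \<Rightarrow> ('m \<Rightarrow> 'e) \<Rightarrow> 'm \<Rightarrow> 'e::euclidean_space" where
  "nabla_tensor11 nabla \<phi> X Y p = nabla X (\<lambda>q. \<phi> q (Y q)) p - \<phi> p (nabla X Y p)"

subsection \<open>Integrability of almost complex structures\<close>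

definition nijenhuis ::
  "('m, 'e::euclidean_space) chart set \<Rightarrow> ('m \<Rightarrow> 'e \<Rightarrow> 'e) \<Rightarrow> ('m \<Rightarrow> 'e) \<Rightarrow> ('m \<Rightarrow> 'e) \<Rightarrow> 'm \<Rightarrow> 'e" where
  "nijenhuis A \<phi> X Y p =
     \<phi> p (\<phi> p (lie_bracket A X Y p)) - \<phi> p (lie_bracket A (\<lambda>q. \<phi> q (X q)) Y p)
     - \<phi> p (lie_bracket A X (\<lambda>q. \<phi> q (Y q)) p)
     + lie_bracket A (\<lambda>q. \<phi> q (X q)) (\<lambda>q. \<phi> q (Y q)) p"

definition almost_complex :: "('m, 'e::euclidean_space) chart set \<Rightarrow> ('m \<Rightarrow> 'e \<Rightarrow> 'e) \<Rightarrow> bool" where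
  "almost_complex A J \<longleftrightarrow> tensor11 A J \<and> (\<forall>p v. J p (J p v) = - v)"

text \<open>Integrability is the vanishing of the Nijenhuis torsion; by the Newlander-Nirenberg
  theorem this amounts to \<open>J\<close> being induced by a complex atlas.\<close>

definition integrable_almost_complex ::
  "('m, 'e::euclidean_space) chart set \<Rightarrow> ('m \<Rightarrow> 'e \<Rightarrow> 'e) \<Rightarrow> bool" where
  "integrable_almost_complex A J \<longleftrightarrow> almost_complex A J \<and>
     (\<forall>X\<in>vector_fields A. \<forall>Y\<in>vector_fields A. \<forall>p. nijenhuis A J X Y p = 0)"

section \<open>Contact pairs\<close>

definition contact_pair ::
  "('m, 'e::euclidean_space) chart set \<Rightarrow> nat \<Rightarrow> nat \<Rightarrow> ('m \<Rightarrow> 'e \<Rightarrow> real) \<Rightarrow> ('m \<Rightarrow> 'e \<Rightarrow> real) \<Rightarrow> bool" where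
  "contact_pair A h k \<alpha>1 \<alpha>2 \<longleftrightarrow>
     one_form A \<alpha>1 \<and> one_form A \<alpha>2 \<and>
     DIM('e) = 2 * h + 2 * k + 2 \<and>
     (\<forall>p. \<exists>v. wedge (2 * h + 1) (2 * k + 1)
        (wedge 1 (2 * h) (form1 (\<alpha>1 p)) (wedge_power2 (ext_d A \<alpha>1 p) h))
        (wedge 1 (2 * k) (form1 (\<alpha>2 p)) (wedge_power2 (ext_d A \<alpha>2 p) k)) v \<noteq> 0) \<and>
     (\<forall>p v. wedge_power2 (ext_d A \<alpha>1 p) (h + 1) v = 0) \<and>
     (\<forall>p v. wedge_power2 (ext_d A \<alpha>2 p) (k + 1) v = 0)"

definition reeb_fields ::
  "('m, 'e::euclidean_space) chart set \<Rightarrow> ('m \<Rightarrow> 'e \<Rightarrow> real) \<Rightarrow> ('m \<Rightarrow> 'e \<Rightarrow> real) \<Rightarrow>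
   ('m \<Rightarrow> 'e) \<Rightarrow> ('m \<Rightarrow> 'e) \<Rightarrow> bool" where
  "reeb_fields A \<alpha>1 \<alpha>2 Z1 Z2 \<longleftrightarrow>
     Z1 \<in> vector_fields A \<and> Z2 \<in> vector_fields A \<and>
     (\<forall>p. \<alpha>1 p (Z1 p) = 1 \<and> \<alpha>1 p (Z2 p) = 0 \<and> \<alpha>2 p (Z1 p) = 0 \<and> \<alpha>2 p (Z2 p) = 1) \<and>
     (\<forall>Z\<in>{Z1, Z2}. \<forall>\<alpha>\<in>{\<alpha>1, \<alpha>2}. \<forall>p v. ext_d A \<alpha> p (Z p) v = 0)"

text \<open>The tangent space at \<open>p\<close> of the characteristic foliation of \<open>\<alpha>\<close>.\<close>

definition char_foliation ::
  "('m, 'e::euclidean_space) chart set \<Rightarrow> ('m \<Rightarrow> 'e \<Rightarrow> real) \<Rightarrow> 'm \<Rightarrow> 'e set" where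
  "char_foliation A \<alpha> p = {v. \<alpha> p v = 0 \<and> (\<forall>w. ext_d A \<alpha> p v w = 0)}"

definition contact_pair_structure ::
  "('m, 'e::euclidean_space) chart set \<Rightarrow> nat \<Rightarrow> nat \<Rightarrow> ('m \<Rightarrow> 'e \<Rightarrow> real) \<Rightarrow> ('m \<Rightarrow> 'e \<Rightarrow> real) \<Rightarrow>
   ('m \<Rightarrow> 'e) \<Rightarrow> ('m \<Rightarrow> 'e) \<Rightarrow> ('m \<Rightarrow> 'e \<Rightarrow> 'e) \<Rightarrow> bool" where
  "contact_pair_structure A h k \<alpha>1 \<alpha>2 Z1 Z2 \<phi> \<longleftrightarrow>
     contact_pair A h k \<alpha>1 \<alpha>2 \<and> reeb_fields A \<alpha>1 \<alpha>2 Z1 Z2 \<and> tensor11 A \<phi> \<and>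
     (\<forall>p v. \<phi> p (\<phi> p v) = - v + \<alpha>1 p v *\<^sub>R Z1 p + \<alpha>2 p v *\<^sub>R Z2 p) \<and>
     (\<forall>p. \<phi> p (Z1 p) = 0 \<and> \<phi> p (Z2 p) = 0)"

definition decomposable ::
  "('m, 'e::euclidean_space) chart set \<Rightarrow> ('m \<Rightarrow> 'e \<Rightarrow> real) \<Rightarrow> ('m \<Rightarrow> 'e \<Rightarrow> real) \<Rightarrow>
   ('m \<Rightarrow> 'e \<Rightarrow> 'e) \<Rightarrow> bool" where
  "decomposable A \<alpha>1 \<alpha>2 \<phi> \<longleftrightarrow>
     (\<forall>\<alpha>\<in>{\<alpha>1, \<alpha>2}. \<forall>p. \<phi> p ` char_foliation A \<alpha> p \<subseteq> char_foliation A \<alpha> p)"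

definition compatible_metric ::
  "('m, 'e::euclidean_space) chart set \<Rightarrow> ('m \<Rightarrow> 'e \<Rightarrow> real) \<Rightarrow> ('m \<Rightarrow> 'e \<Rightarrow> real) \<Rightarrow>
   ('m \<Rightarrow> 'e \<Rightarrow> 'e) \<Rightarrow> ('m \<Rightarrow> 'e \<Rightarrow> 'e \<Rightarrow> real) \<Rightarrow> bool" where
  "compatible_metric A \<alpha>1 \<alpha>2 \<phi> g \<longleftrightarrow> riemannian_metric A g \<and>
     (\<forall>p u v. g p (\<phi> p u) (\<phi> p v) = g p u v - \<alpha>1 p u * \<alpha>1 p v - \<alpha>2 p u * \<alpha>2 p v)"

definition associated_metric ::
  "('m, 'e::euclidean_space) chart set \<Rightarrow> ('m \<Rightarrow> 'e \<Rightarrow> real) \<Rightarrow> ('m \<Rightarrow> 'e \<Rightarrow> real) \<Rightarrow>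
   ('m \<Rightarrow> 'e) \<Rightarrow> ('m \<Rightarrow> 'e) \<Rightarrow> ('m \<Rightarrow> 'e \<Rightarrow> 'e) \<Rightarrow> ('m \<Rightarrow> 'e \<Rightarrow> 'e \<Rightarrow> real) \<Rightarrow> bool" where
  "associated_metric A \<alpha>1 \<alpha>2 Z1 Z2 \<phi> g \<longleftrightarrow> riemannian_metric A g \<and>
     (\<forall>p u v. g p u (\<phi> p v) = ext_d A \<alpha>1 p u v + ext_d A \<alpha>2 p u v) \<and>
     (\<forall>p v. g p v (Z1 p) = \<alpha>1 p v \<and> g p v (Z2 p) = \<alpha>2 p v)"

definition metric_contact_pair ::
  "('m, 'e::euclidean_space) chart set \<Rightarrow> nat \<Rightarrow> nat \<Rightarrow> ('m \<Rightarrow> 'e \<Rightarrow> real) \<Rightarrow> ('m \<Rightarrow> 'e \<Rightarrow> real) \<Rightarrow>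
   ('m \<Rightarrow> 'e) \<Rightarrow> ('m \<Rightarrow> 'e) \<Rightarrow> ('m \<Rightarrow> 'e \<Rightarrow> 'e) \<Rightarrow> ('m \<Rightarrow> 'e \<Rightarrow> 'e \<Rightarrow> real) \<Rightarrow> bool" where
  "metric_contact_pair A h k \<alpha>1 \<alpha>2 Z1 Z2 \<phi> g \<longleftrightarrow>
     contact_pair_structure A h k \<alpha>1 \<alpha>2 Z1 Z2 \<phi> \<and> associated_metric A \<alpha>1 \<alpha>2 Z1 Z2 \<phi> g"

definition normal_structure ::
  "('m, 'e::euclidean_space) chart set \<Rightarrow> ('m \<Rightarrow> 'e \<Rightarrow> real) \<Rightarrow> ('m \<Rightarrow> 'e \<Rightarrow> real) \<Rightarrow>
   ('m \<Rightarrow> 'e) \<Rightarrow> ('m \<Rightarrow> 'e) \<Rightarrow> ('m \<Rightarrow> 'e \<Rightarrow> 'e) \<Rightarrow> bool" where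
  "normal_structure A \<alpha>1 \<alpha>2 Z1 Z2 \<phi> \<longleftrightarrow>
     integrable_almost_complex A (\<lambda>p v. \<phi> p v - \<alpha>2 p v *\<^sub>R Z1 p + \<alpha>1 p v *\<^sub>R Z2 p) \<and>
     integrable_almost_complex A (\<lambda>p v. \<phi> p v + \<alpha>2 p v *\<^sub>R Z1 p - \<alpha>1 p v *\<^sub>R Z2 p)"

definition orth_proj :: "('e \<Rightarrow> 'e \<Rightarrow> real) \<Rightarrow> 'e set \<Rightarrow> 'e \<Rightarrow> 'e::real_vector" where
  "orth_proj b S v = (THE w. w \<in> S \<and> (\<forall>u\<in>S. b (v - w) u = 0))"

definition field_proj ::
  "('m \<Rightarrow> 'e \<Rightarrow> 'e \<Rightarrow> real) \<Rightarrow> ('m \<Rightarrow> 'e set) \<Rightarrow> ('m \<Rightarrow> 'e) \<Rightarrow> 'm \<Rightarrow> 'e::real_vector" where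
  "field_proj g D X p = orth_proj (g p) (D p) (X p)"

end

theory Submission
  imports Defs
begin

text \<open>
  Write \<open>b\<^sub>i = d\<alpha>\<^sub>i\<close>, \<open>J = \<phi> - \<alpha>\<^sub>2 \<otimes> Z\<^sub>1 + \<alpha>\<^sub>1 \<otimes> Z\<^sub>2\<close> and \<open>T = \<phi> + \<alpha>\<^sub>2 \<otimes> Z\<^sub>1 - \<alpha>\<^sub>1 \<otimes> Z\<^sub>2\<close>. If \<open>J\<close> is
  integrable and Hermitian, \<open>\<nabla>J\<close> is determined by the cyclic sum of \<open>g((\<nabla>\<^sub>X J) Y, W)\<close>; for an associated
  metric \<open>b\<^sub>1 + b\<^sub>2\<close> is the fundamental form of \<open>\<phi>\<close>, so \<open>d\<^sup>2 = 0\<close> leaves only the contribution of the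
  correction term \<open>\<alpha>\<^sub>1 \<otimes> Z\<^sub>2 - \<alpha>\<^sub>2 \<otimes> Z\<^sub>1\<close>, which is algebraic in \<open>\<alpha>\<^sub>i\<close> and \<open>b\<^sub>i\<close>. Averaging over \<open>J\<close> and \<open>T\<close> gives
  \<open>g((\<nabla>\<^sub>X \<phi>) Y, W) = \<Sum>\<^sub>i [b\<^sub>i(X, \<phi>W) \<alpha>\<^sub>i(Y) - b\<^sub>i(X, \<phi>Y) \<alpha>\<^sub>i(W)]\<close>, and the orthogonal splitting
  \<open>TM = T\<F>\<^sub>1 \<oplus> T\<F>\<^sub>2\<close> turns this into the formula. Conversely, the formula at \<open>Y = Z\<^sub>i\<close> gives
  \<open>\<nabla>\<^sub>X Z\<^sub>i = - \<phi> X\<^sub>i\<close>, hence \<open>b\<^sub>i\<close>, orthogonality of the foliations, \<open>b\<^sub>1 + b\<^sub>2 = g(\<cdot>, \<phi>\<cdot>)\<close> and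
  \<open>\<nabla>\<^bsub>JX\<^esub> J = J \<nabla>\<^sub>X J\<close>, which kills the torsion of \<open>J\<close>; exchanging the indices treats \<open>T\<close>.

  The splitting rests on a dimension count: \<open>b\<^sub>1\<^bsup>h+1\<^esup> = 0\<close> and \<open>b\<^sub>2\<^bsup>k+1\<^esup> = 0\<close> bound the ranks, so the dimensions of
  the two characteristic foliations add up to at least \<open>dim M\<close>.
\<close>

section \<open>Powers of two-forms and the rank\<close>

text \<open>Transports \<open>p\<close> to the block \<open>{k..<k + n}\<close> and fixes all else.
  It serves to absorb the alternation inside a wedge factor into the outer alternation.\<close>

definition shift_perm :: "nat \<Rightarrow> nat \<Rightarrow> (nat \<Rightarrow> nat) \<Rightarrow> nat \<Rightarrow> nat" where
  "shift_perm k n p = map_permutation {..<n} (\<lambda>i. k + i) p"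

lemma bij_betw_shift: "bij_betw (\<lambda>i. k + i) {..<n} {k..<k + n::nat}"
proof -
  have "(\<lambda>i. k + i) ` {..<n} = {k..<k + n}"
    unfolding lessThan_atLeast0 image_add_atLeastLessThan by (simp add: add.commute)
  then show ?thesis by (simp add: bij_betw_def inj_on_def)
qed

lemma shift_perm_permutes':
  assumes "p permutes {..<n}" shows "shift_perm k n p permutes {k..<k + n}"
  unfolding shift_perm_def by (rule map_permutation_permutes[OF bij_betw_shift assms])

lemma shift_perm_permutes:
  assumes "p permutes {..<n}" shows "shift_perm k n p permutes {..<k + n}"
  by (rule permutes_subset[OF shift_perm_permutes'[OF assms]]) auto

lemma sign_shift_perm:
  assumes "p permutes {..<n}" shows "sign (shift_perm k n p) = sign p"
  unfolding shift_perm_def by (rule sign_map_permutation) (use assms in auto)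

lemma shift_perm_add: "i < n \<Longrightarrow> shift_perm k n p (k + i) = k + p i"
  unfolding shift_perm_def by (subst map_permutation_apply) auto

lemma shift_perm_less: "p permutes {..<n} \<Longrightarrow> i < k \<Longrightarrow> shift_perm k n p i = i"
  using shift_perm_permutes'[of p n k] by (auto simp: permutes_def)

text \<open>A permutation of \<open>{..<k + n}\<close> fixing every \<open>i < k\<close> permutes
  \<open>{k..<k + n}\<close>, so transporting it back along \<open>i - k\<close> inverts
  \<open>shift_perm\<close>.\<close>

lemma bij_betw_shift_perm:
  "bij_betw (shift_perm k n) {p. p permutes {..<n}} {p. p permutes {..<k + n} \<and> (\<forall>i<k. p i = i)}"
proof (rule bij_betw_byWitness)
  let ?g = "map_permutation {k..<k + n} (\<lambda>i. i - k)"
  show "\<forall>p\<in>{p. p permutes {..<n}}. ?g (shift_perm k n p) = p"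
    unfolding shift_perm_def by (auto intro!: map_permutation_compose_inv bij_betw_shift)
  have fix_perm: "p permutes {k..<k + n}" if "p permutes {..<k + n}" "\<forall>i<k. p i = i" for p
    by (rule permutes_superset[OF that(1)]) (use that(2) in auto)
  have bij: "bij_betw (\<lambda>i. i - k) {k..<k + n} {..<n}"
    by (rule bij_betw_byWitness[where f' = "\<lambda>i. k + i"]) auto
  show "\<forall>p\<in>{p. p permutes {..<k + n} \<and> (\<forall>i<k. p i = i)}. shift_perm k n (?g p) = p"
    unfolding shift_perm_def by (auto intro!: map_permutation_compose_inv bij fix_perm)
  show "shift_perm k n ` {p. p permutes {..<n}} \<subseteq> {p. p permutes {..<k + n} \<and> (\<forall>i<k. p i = i)}"
    by (auto simp: shift_perm_permutes shift_perm_less)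
  show "?g ` {p. p permutes {..<k + n} \<and> (\<forall>i<k. p i = i)} \<subseteq> {p. p permutes {..<n}}"
    using map_permutation_permutes[OF bij] fix_perm by auto
qed

definition pairing_term :: "('e \<Rightarrow> 'e \<Rightarrow> real) \<Rightarrow> nat \<Rightarrow> (nat \<Rightarrow> 'e) \<Rightarrow> (nat \<Rightarrow> nat) \<Rightarrow> real" where
  "pairing_term b n v \<sigma> = of_int (sign \<sigma>) * (\<Prod>i<n. b (v (\<sigma> (2 * i))) (v (\<sigma> (2 * i + 1))))"

text \<open>For skew \<open>b\<close> this is \<open>2^n * n!\<close> times the Pfaffian of the
  matrix with entries \<open>b (v i) (v j)\<close>.\<close>

definition pairing_sum :: "('e \<Rightarrow> 'e \<Rightarrow> real) \<Rightarrow> nat \<Rightarrow> (nat \<Rightarrow> 'e) \<Rightarrow> real" where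
  "pairing_sum b n v = (\<Sum>\<sigma> | \<sigma> permutes {..<2 * n}. pairing_term b n v \<sigma>)"

lemma pairing_term_Suc:
  "pairing_term b (Suc n) v \<sigma> = of_int (sign \<sigma>) * b (v (\<sigma> 0)) (v (\<sigma> 1)) *
     (\<Prod>i<n. b (v (\<sigma> (2 + 2 * i))) (v (\<sigma> (2 + (2 * i + 1)))))"
  unfolding pairing_term_def by (subst prod.lessThan_Suc_shift) (simp add: algebra_simps)

lemma permutes_sign_compose:
  assumes "p permutes {..<n::nat}" "q permutes {..<n}" shows "sign (p \<circ> q) = sign p * sign q"
  using assms by (intro sign_compose) (auto intro: permutes_imp_permutation[of "{..<n}"])

lemma pairing_term_shift:
  assumes "\<sigma> permutes {..<2 * Suc n}" "\<rho> permutes {..<2 * n}"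
  shows "pairing_term b (Suc n) v (\<sigma> \<circ> shift_perm 2 (2 * n) \<rho>) =
    of_int (sign \<sigma>) * b (v (\<sigma> 0)) (v (\<sigma> 1)) * pairing_term b n (\<lambda>i. v (\<sigma> (2 + i))) \<rho>"
proof -
  have sg: "sign (\<sigma> \<circ> shift_perm 2 (2 * n) \<rho>) = sign \<sigma> * sign \<rho>"
    using permutes_sign_compose[of \<sigma> "2 * Suc n" "shift_perm 2 (2 * n) \<rho>"]
      shift_perm_permutes[OF assms(2), of 2] assms by (simp add: sign_shift_perm)
  have "shift_perm 2 (2 * n) \<rho> (2 + (2 * i + 1)) = 2 + \<rho> (2 * i + 1)" if "i < n" for i
    by (rule shift_perm_add) (use that in simp)
  then have *: "(\<Prod>i<n. b (v ((\<sigma> \<circ> shift_perm 2 (2 * n) \<rho>) (2 + 2 * i)))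
      (v ((\<sigma> \<circ> shift_perm 2 (2 * n) \<rho>) (2 + (2 * i + 1)))))
    = (\<Prod>i<n. b (v (\<sigma> (2 + \<rho> (2 * i)))) (v (\<sigma> (2 + \<rho> (2 * i + 1)))))"
    by (intro prod.cong refl) (simp only: o_apply shift_perm_add lessThan_iff mult_less_cancel1 zero_less_numeral simp_thms)
  show ?thesis
    unfolding pairing_term_Suc sg *
    by (simp add: pairing_term_def shift_perm_less[OF assms(2)])
qed

text \<open>By induction on \<open>n\<close>. Each permutation \<open>\<rho>\<close> of the inner
  alternation is absorbed into the outer one by composing \<open>\<sigma>\<close> with the shifted
  \<open>\<rho>\<close>. Every \<open>\<rho>\<close> then contributes the same sum, and their number
  cancels the inner factor \<open>1 / fact (2 * n)\<close>.\<close>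

lemma wedge_power2_eq_pairing_sum:
  "wedge_power2 b n v = pairing_sum b n v / fact (2 * n)"
proof (induction n arbitrary: v)
  case 0
  then show ?case by (simp add: pairing_sum_def pairing_term_def)
next
  case (Suc n)
  let ?P = "\<lambda>n. {\<sigma>. \<sigma> permutes {..<2 * n}}"
  have "(\<Sum>\<sigma>\<in>?P (Suc n). of_int (sign \<sigma>) * b (v (\<sigma> 0)) (v (\<sigma> 1)) * pairing_sum b n (\<lambda>i. v (\<sigma> (2 + i))))
    = (\<Sum>\<sigma>\<in>?P (Suc n). \<Sum>\<rho>\<in>?P n. pairing_term b (Suc n) v (\<sigma> \<circ> shift_perm 2 (2 * n) \<rho>))"
    by (intro sum.cong refl) (simp add: pairing_sum_def sum_distrib_left pairing_term_shift del: add_2_eq_Suc mult_Suc_right)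
  also have "\<dots> = (\<Sum>\<rho>\<in>?P n. \<Sum>\<sigma>\<in>?P (Suc n). pairing_term b (Suc n) v (\<sigma> \<circ> shift_perm 2 (2 * n) \<rho>))"
    by (rule sum.swap)
  also have "\<dots> = (\<Sum>\<rho>\<in>?P n. pairing_sum b (Suc n) v)"
  proof (rule sum.cong[OF refl])
    fix \<rho> assume "\<rho> \<in> ?P n"
    then have "shift_perm 2 (2 * n) \<rho> permutes {..<2 * Suc n}"
      using shift_perm_permutes[of \<rho> "2 * n" 2] by simp
    from sum_permutations_compose_right[OF this, of "pairing_term b (Suc n) v"]
    show "(\<Sum>\<sigma>\<in>?P (Suc n). pairing_term b (Suc n) v (\<sigma> \<circ> shift_perm 2 (2 * n) \<rho>)) = pairing_sum b (Suc n) v"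
      by (simp add: pairing_sum_def)
  qed
  also have "\<dots> = fact (2 * n) * pairing_sum b (Suc n) v"
    by (simp add: card_permutations)
  finally have *: "(\<Sum>\<sigma>\<in>?P (Suc n). of_int (sign \<sigma>) * b (v (\<sigma> 0)) (v (\<sigma> 1)) * pairing_sum b n (\<lambda>i. v (\<sigma> (2 + i))))
    = fact (2 * n) * pairing_sum b (Suc n) v" .
  have "wedge_power2 b (Suc n) v =
    (\<Sum>\<sigma>\<in>?P (Suc n). of_int (sign \<sigma>) * b (v (\<sigma> 0)) (v (\<sigma> 1)) * pairing_sum b n (\<lambda>i. v (\<sigma> (2 + i)))) / fact (2 * n) / fact (2 * Suc n)"
    by (simp add: wedge_def form2_def Suc sum_divide_distrib)
  also have "\<dots> = pairing_sum b (Suc n) v / fact (2 * Suc n)"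
    unfolding * by simp
  finally show ?case .
qed

text \<open>Exchanging two whole pairs is a product of two transpositions, hence even, and merely
  reorders the factors of the product.\<close>

lemma pairing_term_swap_pairs:
  assumes "\<sigma> permutes {..<2 * n}" "k < n" "0 < k"
  defines "\<tau> \<equiv> Transposition.transpose 0 (2 * k) \<circ> Transposition.transpose 1 (2 * k + 1)"
  shows "pairing_term b n v (\<sigma> \<circ> \<tau>) = pairing_term b n v \<sigma>"
proof -
  have t: "Transposition.transpose 0 (2 * k) permutes {..<2 * n}" "Transposition.transpose 1 (2 * k + 1) permutes {..<2 * n}"
    using assms by (auto intro!: permutes_swap_id)
  have s\<tau>: "sign \<tau> = 1"
    unfolding \<tau>_def by (subst permutes_sign_compose[OF t]) (use assms in \<open>auto simp: sign_swap_id\<close>)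
  have sg: "sign (\<sigma> \<circ> \<tau>) = sign \<sigma>"
    using permutes_sign_compose[of \<sigma> "2 * n" \<tau>] assms(1) permutes_compose[OF t(2) t(1)] s\<tau>
    by (simp add: \<tau>_def)
  have ev: "\<tau> (2 * i) = 2 * Transposition.transpose 0 k i" "\<tau> (2 * i + 1) = 2 * Transposition.transpose 0 k i + 1" for i
  proof -
    show "\<tau> (2 * i) = 2 * Transposition.transpose 0 k i"
      using \<open>0 < k\<close> by (simp add: \<tau>_def Transposition.transpose_def)
    show "\<tau> (2 * i + 1) = 2 * Transposition.transpose 0 k i + 1"
      using \<open>0 < k\<close> by (simp add: \<tau>_def Transposition.transpose_def)
  qed
  have "bij_betw (Transposition.transpose 0 k) {..<n} {..<n}"
    using assms by (intro permutes_imp_bij permutes_swap_id) auto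
  from prod.reindex_bij_betw[OF this, of "\<lambda>i. b (v (\<sigma> (2 * i))) (v (\<sigma> (2 * i + 1)))"]
  show ?thesis by (simp only: pairing_term_def sg o_apply ev)
qed

text \<open>Pfaffian expansion along the index 1. In a nonzero term, 1 can only be paired with 0.
  This pair can sit in \<open>n + 1\<close> places and in two orders, which explains the factor
  \<open>2 * real (Suc n)\<close>; what remains is a sum over the permutations of the other
  \<open>2 * n\<close> indices.\<close>

lemma pairing_sum_contract:
  assumes skew: "\<And>x y. b x y = - b y x" and orth: "\<And>i. i < 2 * n \<Longrightarrow> b (v 1) (v (2 + i)) = 0"
  shows "pairing_sum b (Suc n) v = 2 * real (Suc n) * b (v 0) (v 1) * pairing_sum b n (\<lambda>i. v (2 + i))"
proof -
  let ?N = "2 * Suc n" and ?F = "pairing_term b (Suc n) v"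
  let ?P = "{\<sigma>. \<sigma> permutes {..<2 * Suc n}}"
  \<comment> \<open>\<open>S\<close> says that the \<open>k\<close>-th pair of
    \<open>\<sigma>\<close> is \<open>{0, 1}\<close> in one of the two orders.\<close>
  define S where "S \<sigma> k \<longleftrightarrow> {\<sigma> (2 * k), \<sigma> (2 * k + 1)} = {0, 1}" for \<sigma> :: "nat \<Rightarrow> nat" and k
  have b11: "b (v 1) (v 1) = 0" using skew[of "v 1" "v 1"] by simp
  have partner: "x = 0" if "b (v 1) (v x) \<noteq> 0 \<or> b (v x) (v 1) \<noteq> 0" "x < ?N" for x
  proof (rule ccontr)
    assume "x \<noteq> 0"
    moreover have "x \<noteq> 1" using that skew[of "v x" "v 1"] b11 by auto
    ultimately obtain i where "x = 2 + i" using le_Suc_ex[of 2 x] by auto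
    then show False using orth[of i] that skew[of "v x" "v 1"] by auto
  qed
  have inj: "inj \<sigma>" if "\<sigma> \<in> ?P" for \<sigma> using that permutes_inj by auto
  \<comment> \<open>For a nonzero term exactly one \<open>k\<close> satisfies \<open>S\<close>: the
    pair containing the preimage of 1. The inner sum therefore has a single summand.\<close>
  have split: "?F \<sigma> = (\<Sum>k<Suc n. if S \<sigma> k then ?F \<sigma> else 0)" if \<sigma>: "\<sigma> \<in> ?P" for \<sigma>
  proof (cases "?F \<sigma> = 0")
    case False
    have surj: "\<exists>j<?N. \<sigma> j = 1"
    proof -
      have "1 \<in> \<sigma> ` {..<?N}" using permutes_image[of \<sigma> "{..<?N}"] \<sigma> by simp
      then show ?thesis by force
    qed
    then obtain j where j: "j < ?N" "\<sigma> j = 1" by blast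
    define k where "k = j div 2"
    have k: "k < Suc n" using j by (simp add: k_def)
    have nz: "b (v (\<sigma> (2 * k))) (v (\<sigma> (2 * k + 1))) \<noteq> 0"
      using False k unfolding pairing_term_def by (auto simp del: prod.lessThan_Suc)
    have lt: "\<sigma> i < ?N" if "i < ?N" for i
      using permutes_in_image[of \<sigma> "{..<?N}" i] \<sigma> that by auto
    have Sk: "S \<sigma> k"
    proof (cases "even j")
      case True
      then have "j = 2 * k" by (simp add: k_def)
      then show ?thesis using nz j partner[of "\<sigma> (2 * k + 1)"] lt[of "2 * k + 1"] k
        by (auto simp: S_def)
    next
      case False
      then have "j = 2 * k + 1" by (simp add: k_def)
      then show ?thesis using nz j partner[of "\<sigma> (2 * k)"] lt[of "2 * k"] k
        by (auto simp: S_def)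
    qed
    have "k' = k" if "S \<sigma> k'" for k'
    proof -
      have "j = 2 * k' \<or> j = 2 * k' + 1"
        using that j injD[OF inj[OF \<sigma>], of j] unfolding S_def by (metis insertCI insertE singletonD)
      then show ?thesis by (auto simp: k_def)
    qed
    then have "S \<sigma> k' \<longleftrightarrow> k' = k" for k' using Sk by blast
    then show ?thesis using k by (simp only: sum.delta finite_lessThan lessThan_iff if_True)
  next
    case True
    then show ?thesis by (simp only: if_cancel sum.neutral_const)
  qed
  \<comment> \<open>Composing with the exchange of pair 0 and pair \<open>k\<close> moves the
    distinguished pair to the front without changing the term.\<close>
  have indep: "(\<Sum>\<sigma>\<in>?P. if S \<sigma> k then ?F \<sigma> else 0) = (\<Sum>\<sigma>\<in>?P. if S \<sigma> 0 then ?F \<sigma> else 0)"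
    if k: "k < Suc n" for k
  proof (cases "k = 0")
    case False
    let ?\<tau> = "Transposition.transpose 0 (2 * k) \<circ> Transposition.transpose 1 (2 * k + 1)"
    have t: "Transposition.transpose 0 (2 * k) permutes {..<?N}" "Transposition.transpose 1 (2 * k + 1) permutes {..<?N}"
      using k by (auto intro!: permutes_swap_id)
    have "(\<Sum>\<sigma>\<in>?P. if S \<sigma> k then ?F \<sigma> else 0) = (\<Sum>\<sigma>\<in>?P. if S (\<sigma> \<circ> ?\<tau>) k then ?F (\<sigma> \<circ> ?\<tau>) else 0)"
      using sum_permutations_compose_right[OF permutes_compose[OF t(2) t(1)],
          of "\<lambda>\<sigma>. if S \<sigma> k then ?F \<sigma> else 0"] .
    also have "\<dots> = (\<Sum>\<sigma>\<in>?P. if S \<sigma> 0 then ?F \<sigma> else 0)"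
    proof (rule sum.cong[OF refl])
      fix \<sigma> assume \<sigma>: "\<sigma> \<in> ?P"
      have "?F (\<sigma> \<circ> ?\<tau>) = ?F \<sigma>" using pairing_term_swap_pairs[of \<sigma> "Suc n" k] \<sigma> k False by simp
      moreover have "S (\<sigma> \<circ> ?\<tau>) k \<longleftrightarrow> S \<sigma> 0"
        using False by (auto simp: S_def Transposition.transpose_def)
      ultimately show "(if S (\<sigma> \<circ> ?\<tau>) k then ?F (\<sigma> \<circ> ?\<tau>) else 0) = (if S \<sigma> 0 then ?F \<sigma> else 0)"
        by simp
    qed
    finally show ?thesis .
  qed simp
  have "pairing_sum b (Suc n) v = (\<Sum>\<sigma>\<in>?P. \<Sum>k<Suc n. if S \<sigma> k then ?F \<sigma> else 0)"
    unfolding pairing_sum_def by (rule sum.cong[OF refl split])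
  also have "\<dots> = (\<Sum>k<Suc n. \<Sum>\<sigma>\<in>?P. if S \<sigma> k then ?F \<sigma> else 0)" by (rule sum.swap)
  also have "\<dots> = (\<Sum>k<Suc n. \<Sum>\<sigma>\<in>?P. if S \<sigma> 0 then ?F \<sigma> else 0)"
    by (rule sum.cong[OF refl indep]) simp
  also have "\<dots> = real (Suc n) * (\<Sum>\<sigma>\<in>?P. if S \<sigma> 0 then ?F \<sigma> else 0)" by simp
  finally have 1: "pairing_sum b (Suc n) v = real (Suc n) * (\<Sum>\<sigma>\<in>?P. if S \<sigma> 0 then ?F \<sigma> else 0)" .
  \<comment> \<open>\<open>?I\<close> keeps only the order 0, 1. The other order arises by composing
    with \<open>?t\<close>, whose sign is offset by the skewness of \<open>b\<close>.\<close>
  let ?I = "\<lambda>\<sigma>. if \<sigma> 0 = 0 \<and> \<sigma> 1 = 1 then ?F \<sigma> else 0"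
  let ?t = "Transposition.transpose 0 (1::nat)"
  have t: "?t permutes {..<?N}" by (rule permutes_swap_id) auto
  have Ft: "?F (\<sigma> \<circ> ?t) = ?F \<sigma>" if \<sigma>: "\<sigma> \<in> ?P" for \<sigma>
  proof -
    have "sign (\<sigma> \<circ> ?t) = - sign \<sigma>"
      using permutes_sign_compose[of \<sigma> ?N ?t] \<sigma> t by (simp add: sign_swap_id)
    then show ?thesis
      using skew[of "v (\<sigma> 1)" "v (\<sigma> 0)"] by (simp add: pairing_term_Suc Transposition.transpose_def)
  qed
  have "(\<Sum>\<sigma>\<in>?P. if S \<sigma> 0 then ?F \<sigma> else 0) = (\<Sum>\<sigma>\<in>?P. ?I \<sigma> + ?I (\<sigma> \<circ> ?t))"
  proof (rule sum.cong[OF refl])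
    fix \<sigma> assume "\<sigma> \<in> ?P"
    from Ft[OF this] show "(if S \<sigma> 0 then ?F \<sigma> else 0) = ?I \<sigma> + ?I (\<sigma> \<circ> ?t)"
      by (auto simp: S_def doubleton_eq_iff)
  qed
  also have "\<dots> = 2 * (\<Sum>\<sigma>\<in>?P. ?I \<sigma>)"
    using sum_permutations_compose_right[OF t, of ?I] by (simp add: sum.distrib)
  finally have 2: "(\<Sum>\<sigma>\<in>?P. if S \<sigma> 0 then ?F \<sigma> else 0) = 2 * (\<Sum>\<sigma>\<in>?P. ?I \<sigma>)" .
  have fixed: "{\<sigma> \<in> ?P. \<sigma> 0 = 0 \<and> \<sigma> 1 = 1} = {\<sigma>. \<sigma> permutes {..<2 + 2 * n} \<and> (\<forall>i<2. \<sigma> i = i)}"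
    by (auto simp: less_2_cases_iff)
  have "(\<Sum>\<sigma>\<in>?P. ?I \<sigma>) = (\<Sum>\<sigma> | \<sigma> permutes {..<2 + 2 * n} \<and> (\<forall>i<2. \<sigma> i = i). ?F \<sigma>)"
    unfolding fixed[symmetric] by (subst sum.inter_filter) (auto simp: finite_permutations)
  also have "\<dots> = (\<Sum>\<rho> | \<rho> permutes {..<2 * n}. ?F (shift_perm 2 (2 * n) \<rho>))"
    by (rule sum.reindex_bij_betw[OF bij_betw_shift_perm, symmetric])
  also have "\<dots> = b (v 0) (v 1) * pairing_sum b n (\<lambda>i. v (2 + i))"
    using pairing_term_shift[of id n _ b v]
    by (simp add: pairing_sum_def sum_distrib_left permutes_id)
  finally show ?thesis unfolding 1 2 by simp
qed

section \<open>Dimension counts for kernels of forms and sums of subspaces\<close>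

lemma dim_common_kernel:
  fixes f :: "'i \<Rightarrow> 'e::euclidean_space \<Rightarrow> real"
  assumes "finite I" "\<And>i. i \<in> I \<Longrightarrow> linear (f i)"
  shows "DIM('e) \<le> dim {v. \<forall>i\<in>I. f i v = 0} + card I"
proof -
  \<comment> \<open>Each functional is the inner product with a vector \<open>a i\<close>, so the
    common kernel is the orthogonal complement of a span of dimension at most
    \<open>card I\<close>.\<close>
  define a where "a i = (\<Sum>b\<in>Basis. f i b *\<^sub>R b)" for i
  have f: "f i v = a i \<bullet> v" if "i \<in> I" for i v
  proof -
    interpret linear "f i" using assms(2)[OF that] .
    have "f i v = f i (\<Sum>b\<in>Basis. (v \<bullet> b) *\<^sub>R b)" by (simp add: euclidean_representation)
    also have "\<dots> = (\<Sum>b\<in>Basis. (v \<bullet> b) * f i b)" by (simp add: sum scale)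
    finally show ?thesis by (simp add: a_def inner_sum_left inner_commute[of v] mult.commute)
  qed
  have "{v. \<forall>i\<in>I. f i v = 0} = {v \<in> UNIV. \<forall>x\<in>span (a ` I). orthogonal x v}" (is "_ = ?R")
  proof safe
    fix v x assume v: "\<forall>i\<in>I. f i v = 0" and "x \<in> span (a ` I)"
    then have "orthogonal v x"
      by (intro orthogonal_to_span[of x "a ` I"]) (auto simp: orthogonal_def f inner_commute)
    then show "orthogonal x v" by (simp add: orthogonal_commute)
  qed (auto simp: f orthogonal_def span_base)
  moreover have "dim ?R + dim (span (a ` I)) = DIM('e)"
    using dim_subspace_orthogonal_to_vectors[of "span (a ` I)" "UNIV :: 'e set"] by simp
  moreover have "dim (span (a ` I)) \<le> card I"
    using dim_le_card'[of "a ` I"] assms(1) card_image_le[of I a] by simp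
  ultimately show ?thesis by simp
qed

text \<open>For the least \<open>m\<close> such that the power \<open>m + 1\<close> of \<open>b\<close> vanishes, pick \<open>v\<close> on which the power \<open>m\<close> does
  not: if \<open>u\<close> is \<open>b\<close>-orthogonal to the \<open>2m\<close> vectors of \<open>v\<close>, evaluating the power \<open>m + 1\<close> on \<open>w, u, v\<close> yields
  \<open>0 = c b(w, u)\<close> with \<open>c \<noteq> 0\<close>.\<close>

lemma wedge_power2_zero_kernel:
  fixes b :: "'e::euclidean_space \<Rightarrow> 'e \<Rightarrow> real"
  assumes skew: "\<And>x y. b x y = - b y x" and zero: "\<And>v. wedge_power2 b (h + 1) v = 0"
  shows "\<exists>v. \<forall>u. (\<forall>i<2 * h. b u (v i) = 0) \<longrightarrow> (\<forall>w. b u w = 0)"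
proof -
  have z: "\<forall>v. pairing_sum b (Suc h) v = 0"
    using zero by (simp add: wedge_power2_eq_pairing_sum del: wedge_power2.simps)
  define m where "m = (LEAST m. \<forall>v. pairing_sum b (Suc m) v = 0)"
  have m: "pairing_sum b (Suc m) v = 0" for v
    using LeastI[of "\<lambda>m. \<forall>v. pairing_sum b (Suc m) v = 0" h] z by (simp add: m_def)
  have "m \<le> h" unfolding m_def by (rule Least_le) (rule z)
  have "\<exists>v. pairing_sum b m v \<noteq> 0"
  proof (cases m)
    case 0
    then show ?thesis by (simp add: pairing_sum_def pairing_term_def)
  next
    case (Suc n)
    then show ?thesis
      using not_less_Least[of n "\<lambda>m. \<forall>v. pairing_sum b (Suc m) v = 0"] unfolding m_def by auto
  qed
  then obtain v where v: "pairing_sum b m v \<noteq> 0" by blast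
  show ?thesis
  proof (intro exI allI impI)
    fix u w assume orth: "\<forall>i<2 * h. b u (v i) = 0"
    let ?v = "\<lambda>i. if i = 0 then w else if i = 1 then u else v (i - 2)"
    have "0 = 2 * real (Suc m) * b (?v 0) (?v 1) * pairing_sum b m (\<lambda>i. ?v (2 + i))"
      unfolding m[of ?v, symmetric]
      by (rule pairing_sum_contract[OF skew]) (use orth \<open>m \<le> h\<close> in auto)
    then show "b u w = 0" using v skew[of u w] by simp
  qed
qed

text \<open>The kernel is cut out by \<open>2 * h + 1\<close> functionals: the \<open>2 * h\<close>
  contractions of \<open>b\<close> that already force \<open>u\<close> into the kernel of
  \<open>b\<close>, and \<open>a\<close>.\<close>

lemma dim_form_kernel:
  fixes b :: "'e::euclidean_space \<Rightarrow> 'e \<Rightarrow> real"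
  assumes lin: "\<And>x. linear (b x)" and skew: "\<And>x y. b x y = - b y x"
    and zero: "\<And>v. wedge_power2 b (h + 1) v = 0" and a: "linear (a :: 'e \<Rightarrow> real)"
  shows "DIM('e) \<le> dim {u. a u = 0 \<and> (\<forall>w. b u w = 0)} + (2 * h + 1)"
proof -
  obtain v where v: "\<forall>u. (\<forall>i<2 * h. b u (v i) = 0) \<longrightarrow> (\<forall>w. b u w = 0)"
    using wedge_power2_zero_kernel[of b h] skew zero by blast
  have lin': "linear (\<lambda>u. b u x)" for x
  proof -
    have "(\<lambda>u. b u x) = (\<lambda>u. - b x u)" using skew by blast
    then show ?thesis using linear_compose_neg[OF lin] by simp
  qed
  \<comment> \<open>The index \<open>2 * h\<close>, the last one in \<open>{..2 * h}\<close>,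
    carries \<open>a\<close>.\<close>
  let ?f = "\<lambda>i. if i < 2 * h then (\<lambda>u. b u (v i)) else a"
  have "DIM('e) \<le> dim {u. \<forall>i\<in>{..2 * h}. ?f i u = 0} + card {..2 * h}"
    by (rule dim_common_kernel) (auto simp: lin' a)
  also have "{u. \<forall>i\<in>{..2 * h}. ?f i u = 0} = {u. a u = 0 \<and> (\<forall>w. b u w = 0)}"
    (is "?L = ?R")
  proof safe
    fix u w assume u: "\<forall>i\<in>{..2 * h}. ?f i u = 0"
    show "a u = 0" using u[rule_format, of "2 * h"] by simp
    have "b u (v i) = 0" if "i < 2 * h" for i using u[rule_format, of i] that by simp
    then show "b u w = 0" using v by blast
  qed auto
  finally show ?thesis by simp
qed

lemma subspace_sum_UNIV:
  fixes S T :: "'e::euclidean_space set"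
  assumes "subspace S" "subspace T" "S \<inter> T \<subseteq> {0}" "DIM('e) \<le> dim S + dim T"
  obtains x y where "x \<in> S" "y \<in> T" "v = x + y"
proof -
  have "dim {x + y |x y. x \<in> S \<and> y \<in> T} = dim S + dim T"
    using dim_sums_Int[OF assms(1,2)] assms(3) dim_eq_0[of "S \<inter> T"] by linarith
  then have "dim {x + y |x y. x \<in> S \<and> y \<in> T} = DIM('e)"
    using assms(4) dim_subset_UNIV[of "{x + y |x y. x \<in> S \<and> y \<in> T}"] by simp
  then have "span {x + y |x y. x \<in> S \<and> y \<in> T} = UNIV" by (simp only: dim_eq_full)
  then have "{x + y |x y. x \<in> S \<and> y \<in> T} = UNIV"
    using span_eq_iff[THEN iffD2, OF subspace_sums[OF assms(1,2)]] by simp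
  then show ?thesis using that by blast
qed

section \<open>Orthogonal projections for a scalar product\<close>

locale scalar_product =
  fixes g :: "'e::euclidean_space \<Rightarrow> 'e \<Rightarrow> real"
  assumes g_linear: "linear (g u)" and g_sym: "g u v = g v u" and g_pos: "v \<noteq> 0 \<Longrightarrow> g v v > 0"
begin

lemma bilin: "g u (x + y) = g u x + g u y" "g u (x - y) = g u x - g u y" "g u (- x) = - g u x"
  "g u (c *\<^sub>R x) = c * g u x" "g u 0 = 0"
  "g (x + y) u = g x u + g y u" "g (x - y) u = g x u - g y u" "g (- x) u = - g x u"
  "g (c *\<^sub>R x) u = c * g x u" "g 0 u = 0"
proof -
  show r: "g u (x + y) = g u x + g u y" "g u (x - y) = g u x - g u y" "g u (- x) = - g u x"
    "g u (c *\<^sub>R x) = c * g u x" "g u 0 = 0" for u x y c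
    using linear_add[OF g_linear] linear_diff[OF g_linear] linear_neg[OF g_linear]
      linear_cmul[OF g_linear] linear_0[OF g_linear] by auto
  show "g (x + y) u = g x u + g y u" "g (x - y) u = g x u - g y u" "g (- x) u = - g x u"
    "g (c *\<^sub>R x) u = c * g x u" "g 0 u = 0"
    unfolding g_sym[of _ u] by (rule r)+
qed

lemma nondegenerate:
  assumes "\<And>w. g v w = 0" shows "v = 0"
  using g_pos[of v] assms[of v] by force

lemma eqI: "(\<And>w. g u w = g v w) \<Longrightarrow> u = v"
  using nondegenerate[of "u - v"] by (simp add: bilin)

lemma orth_proj_eq:
  assumes "subspace S" "w \<in> S" "\<And>u. u \<in> S \<Longrightarrow> g (v - w) u = 0"
  shows "orth_proj g S v = w"
  unfolding orth_proj_def
proof (rule the_equality)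
  fix w' assume w': "w' \<in> S \<and> (\<forall>u\<in>S. g (v - w') u = 0)"
  then have "w' - w \<in> S" using assms subspace_diff by blast
  then have "g (v - w) (w' - w) = 0" "g (v - w') (w' - w) = 0" using w' assms by auto
  then have "g (w' - w) (w' - w) = 0" by (simp add: bilin)
  then show "w' = w" using g_pos[of "w' - w"] by force
qed (use assms in auto)

text \<open>This shows that the description in \<open>orth_proj\<close> is met on every subspace.
  \<open>S\<close> and the \<open>g\<close>-orthogonal complement of a basis of \<open>S\<close>
  meet only in 0 by positivity, and their dimensions add up to at least that of the space; hence
  \<open>v\<close> splits, and its part in \<open>S\<close> is the projection.\<close>

lemma orth_proj:
  assumes "subspace S"
  shows "orth_proj g S v \<in> S" "\<And>u. u \<in> S \<Longrightarrow> g (v - orth_proj g S v) u = 0"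
    "\<And>u. u \<in> S \<Longrightarrow> g u (orth_proj g S v) = g u v"
proof -
  obtain B where B: "B \<subseteq> S" "independent B" "S \<subseteq> span B" "card B = dim S"
    using basis_exists by blast
  let ?O = "{v. \<forall>x\<in>B. g x v = 0}"
  have O: "g x v = 0" if "v \<in> ?O" "x \<in> S" for x v
  proof -
    have "x \<in> span B" using that B by auto
    moreover have "subspace {x. g x v = 0}" by (auto simp: subspace_def bilin)
    ultimately show ?thesis using span_minimal[of B "{x. g x v = 0}"] that(1) by auto
  qed
  have "subspace ?O" by (auto simp: subspace_def bilin)
  have "S \<inter> ?O \<subseteq> {0}" using O g_pos by fastforce
  moreover have "DIM('e) \<le> dim S + dim ?O"
    using dim_common_kernel[of B g] B independent_imp_finite g_linear by (auto simp: add.commute)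
  ultimately obtain w y where w: "w \<in> S" "y \<in> ?O" "v = w + y"
    using subspace_sum_UNIV[OF assms \<open>subspace ?O\<close>] by blast
  have w0: "g (v - w) u = 0" if "u \<in> S" for u using O[OF w(2) that] w(3) g_sym by simp
  have *: "orth_proj g S v = w" by (rule orth_proj_eq[OF assms w(1) w0])
  show "orth_proj g S v \<in> S" "\<And>u. u \<in> S \<Longrightarrow> g (v - orth_proj g S v) u = 0" using w(1) w0 * by auto
  then show "\<And>u. u \<in> S \<Longrightarrow> g u (orth_proj g S v) = g u v" using g_sym by (simp add: bilin)
qed

end

section \<open>Smooth functions on open sets\<close>

lemma ck_on_cong:
  assumes "open S" "ck_on n S f" "\<And>x. x \<in> S \<Longrightarrow> f x = g x"
  shows "ck_on n S g"
  using assms(2,3)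
proof (induction n arbitrary: f g)
  case 0
  then show ?case using continuous_on_cong[of S S f g] by simp
next
  case (Suc n)
  have d: "(g has_derivative frechet_derivative f (at x)) (at x)" if "x \<in> S" for x
  proof (rule has_derivative_transform_within_open[OF _ assms(1) that])
    show "(f has_derivative frechet_derivative f (at x)) (at x)"
      using Suc.prems that frechet_derivative_works by auto
  qed (use Suc.prems in auto)
  have "ck_on n S (\<lambda>x. frechet_derivative g (at x) v)" for v
  proof (rule Suc.IH)
    show "ck_on n S (\<lambda>x. frechet_derivative f (at x) v)" using Suc.prems by simp
  qed (simp add: frechet_derivative_at[OF d, symmetric])
  then show ?case using differentiableI[OF d] by simp
qed

text \<open>Allows an explicit derivative in place of the one chosen by
  \<open>frechet_derivative\<close>; they agree on the open set \<open>S\<close>, and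
  \<open>ck_on\<close> is insensitive to values outside it.\<close>

lemma ck_on_SucI:
  assumes "\<And>x. x \<in> S \<Longrightarrow> (f has_derivative f' x) (at x)" "open S" "\<And>v. ck_on n S (\<lambda>x. f' x v)"
  shows "ck_on (Suc n) S f"
proof -
  have "ck_on n S (\<lambda>x. frechet_derivative f (at x) v)" for v
    by (rule ck_on_cong[OF assms(2,3)]) (simp add: frechet_derivative_at[OF assms(1), symmetric])
  then show ?thesis using differentiableI[OF assms(1)] by simp
qed

lemma linear_euclidean_expansion:
  fixes f :: "'e::euclidean_space \<Rightarrow> 'b::real_vector"
  assumes "linear f" shows "f v = (\<Sum>i\<in>Basis. (v \<bullet> i) *\<^sub>R f i)"
  using linear_sum[OF assms, of "\<lambda>i. (v \<bullet> i) *\<^sub>R i" Basis]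
  by (simp add: linear_cmul[OF assms] euclidean_representation)

lemma ck_on_has_derivative:
  "ck_on (Suc n) S f \<Longrightarrow> x \<in> S \<Longrightarrow> (f has_derivative frechet_derivative f (at x)) (at x)"
  using frechet_derivative_works by auto

lemma ck_on_subset: "ck_on n T f \<Longrightarrow> S \<subseteq> T \<Longrightarrow> ck_on n S f"
  by (induction n arbitrary: f) (auto intro: continuous_on_subset)

lemma ck_on_local:
  assumes "\<And>x. x \<in> S \<Longrightarrow> \<exists>U. open U \<and> x \<in> U \<and> ck_on n U f"
  shows "ck_on n S f"
  using assms
proof (induction n arbitrary: f)
  case 0
  have "isCont f x" if "x \<in> S" for x
    using 0[OF that] by (auto simp: continuous_on_eq_continuous_at)
  then show ?case by (simp add: continuous_at_imp_continuous_on)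
next
  case (Suc n)
  then show ?case by (fastforce intro!: Suc.IH)
qed

lemma ck_on_SucD: "ck_on (Suc n) S f \<Longrightarrow> ck_on n S f"
proof (induction n arbitrary: f)
  case 0
  then show ?case by (auto intro!: continuous_at_imp_continuous_on differentiable_imp_continuous_within)
next
  case (Suc n)
  show ?case unfolding ck_on.simps(2)[of n]
    using Suc.prems Suc.IH[of "\<lambda>x. frechet_derivative f (at x) v" for v] unfolding ck_on.simps(2)[of "Suc n"]
    by blast
qed

lemma ck_on_const: "ck_on n S (\<lambda>x. c)"
  by (induction n arbitrary: c) auto

lemma ck_on_bounded_linear:
  assumes "bounded_linear f" "open S" shows "ck_on n S f"
proof (cases n)
  case 0
  then show ?thesis using assms(1) by (simp add: linear_continuous_on)
next
  case (Suc k)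
  show ?thesis unfolding Suc
    by (rule ck_on_SucI[OF _ assms(2), of f "\<lambda>_. f"])
      (auto simp: ck_on_const assms intro: bounded_linear_imp_has_derivative)
qed

lemma ck_on_add:
  assumes "open S" "ck_on n S f" "ck_on n S g" shows "ck_on n S (\<lambda>x. f x + g x)"
  using assms(2,3)
proof (induction n arbitrary: f g)
  case 0
  then show ?case by (auto intro: continuous_on_add)
next
  case (Suc n)
  show ?case
    by (rule ck_on_SucI[OF has_derivative_add assms(1)])
      (use Suc.IH Suc.prems ck_on_has_derivative[OF Suc.prems(1)] ck_on_has_derivative[OF Suc.prems(2)] assms(1) in \<open>auto simp: ck_on.simps(2)\<close>)
qed

lemma ck_on_sum:
  assumes "open S" "\<And>i. i \<in> I \<Longrightarrow> ck_on n S (f i)" shows "ck_on n S (\<lambda>x. \<Sum>i\<in>I. f i x)"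
  using assms(2) by (induction I rule: infinite_finite_induct) (auto intro: ck_on_const ck_on_add assms(1))

lemma ck_on_bilinear:
  assumes B: "bounded_bilinear B" and "open S" "ck_on n S f" "ck_on n S g"
  shows "ck_on n S (\<lambda>x. B (f x) (g x))"
  using assms(3,4)
proof (induction n arbitrary: f g)
  case 0
  then show ?case using bounded_bilinear.continuous_on[OF B] by auto
next
  case (Suc n)
  let ?Df = "\<lambda>x. frechet_derivative f (at x)" and ?Dg = "\<lambda>x. frechet_derivative g (at x)"
  show ?case
  proof (rule ck_on_SucI[OF _ assms(2)])
    show "((\<lambda>x. B (f x) (g x)) has_derivative (\<lambda>v. B (f x) (?Dg x v) + B (?Df x v) (g x))) (at x)"
      if "x \<in> S" for x
      by (rule bounded_bilinear.FDERIV[OF B ck_on_has_derivative[OF Suc.prems(1) that] ck_on_has_derivative[OF Suc.prems(2) that]])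
    show "ck_on n S (\<lambda>x. B (f x) (?Dg x v) + B (?Df x v) (g x))" for v
      using Suc.prems ck_on_SucD[OF Suc.prems(1)] ck_on_SucD[OF Suc.prems(2)]
      by (auto intro!: ck_on_add[OF assms(2)] Suc.IH)
  qed
qed

text \<open>\<open>ck_on\<close> controls derivatives in fixed directions only, whereas the chain
  rule differentiates \<open>f\<close> in the varying direction \<open>?Dg x v\<close>. Expanding
  that direction in the basis gives a sum of products of functions covered by the induction
  hypothesis; this is where the intermediate space has to be Euclidean.\<close>

lemma ck_on_compose:
  fixes g :: "'a::real_normed_vector \<Rightarrow> 'e::euclidean_space"
  assumes "open S" "open T" "g ` S \<subseteq> T" "ck_on n S g" "ck_on n T f"
  shows "ck_on n S (\<lambda>x. f (g x))"
  using assms(4,5)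
proof (induction n arbitrary: f)
  case 0
  then show ?case using assms(3) continuous_on_compose2 by auto
next
  case (Suc n)
  let ?Df = "\<lambda>x. frechet_derivative f (at x)" and ?Dg = "\<lambda>x. frechet_derivative g (at x)"
  have D: "?Df (g x) (?Dg x v) = (\<Sum>i\<in>Basis. (?Dg x v \<bullet> i) *\<^sub>R ?Df (g x) i)" if "x \<in> S" for x v
  proof -
    have "linear (?Df (g x))"
      using ck_on_has_derivative[OF Suc.prems(2), of "g x"] that assms(3) has_derivative_linear by blast
    then show ?thesis by (rule linear_euclidean_expansion)
  qed
  show ?case
  proof (rule ck_on_SucI[OF _ assms(1)])
    show "((\<lambda>x. f (g x)) has_derivative (\<lambda>v. ?Df (g x) (?Dg x v))) (at x)" if "x \<in> S" for x
      by (rule has_derivative_compose[OF ck_on_has_derivative[OF Suc.prems(1) that] ck_on_has_derivative[OF Suc.prems(2)]])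
        (use that assms(3) in blast)
    have "ck_on n S (\<lambda>x. \<Sum>i\<in>Basis. (?Dg x v \<bullet> i) *\<^sub>R ?Df (g x) i)" for v
      using Suc.prems ck_on_SucD[OF Suc.prems(1)]
      by (auto intro!: ck_on_sum assms(1) ck_on_bilinear[OF bounded_bilinear_scaleR]
          ck_on_bilinear[OF bounded_bilinear_inner] ck_on_const Suc.IH)
    then show "ck_on n S (\<lambda>x. ?Df (g x) (?Dg x v))" for v
      by (rule ck_on_cong[OF assms(1)]) (simp add: D)
  qed
qed

lemma smooth_on_ck: "smooth_on S f \<Longrightarrow> ck_on n S f"
  by (simp add: smooth_on_def)

lemma smooth_on_has_derivative:
  "smooth_on S f \<Longrightarrow> x \<in> S \<Longrightarrow> (f has_derivative frechet_derivative f (at x)) (at x)"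
  using ck_on_has_derivative smooth_on_ck by blast

lemma smooth_on_frechet: "smooth_on S f \<Longrightarrow> smooth_on S (\<lambda>x. frechet_derivative f (at x) v)"
  unfolding smooth_on_def using ck_on.simps(2) by blast

lemma smooth_on_cong: "open S \<Longrightarrow> smooth_on S f \<Longrightarrow> (\<And>x. x \<in> S \<Longrightarrow> f x = g x) \<Longrightarrow> smooth_on S g"
  unfolding smooth_on_def using ck_on_cong by blast

lemma smooth_on_subset: "smooth_on T f \<Longrightarrow> S \<subseteq> T \<Longrightarrow> smooth_on S f"
  unfolding smooth_on_def using ck_on_subset by blast

lemma smooth_on_local:
  assumes "\<And>x. x \<in> S \<Longrightarrow> \<exists>U. open U \<and> x \<in> U \<and> smooth_on U f"
  shows "smooth_on S f"
  unfolding smooth_on_def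
proof
  show "ck_on n S f" for n
    by (rule ck_on_local) (use assms smooth_on_ck in blast)
qed

lemma smooth_on_const: "smooth_on S (\<lambda>x. c)"
  by (simp add: smooth_on_def ck_on_const)

lemma smooth_on_bounded_linear: "bounded_linear f \<Longrightarrow> open S \<Longrightarrow> smooth_on S f"
  by (simp add: smooth_on_def ck_on_bounded_linear)

lemma smooth_on_add:
  "open S \<Longrightarrow> smooth_on S f \<Longrightarrow> smooth_on S g \<Longrightarrow> smooth_on S (\<lambda>x. f x + g x)"
  by (simp add: smooth_on_def ck_on_add)

lemma smooth_on_sum:
  "open S \<Longrightarrow> (\<And>i. i \<in> I \<Longrightarrow> smooth_on S (f i)) \<Longrightarrow> smooth_on S (\<lambda>x. \<Sum>i\<in>I. f i x)"
  by (simp add: smooth_on_def ck_on_sum)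

lemma smooth_on_bilinear:
  "bounded_bilinear B \<Longrightarrow> open S \<Longrightarrow> smooth_on S f \<Longrightarrow> smooth_on S g \<Longrightarrow> smooth_on S (\<lambda>x. B (f x) (g x))"
  by (simp add: smooth_on_def ck_on_bilinear)

lemmas smooth_on_scaleR = smooth_on_bilinear[OF bounded_bilinear_scaleR]
lemmas smooth_on_mult = smooth_on_bilinear[OF bounded_bilinear_mult]
lemmas smooth_on_inner = smooth_on_bilinear[OF bounded_bilinear_inner]

lemma smooth_on_compose:
  fixes g :: "'a::real_normed_vector \<Rightarrow> 'e::euclidean_space"
  assumes "open S" "open T" "g ` S \<subseteq> T" "smooth_on S g" "smooth_on T f"
  shows "smooth_on S (\<lambda>x. f (g x))"
  using assms ck_on_compose unfolding smooth_on_def by blast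

lemma smooth_on_frechet_apply:
  fixes f :: "'e::euclidean_space \<Rightarrow> 'b::real_normed_vector"
  assumes "open S" "smooth_on S f" "smooth_on S X"
  shows "smooth_on S (\<lambda>x. frechet_derivative f (at x) (X x))"
proof (rule smooth_on_cong[OF assms(1)])
  show "smooth_on S (\<lambda>x. \<Sum>i\<in>Basis. (X x \<bullet> i) *\<^sub>R frechet_derivative f (at x) i)"
    by (intro smooth_on_sum smooth_on_scaleR smooth_on_inner smooth_on_const smooth_on_frechet assms)
  fix x assume "x \<in> S"
  then have "linear (frechet_derivative f (at x))"
    using smooth_on_has_derivative[OF assms(2)] has_derivative_linear by blast
  then show "(\<Sum>i\<in>Basis. (X x \<bullet> i) *\<^sub>R frechet_derivative f (at x) i) = frechet_derivative f (at x) (X x)"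
    by (rule linear_euclidean_expansion[symmetric])
qed

section \<open>Symmetry of second derivatives\<close>

lemma DERIV_along_line:
  assumes "(f has_derivative f') (at (x + s *\<^sub>R u))"
  shows "DERIV (\<lambda>s. f (x + s *\<^sub>R u)) s :> (f' u :: real)"
proof -
  have "((\<lambda>s. f (x + s *\<^sub>R u)) has_derivative (\<lambda>h. f' (h *\<^sub>R u))) (at s)"
    by (rule has_derivative_compose[of "\<lambda>s. x + s *\<^sub>R u", OF _ assms]) (auto intro!: derivative_eq_intros)
  moreover have "(\<lambda>h. f' (h *\<^sub>R u)) = (*) (f' u)"
    using linear_cmul[OF has_derivative_linear[OF assms]] by (auto simp: mult.commute)
  ultimately show ?thesis by (simp add: has_field_derivative_def)
qed

text \<open>The mean value theorem is applied twice: along \<open>u\<close> to the difference of two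
  parallel edges, then along \<open>v\<close> to the directional derivative that results.\<close>

lemma second_difference:
  fixes f :: "'a::real_normed_vector \<Rightarrow> real"
  assumes f: "ck_on 2 S f" and "t > 0"
    and S: "\<And>\<sigma> \<tau>. 0 \<le> \<sigma> \<Longrightarrow> \<sigma> \<le> t \<Longrightarrow> 0 \<le> \<tau> \<Longrightarrow> \<tau> \<le> t \<Longrightarrow> x + \<sigma> *\<^sub>R u + \<tau> *\<^sub>R v \<in> S"
  shows "\<exists>\<sigma> \<tau>. 0 \<le> \<sigma> \<and> \<sigma> \<le> t \<and> 0 \<le> \<tau> \<and> \<tau> \<le> t \<and>
    f (x + t *\<^sub>R u + t *\<^sub>R v) - f (x + t *\<^sub>R u) - (f (x + t *\<^sub>R v) - f x) =
    t * (t * frechet_derivative (\<lambda>y. frechet_derivative f (at y) u) (at (x + \<sigma> *\<^sub>R u + \<tau> *\<^sub>R v)) v)"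
proof -
  let ?D = "\<lambda>y. frechet_derivative f (at y)"
  have f1: "ck_on (Suc 0) S (\<lambda>y. ?D y u)" and f2: "ck_on (Suc 1) S f"
    using f by (simp_all add: numeral_2_eq_2)
  define h where "h s = f (x + t *\<^sub>R v + s *\<^sub>R u) - f (x + s *\<^sub>R u)" for s
  have dh: "DERIV h s :> ?D (x + t *\<^sub>R v + s *\<^sub>R u) u - ?D (x + s *\<^sub>R u) u" if "0 \<le> s" "s \<le> t" for s
    unfolding h_def
    using S[of s t] S[of s 0] that \<open>t > 0\<close>
    by (intro DERIV_diff DERIV_along_line ck_on_has_derivative[OF f2]) (auto simp: algebra_simps)
  obtain \<sigma> where \<sigma>: "0 < \<sigma>" "\<sigma> < t" "h t - h 0 = (t - 0) * (?D (x + t *\<^sub>R v + \<sigma> *\<^sub>R u) u - ?D (x + \<sigma> *\<^sub>R u) u)"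
    using MVT2[OF \<open>t > 0\<close> dh] by blast
  define k where "k s = ?D (x + \<sigma> *\<^sub>R u + s *\<^sub>R v) u" for s
  have dk: "DERIV k s :> frechet_derivative (\<lambda>y. ?D y u) (at (x + \<sigma> *\<^sub>R u + s *\<^sub>R v)) v" if "0 \<le> s" "s \<le> t" for s
    unfolding k_def
    by (rule DERIV_along_line[of "\<lambda>y. ?D y u"], rule ck_on_has_derivative[OF f1]) (use S[of \<sigma> s] that \<sigma> in auto)
  obtain \<tau> where \<tau>: "0 < \<tau>" "\<tau> < t"
    "k t - k 0 = (t - 0) * frechet_derivative (\<lambda>y. ?D y u) (at (x + \<sigma> *\<^sub>R u + \<tau> *\<^sub>R v)) v"
    using MVT2[OF \<open>t > 0\<close> dk] by blast
  have "f (x + t *\<^sub>R u + t *\<^sub>R v) - f (x + t *\<^sub>R u) - (f (x + t *\<^sub>R v) - f x) = h t - h 0"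
    by (simp add: h_def algebra_simps)
  also have "\<dots> = t * (k t - k 0)"
    unfolding \<sigma>(3) k_def by (simp add: algebra_simps)
  finally show ?thesis using \<sigma>(1,2) \<tau> by (intro exI[of _ \<sigma>] exI[of _ \<tau>]) auto
qed

text \<open>The second difference over a parallelogram is symmetric in \<open>u\<close> and
  \<open>v\<close>. Hence the two mixed derivatives take a common value at two points near
  \<open>x\<close>, and continuity rules out a gap between them at \<open>x\<close>.\<close>

lemma second_derivative_symmetric:
  fixes f :: "'a::real_normed_vector \<Rightarrow> real"
  assumes f: "ck_on 2 S f" and S: "open S" "x \<in> S"
  shows "frechet_derivative (\<lambda>y. frechet_derivative f (at y) u) (at x) v =
    frechet_derivative (\<lambda>y. frechet_derivative f (at y) v) (at x) u"
proof (rule ccontr)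
  let ?D2 = "\<lambda>u v y. frechet_derivative (\<lambda>y. frechet_derivative f (at y) u) (at y) v"
  assume ne: "?D2 u v x \<noteq> ?D2 v u x"
  define e where "e = \<bar>?D2 u v x - ?D2 v u x\<bar> / 2"
  have "e > 0" using ne by (simp add: e_def)
  have c: "isCont (?D2 u v) x" for u v
  proof -
    have "continuous_on S (?D2 u v)" using f by (simp add: numeral_2_eq_2)
    then show ?thesis using S by (simp add: continuous_on_eq_continuous_at)
  qed
  obtain d1 where d1: "d1 > 0" "\<And>y. dist y x < d1 \<Longrightarrow> dist (?D2 u v y) (?D2 u v x) < e"
    using c[of u v] \<open>e > 0\<close> unfolding continuous_at_eps_delta by blast
  obtain d2 where d2: "d2 > 0" "\<And>y. dist y x < d2 \<Longrightarrow> dist (?D2 v u y) (?D2 v u x) < e"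
    using c[of v u] \<open>e > 0\<close> unfolding continuous_at_eps_delta by blast
  obtain d3 where d3: "d3 > 0" "\<And>y. dist y x < d3 \<Longrightarrow> y \<in> S"
    using S unfolding open_dist by blast
  define d where "d = min d1 (min d2 d3)"
  have "d > 0" using d1 d2 d3 by (simp add: d_def)
  \<comment> \<open>With this side length every point of the parallelogram lies within
    \<open>d / 2\<close> of \<open>x\<close>; the summand 1 keeps the denominator positive when
    \<open>u\<close> and \<open>v\<close> vanish.\<close>
  define t where "t = d / (2 * (norm u + norm v + 1))"
  have np: "norm u + norm v + 1 > 0" using norm_ge_zero[of u] norm_ge_zero[of v] by linarith
  have "t > 0" using \<open>d > 0\<close> np by (simp add: t_def)
  have near: "dist (x + \<sigma> *\<^sub>R u + \<tau> *\<^sub>R v) x < d" if "0 \<le> \<sigma>" "\<sigma> \<le> t" "0 \<le> \<tau>" "\<tau> \<le> t" for \<sigma> \<tau>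
  proof -
    have "dist (x + \<sigma> *\<^sub>R u + \<tau> *\<^sub>R v) x = norm (\<sigma> *\<^sub>R u + \<tau> *\<^sub>R v)" by (simp add: dist_norm algebra_simps)
    also have "\<dots> \<le> \<sigma> * norm u + \<tau> * norm v"
      using norm_triangle_ineq[of "\<sigma> *\<^sub>R u" "\<tau> *\<^sub>R v"] that by simp
    also have "\<dots> \<le> t * norm u + t * norm v" using that by (intro add_mono mult_right_mono) auto
    also have "\<dots> \<le> t * (norm u + norm v + 1)" using \<open>t > 0\<close> by (simp add: algebra_simps)
    also have "\<dots> = d / 2" using np by (simp add: t_def field_simps)
    finally show ?thesis using \<open>d > 0\<close> by simp
  qed
  have inS: "x + \<sigma> *\<^sub>R u + \<tau> *\<^sub>R v \<in> S" "x + \<tau> *\<^sub>R v + \<sigma> *\<^sub>R u \<in> S"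
    if "0 \<le> \<sigma>" "\<sigma> \<le> t" "0 \<le> \<tau>" "\<tau> \<le> t" for \<sigma> \<tau>
    using near[OF that] d3(2) by (auto simp: d_def algebra_simps)
  obtain \<sigma> \<tau> where 1: "0 \<le> \<sigma>" "\<sigma> \<le> t" "0 \<le> \<tau>" "\<tau> \<le> t"
    "f (x + t *\<^sub>R u + t *\<^sub>R v) - f (x + t *\<^sub>R u) - (f (x + t *\<^sub>R v) - f x) = t * (t * ?D2 u v (x + \<sigma> *\<^sub>R u + \<tau> *\<^sub>R v))"
    using second_difference[OF f \<open>t > 0\<close> inS(1)] by blast
  obtain \<sigma>' \<tau>' where 2: "0 \<le> \<sigma>'" "\<sigma>' \<le> t" "0 \<le> \<tau>'" "\<tau>' \<le> t"
    "f (x + t *\<^sub>R v + t *\<^sub>R u) - f (x + t *\<^sub>R v) - (f (x + t *\<^sub>R u) - f x) = t * (t * ?D2 v u (x + \<sigma>' *\<^sub>R v + \<tau>' *\<^sub>R u))"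
    using second_difference[OF f \<open>t > 0\<close> inS(2)] by blast
  have "t * (t * ?D2 u v (x + \<sigma> *\<^sub>R u + \<tau> *\<^sub>R v)) = t * (t * ?D2 v u (x + \<sigma>' *\<^sub>R v + \<tau>' *\<^sub>R u))"
    unfolding 1(5)[symmetric] 2(5)[symmetric] by (simp add: algebra_simps)
  then have eq: "?D2 u v (x + \<sigma> *\<^sub>R u + \<tau> *\<^sub>R v) = ?D2 v u (x + \<sigma>' *\<^sub>R v + \<tau>' *\<^sub>R u)"
    using \<open>t > 0\<close> by simp
  have "dist (?D2 u v (x + \<sigma> *\<^sub>R u + \<tau> *\<^sub>R v)) (?D2 u v x) < e"
    using near[OF 1(1-4)] by (intro d1(2)) (simp add: d_def)
  moreover have "dist (?D2 v u (x + \<sigma>' *\<^sub>R v + \<tau>' *\<^sub>R u)) (?D2 v u x) < e"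
    using near[OF 2(3,4,1,2)] by (intro d2(2)) (simp add: d_def algebra_simps)
  ultimately have "\<bar>?D2 u v x - ?D2 v u x\<bar> < 2 * e"
    unfolding eq dist_real_def by linarith
  then show False by (simp add: e_def)
qed

text \<open>Product rule for the derivative of \<open>f\<close> along \<open>Y\<close>, written out
  in the basis. Symmetry of the second derivative puts \<open>w\<close> in the inner slot, so that
  the basis expansion can be folded up again at \<open>Y x\<close>.\<close>

lemma frechet_derivative_directional:
  fixes f :: "'e::euclidean_space \<Rightarrow> real"
  assumes S: "open S" "x \<in> S" and f: "smooth_on S f" and Y: "smooth_on S Y"
  shows "frechet_derivative (\<lambda>y. frechet_derivative f (at y) (Y y)) (at x) w =
    frechet_derivative f (at x) (frechet_derivative Y (at x) w) +
    frechet_derivative (\<lambda>y. frechet_derivative f (at y) w) (at x) (Y x)"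
proof -
  let ?D = "\<lambda>y. frechet_derivative f (at y)"
  let ?DY = "frechet_derivative Y (at x)"
  let ?H = "\<lambda>u. frechet_derivative (\<lambda>y. ?D y u) (at x)"
  have lin: "linear (?D y)" if "y \<in> S" for y
    using smooth_on_has_derivative[OF f that] has_derivative_linear by blast
  have dH: "((\<lambda>y. ?D y u) has_derivative ?H u) (at x)" for u
    by (rule smooth_on_has_derivative[OF smooth_on_frechet[OF f] S(2)])
  have dY: "(Y has_derivative ?DY) (at x)" by (rule smooth_on_has_derivative[OF Y S(2)])
  have "((\<lambda>y. \<Sum>i\<in>Basis. (Y y \<bullet> i) *\<^sub>R ?D y i) has_derivative
      (\<lambda>w. \<Sum>i\<in>Basis. (Y x \<bullet> i) *\<^sub>R ?H i w + (?DY w \<bullet> i) *\<^sub>R ?D x i)) (at x)"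
    by (intro has_derivative_sum has_derivative_scaleR dH has_derivative_inner_left dY)
  then have "((\<lambda>y. ?D y (Y y)) has_derivative
      (\<lambda>w. \<Sum>i\<in>Basis. (Y x \<bullet> i) *\<^sub>R ?H i w + (?DY w \<bullet> i) *\<^sub>R ?D x i)) (at x)"
    by (rule has_derivative_transform_within_open[OF _ S]) (rule linear_euclidean_expansion[OF lin, symmetric])
  from frechet_derivative_at[OF this, symmetric]
  have "frechet_derivative (\<lambda>y. ?D y (Y y)) (at x) w =
      (\<Sum>i\<in>Basis. (Y x \<bullet> i) *\<^sub>R ?H i w + (?DY w \<bullet> i) *\<^sub>R ?D x i)" by simp
  also have "\<dots> = (\<Sum>i\<in>Basis. (Y x \<bullet> i) *\<^sub>R ?H w i) + (\<Sum>i\<in>Basis. (?DY w \<bullet> i) *\<^sub>R ?D x i)"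
    by (simp only: sum.distrib second_derivative_symmetric[OF smooth_on_ck[OF f] S, of _ w])
  also have "\<dots> = ?H w (Y x) + ?D x (?DY w)"
    by (simp only: linear_euclidean_expansion[OF has_derivative_linear[OF dH[of w]], of "Y x"]
        linear_euclidean_expansion[OF lin[OF S(2)], of "?DY w"])
  finally show ?thesis by simp
qed

section \<open>Smooth bump functions\<close>

definition flat :: "nat \<Rightarrow> real \<Rightarrow> real" where
  "flat n t = (if t \<le> 0 then 0 else exp (- 1 / t) / t ^ n)"

lemma flat_tendsto_0: "(flat n \<longlongrightarrow> 0) (at 0)"
proof (rule filterlim_split_at)
  show "(flat n \<longlongrightarrow> 0) (at_left 0)"
    by (rule tendsto_eventually) (auto simp: eventually_at_filter flat_def)
  have "((\<lambda>t. inverse t ^ n / exp (inverse t)) \<longlongrightarrow> (0::real)) (at_right 0)"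
    using filterlim_compose[OF tendsto_power_div_exp_0 filterlim_inverse_at_top_right] .
  then show "(flat n \<longlongrightarrow> 0) (at_right 0)"
    by (rule Lim_transform_eventually)
      (auto simp: eventually_at_filter flat_def exp_minus field_simps power_inverse)
qed

text \<open>The powers of \<open>t\<close> in the denominator make the family closed under
  differentiation, up to linear combinations; smoothness of every \<open>flat n\<close> then follows
  by induction on the order.\<close>

lemma flat_derivative: "DERIV (flat n) t :> flat (n + 2) t - of_nat n * flat (n + 1) t"
proof -
  consider "t < 0" | "t = 0" | "t > 0" by linarith
  then show ?thesis
  proof cases
    case 1
    have "DERIV (\<lambda>_. 0) t :> 0" by simp
    then have "DERIV (flat n) t :> 0"
      by (rule DERIV_cong_ev[THEN iffD1, rotated -1])
        (use 1 in \<open>auto simp: flat_def eventually_nhds intro!: exI[of _ "{..<0}"]\<close>)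
    then show ?thesis using 1 by (simp add: flat_def)
  next
    case 2
    \<comment> \<open>The difference quotient at 0 is \<open>flat (Suc n)\<close>, which tends to
      0.\<close>
    have "((\<lambda>h. (flat n (0 + h) - flat n 0) / h) \<longlongrightarrow> 0) (at 0)"
      by (rule Lim_transform_eventually[OF flat_tendsto_0[of "Suc n"]])
        (auto simp: eventually_at_filter flat_def field_simps)
    then show ?thesis using 2 by (simp add: DERIV_def flat_def)
  next
    case 3
    have p: "DERIV (\<lambda>t. t ^ n) t :> of_nat n * t ^ n / t"
      using DERIV_pow[of n t UNIV] 3 by (cases n) auto
    have e: "DERIV (\<lambda>t. exp (- 1 / t)) t :> exp (- 1 / t) * (1 / t\<^sup>2)"
      using 3 by (auto intro!: derivative_eq_intros simp: power2_eq_square)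
    have "DERIV (\<lambda>t. exp (- 1 / t) / t ^ n) t :>
        (exp (- 1 / t) * (1 / t\<^sup>2) * t ^ n - exp (- 1 / t) * (of_nat n * t ^ n / t)) / (t ^ n * t ^ n)"
      by (rule DERIV_divide[OF e p]) (use 3 in simp)
    also have "(exp (- 1 / t) * (1 / t\<^sup>2) * t ^ n - exp (- 1 / t) * (of_nat n * t ^ n / t)) / (t ^ n * t ^ n) =
        flat (n + 2) t - of_nat n * flat (n + 1) t"
      using 3 by (simp add: flat_def field_simps power2_eq_square power_add)
    finally have "DERIV (\<lambda>t. exp (- 1 / t) / t ^ n) t :> flat (n + 2) t - of_nat n * flat (n + 1) t" .
    then show ?thesis
      by (rule DERIV_cong_ev[THEN iffD1, rotated -1])
        (use 3 in \<open>auto simp: flat_def eventually_nhds intro!: exI[of _ "{0<..}"]\<close>)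
  qed
qed

lemma flat_ck_on: "ck_on m UNIV (flat n)"
proof (induction m arbitrary: n)
  case 0
  then show ?case using flat_derivative by (auto intro!: DERIV_isCont continuous_at_imp_continuous_on)
next
  case (Suc m)
  show ?case
  proof (rule ck_on_SucI)
    show "(flat n has_derivative (\<lambda>v. (flat (n + 2) t + (- of_nat n) * flat (n + 1) t) * v)) (at t)" for t
      using flat_derivative[of n t] by (simp add: has_field_derivative_def)
    show "ck_on m UNIV (\<lambda>x. (flat (n + 2) x + - real n * flat (n + 1) x) * v)" for v
      by (intro ck_on_bilinear[OF bounded_bilinear_mult] ck_on_add ck_on_const Suc.IH open_UNIV)
  qed auto
qed

text \<open>The squared distance, unlike the distance, is smooth at the centre too; the denominator
  normalises the value there to 1.\<close>

definition bump :: "'e::euclidean_space \<Rightarrow> real \<Rightarrow> 'e \<Rightarrow> real" where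
  "bump c r x = flat 0 (r\<^sup>2 - (x - c) \<bullet> (x - c)) / flat 0 (r\<^sup>2)"

lemma bump_center: "r > 0 \<Longrightarrow> bump c r c = 1"
  by (simp add: bump_def flat_def)

lemma bump_outside: "r > 0 \<Longrightarrow> x \<notin> ball c r \<Longrightarrow> bump c r x = 0"
proof -
  assume "r > 0" "x \<notin> ball c r"
  then have "r \<le> norm (x - c)" by (simp add: dist_norm norm_minus_commute)
  then have "r\<^sup>2 \<le> (x - c) \<bullet> (x - c)"
    using \<open>r > 0\<close> by (simp add: power2_norm_eq_inner[symmetric] power_mono)
  then show ?thesis by (simp add: bump_def flat_def)
qed

lemma bump_smooth: "smooth_on UNIV (bump c r)"
proof -
  have id: "smooth_on UNIV (\<lambda>x. x + - c)"
    by (intro smooth_on_add smooth_on_const smooth_on_bounded_linear bounded_linear_ident open_UNIV)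
  have "smooth_on UNIV (\<lambda>x. r\<^sup>2 + (-1) * ((x + - c) \<bullet> (x + - c)))"
    by (intro smooth_on_add smooth_on_mult smooth_on_inner smooth_on_const id open_UNIV)
  then have "smooth_on UNIV (\<lambda>x. flat 0 (r\<^sup>2 + (-1) * ((x + - c) \<bullet> (x + - c))))"
    by (rule smooth_on_compose[where T = UNIV, rotated 3]) (auto simp: smooth_on_def flat_ck_on)
  then have "smooth_on UNIV (\<lambda>x. flat 0 (r\<^sup>2 + (-1) * ((x + - c) \<bullet> (x + - c))) * (1 / flat 0 (r\<^sup>2)))"
    by (intro smooth_on_mult smooth_on_const open_UNIV)
  then show ?thesis by (simp add: bump_def[abs_def])
qed

section \<open>Functions and vector fields on a manifold\<close>

locale smooth_atlas =
  fixes A :: "('m::{t2_space, second_countable_topology}, 'e::euclidean_space) chart set"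
  assumes manifold: "smooth_manifold A"
begin

abbreviation img :: "('m, 'e) chart \<Rightarrow> 'e set" where "img C \<equiv> chart_map C ` chart_dom C"

abbreviation trans_map :: "('m, 'e) chart \<Rightarrow> ('m, 'e) chart \<Rightarrow> 'e \<Rightarrow> 'e" where
  "trans_map C D \<equiv> chart_map D \<circ> chart_inv C"

abbreviation trans_deriv :: "('m, 'e) chart \<Rightarrow> ('m, 'e) chart \<Rightarrow> 'm \<Rightarrow> 'e \<Rightarrow> 'e" where
  "trans_deriv C D q \<equiv> frechet_derivative (trans_map C D) (at (chart_map C q))"

abbreviation at_pt :: "'m \<Rightarrow> ('m, 'e) chart" where "at_pt \<equiv> chart_at A"

lemma is_chart: "C \<in> A \<Longrightarrow> is_chart C"
  using manifold by (auto simp: smooth_manifold_def)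

lemma chart_at: "chart_at A p \<in> A" "p \<in> chart_dom (chart_at A p)"
proof -
  have "p \<in> (\<Union>C\<in>A. chart_dom C)" using manifold by (simp only: smooth_manifold_def UNIV_I)
  then have "\<exists>C. C \<in> A \<and> p \<in> chart_dom C" by blast
  from someI_ex[OF this] show "chart_at A p \<in> A" "p \<in> chart_dom (chart_at A p)"
    by (auto simp: chart_at_def)
qed

lemma chart:
  assumes "C \<in> A"
  shows open_dom: "open (chart_dom C)" and open_img: "open (img C)"
    and cont_inv: "continuous_on (img C) (chart_inv C)"
    and inv_map: "q \<in> chart_dom C \<Longrightarrow> chart_inv C (chart_map C q) = q"
    and inv_dom: "x \<in> img C \<Longrightarrow> chart_inv C x \<in> chart_dom C"
    and map_inv: "x \<in> img C \<Longrightarrow> chart_map C (chart_inv C x) = x"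
  using is_chart[OF assms] by (auto simp: is_chart_def homeomorphism_def)

lemma open_preimage:
  assumes "C \<in> A" "open U" shows "open {x \<in> img C. chart_inv C x \<in> U}"
proof -
  have "open (img C \<inter> chart_inv C -` U)"
    by (rule continuous_open_preimage[OF cont_inv[OF assms(1)] open_img[OF assms(1)] assms(2)])
  moreover have "img C \<inter> chart_inv C -` U = {x \<in> img C. chart_inv C x \<in> U}" by auto
  ultimately show ?thesis by simp
qed

lemma image_overlap:
  assumes "C \<in> A" shows "chart_map C ` (chart_dom C \<inter> U) = {x \<in> img C. chart_inv C x \<in> U}"
  using inv_map[OF assms] map_inv[OF assms] inv_dom[OF assms] by (force simp: image_iff)

lemma open_overlap: "C \<in> A \<Longrightarrow> open U \<Longrightarrow> open (chart_map C ` (chart_dom C \<inter> U))"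
  by (simp add: image_overlap open_preimage)

lemma trans_smooth:
  "C \<in> A \<Longrightarrow> D \<in> A \<Longrightarrow> smooth_on (chart_map C ` (chart_dom C \<inter> chart_dom D)) (trans_map C D)"
  using manifold by (auto simp: smooth_manifold_def)

lemma trans_has_derivative:
  assumes "C \<in> A" "D \<in> A" "q \<in> chart_dom C" "q \<in> chart_dom D"
  shows "(trans_map C D has_derivative trans_deriv C D q) (at (chart_map C q))"
  by (rule smooth_on_has_derivative[OF trans_smooth]) (use assms in auto)

lemma linear_trans_deriv:
  assumes "C \<in> A" "D \<in> A" "q \<in> chart_dom C" "q \<in> chart_dom D"
  shows "linear (trans_deriv C D q)"
  using trans_has_derivative[OF assms] has_derivative_linear by blast

text \<open>Near the point, \<open>F\<close> read in \<open>C\<close> is \<open>F\<close> read in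
  \<open>D\<close> after the transition map, so this is the chain rule.\<close>

lemma frechet_chart_change:
  fixes F :: "'m \<Rightarrow> 'b::real_normed_vector"
  assumes C: "C \<in> A" and D: "D \<in> A" and q: "q \<in> chart_dom C" "q \<in> chart_dom D"
    and F: "((F \<circ> chart_inv D) has_derivative F') (at (chart_map D q))"
  shows "((F \<circ> chart_inv C) has_derivative (\<lambda>v. F' (trans_deriv C D q v))) (at (chart_map C q))"
proof -
  have "(F \<circ> chart_inv D has_derivative F') (at (trans_map C D (chart_map C q)))"
    using F by (simp add: inv_map[OF C q(1)])
  from has_derivative_compose[OF trans_has_derivative[OF C D q] this]
  show ?thesis
    by (rule has_derivative_transform_within_open[OF _ open_overlap[OF C open_dom[OF D]]])
      (use q inv_map[OF C] inv_map[OF D] in auto)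
qed

lemma trans_deriv_compose:
  assumes "C \<in> A" "D \<in> A" "E \<in> A" "q \<in> chart_dom C" "q \<in> chart_dom D" "q \<in> chart_dom E"
  shows "trans_deriv D E q (trans_deriv C D q v) = trans_deriv C E q v"
  using frechet_chart_change[OF assms(1,2,4,5) trans_has_derivative[OF assms(2,3,5,6)]]
  by (rule frechet_derivative_at[THEN fun_cong])

lemma trans_deriv_self:
  assumes "C \<in> A" "q \<in> chart_dom C" shows "trans_deriv C C q v = v"
proof -
  have "(trans_map C C has_derivative (\<lambda>v. v)) (at (chart_map C q))"
    by (rule has_derivative_transform_within_open[OF has_derivative_ident open_img[OF assms(1)]])
      (use assms map_inv[OF assms(1)] in auto)
  from frechet_derivative_at[OF this, symmetric] show ?thesis by simp
qed

lemma tangent_coord_eq: "tangent_coord A C p = trans_deriv (at_pt p) C p"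
  by (simp add: tangent_coord_def fun_eq_iff)

lemma linear_tangent_coord:
  "C \<in> A \<Longrightarrow> p \<in> chart_dom C \<Longrightarrow> linear (tangent_coord A C p)"
  unfolding tangent_coord_eq using linear_trans_deriv[OF chart_at(1) _ chart_at(2)] .

lemma tangent_coord_at: "tangent_coord A (at_pt p) p v = v"
  unfolding tangent_coord_eq by (rule trans_deriv_self[OF chart_at])

lemma tangent_coord_change:
  assumes "C \<in> A" "D \<in> A" "p \<in> chart_dom C" "p \<in> chart_dom D"
  shows "trans_deriv C D p (tangent_coord A C p v) = tangent_coord A D p v"
  unfolding tangent_coord_eq by (rule trans_deriv_compose[OF chart_at(1) assms(1,2) chart_at(2) assms(3,4)])

lemma tangent_coord_trans_deriv:
  assumes "C \<in> A" "D \<in> A" "p \<in> chart_dom C" "p \<in> chart_dom D"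
  shows "tangent_coord A D p (trans_deriv C (at_pt p) p v) = trans_deriv C D p v"
  unfolding tangent_coord_eq by (rule trans_deriv_compose[OF assms(1) chart_at(1) assms(2,3) chart_at(2) assms(4)])

lemma tangent_coord_inverse:
  "C \<in> A \<Longrightarrow> p \<in> chart_dom C \<Longrightarrow> trans_deriv C (at_pt p) p (tangent_coord A C p v) = v"
  using tangent_coord_change[OF _ chart_at(1) _ chart_at(2)] by (simp add: tangent_coord_at)

lemma local_rep_map: "C \<in> A \<Longrightarrow> q \<in> chart_dom C \<Longrightarrow> local_rep A C X (chart_map C q) = tangent_coord A C q (X q)"
  by (simp add: local_rep_def inv_map)

lemma smooth_funD: "smooth_fun A f \<Longrightarrow> C \<in> A \<Longrightarrow> smooth_on (img C) (f \<circ> chart_inv C)"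
  by (simp add: smooth_fun_def)

lemma vector_fieldsD: "X \<in> vector_fields A \<Longrightarrow> C \<in> A \<Longrightarrow> smooth_on (img C) (local_rep A C X)"
  by (simp add: vector_fields_def)

lemma smooth_fun_const: "smooth_fun A (\<lambda>q. c)"
  by (simp add: smooth_fun_def smooth_on_const o_def)

lemma smooth_fun_add: "smooth_fun A f \<Longrightarrow> smooth_fun A g \<Longrightarrow> smooth_fun A (\<lambda>q. f q + g q)"
  by (simp add: smooth_fun_def o_def smooth_on_add open_img)

lemma smooth_fun_mult: "smooth_fun A f \<Longrightarrow> smooth_fun A g \<Longrightarrow> smooth_fun A (\<lambda>q. f q * g q)"
  by (simp add: smooth_fun_def o_def smooth_on_mult open_img)

lemma smooth_fun_minus: "smooth_fun A f \<Longrightarrow> smooth_fun A (\<lambda>q. - f q)"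
  using smooth_fun_mult[OF smooth_fun_const[of "-1"], of f] by simp

lemma smooth_fun_diff: "smooth_fun A f \<Longrightarrow> smooth_fun A g \<Longrightarrow> smooth_fun A (\<lambda>q. f q - g q)"
  using smooth_fun_add[OF _ smooth_fun_minus, of f g] by simp

lemma vector_fields_add:
  assumes "X \<in> vector_fields A" "Y \<in> vector_fields A" shows "(\<lambda>q. X q + Y q) \<in> vector_fields A"
  unfolding vector_fields_def
proof safe
  fix C assume C: "C \<in> A"
  show "smooth_on (img C) (local_rep A C (\<lambda>q. X q + Y q))"
    by (rule smooth_on_cong[OF open_img[OF C] smooth_on_add[OF open_img[OF C] vector_fieldsD[OF assms(1) C] vector_fieldsD[OF assms(2) C]]])
      (simp add: local_rep_def linear_add[OF linear_tangent_coord[OF C inv_dom[OF C]]])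
qed

lemma vector_fields_scaleR:
  assumes "smooth_fun A f" "X \<in> vector_fields A" shows "(\<lambda>q. f q *\<^sub>R X q) \<in> vector_fields A"
  unfolding vector_fields_def
proof safe
  fix C assume C: "C \<in> A"
  show "smooth_on (img C) (local_rep A C (\<lambda>q. f q *\<^sub>R X q))"
    by (rule smooth_on_cong[OF open_img[OF C] smooth_on_scaleR[OF open_img[OF C] smooth_funD[OF assms(1) C] vector_fieldsD[OF assms(2) C]]])
      (simp add: local_rep_def linear_cmul[OF linear_tangent_coord[OF C inv_dom[OF C]]])
qed

lemma vector_fields_minus: "X \<in> vector_fields A \<Longrightarrow> (\<lambda>q. - X q) \<in> vector_fields A"
  using vector_fields_scaleR[OF smooth_fun_const[of "-1"], of X] by simp

lemma vector_fields_diff: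
  "X \<in> vector_fields A \<Longrightarrow> Y \<in> vector_fields A \<Longrightarrow> (\<lambda>q. X q - Y q) \<in> vector_fields A"
  using vector_fields_add[OF _ vector_fields_minus, of X Y] by simp

lemma smooth_fun_has_derivative:
  "smooth_fun A f \<Longrightarrow> C \<in> A \<Longrightarrow> q \<in> chart_dom C \<Longrightarrow>
    (f \<circ> chart_inv C has_derivative frechet_derivative (f \<circ> chart_inv C) (at (chart_map C q))) (at (chart_map C q))"
  by (rule smooth_on_has_derivative[OF smooth_funD]) auto

lemma vf_apply_chart:
  assumes "smooth_fun A f" "C \<in> A" "q \<in> chart_dom C"
  shows "vf_apply A X f q = frechet_derivative (f \<circ> chart_inv C) (at (chart_map C q)) (tangent_coord A C q (X q))"
proof -
  from frechet_derivative_at[OF frechet_chart_change[OF chart_at(1) assms(2) chart_at(2) assms(3)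
        smooth_fun_has_derivative[OF assms]], symmetric]
  show ?thesis by (simp add: vf_apply_def tangent_coord_eq)
qed

lemma vf_apply_img:
  assumes "smooth_fun A f" "C \<in> A" "x \<in> img C"
  shows "vf_apply A X f (chart_inv C x) = frechet_derivative (f \<circ> chart_inv C) (at x) (local_rep A C X x)"
  using vf_apply_chart[OF assms(1,2) inv_dom[OF assms(2,3)]] by (simp add: map_inv[OF assms(2,3)] local_rep_def)

lemma smooth_fun_vf_apply:
  assumes "smooth_fun A f" "X \<in> vector_fields A" shows "smooth_fun A (vf_apply A X f)"
  unfolding smooth_fun_def
proof
  fix C assume C: "C \<in> A"
  show "smooth_on (img C) (vf_apply A X f \<circ> chart_inv C)"
    by (rule smooth_on_cong[OF open_img[OF C] smooth_on_frechet_apply[OF open_img[OF C] smooth_funD[OF assms(1) C] vector_fieldsD[OF assms(2) C]]])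
      (simp add: vf_apply_img[OF assms(1) C])
qed

lemma vf_apply_add:
  assumes "smooth_fun A f" "smooth_fun A g"
  shows "vf_apply A X (\<lambda>q. f q + g q) p = vf_apply A X f p + vf_apply A X g p"
proof -
  have "((\<lambda>x. (f \<circ> chart_inv (at_pt p)) x + (g \<circ> chart_inv (at_pt p)) x) has_derivative
     (\<lambda>v. frechet_derivative (f \<circ> chart_inv (at_pt p)) (at (chart_map (at_pt p) p)) v +
          frechet_derivative (g \<circ> chart_inv (at_pt p)) (at (chart_map (at_pt p) p)) v)) (at (chart_map (at_pt p) p))"
    by (intro has_derivative_add smooth_fun_has_derivative assms chart_at)
  from frechet_derivative_at[OF this, symmetric] show ?thesis by (simp add: vf_apply_def o_def)
qed

lemma vf_apply_diff:
  assumes "smooth_fun A f" "smooth_fun A g"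
  shows "vf_apply A X (\<lambda>q. f q - g q) p = vf_apply A X f p - vf_apply A X g p"
  using vf_apply_add[OF smooth_fun_diff[OF assms] assms(2), of X p] by simp

lemma vf_apply_const: "vf_apply A X (\<lambda>q. c) p = 0"
  by (simp add: vf_apply_def o_def)

lemma vf_apply_minus:
  assumes "smooth_fun A f" shows "vf_apply A X (\<lambda>q. - f q) p = - vf_apply A X f p"
  using vf_apply_diff[OF smooth_fun_const[of 0] assms, of X p] by (simp add: vf_apply_const)

lemma linear_vf_apply:
  assumes "smooth_fun A f"
  shows "linear (\<lambda>v. vf_apply A (\<lambda>_. v) f p)"
  unfolding vf_apply_def
  using has_derivative_linear[OF smooth_fun_has_derivative[OF assms chart_at]] .

lemma vf_apply_at: "vf_apply A X f p = vf_apply A (\<lambda>_. X p) f p"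
  by (simp add: vf_apply_def)

text \<open>In the preferred chart at \<open>p\<close>, a second derivative of \<open>f\<close>
  along fields is a first-order term, which builds the bracket, plus the Hessian of
  \<open>f\<close>. The Hessian terms cancel in the commutator by symmetry.\<close>

lemma vf_apply_lie_bracket:
  assumes X: "X \<in> vector_fields A" and Y: "Y \<in> vector_fields A" and f: "smooth_fun A f"
  shows "vf_apply A (lie_bracket A X Y) f p =
    vf_apply A X (vf_apply A Y f) p - vf_apply A Y (vf_apply A X f) p"
proof -
  define C where "C = at_pt p"
  define x where "x = chart_map C p"
  have C: "C \<in> A" "p \<in> chart_dom C" using chart_at by (auto simp: C_def)
  have x: "x \<in> img C" using C by (simp add: x_def)
  let ?f = "f \<circ> chart_inv C"
  let ?D = "frechet_derivative ?f"
  \<comment> \<open>Tangent vectors at \<open>p\<close> are by definition stored in this chart, so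
    the local representative at \<open>x\<close> is the stored value.\<close>
  have rep: "local_rep A C Z x = Z p" for Z
    unfolding x_def local_rep_map[OF C] by (simp add: C_def tangent_coord_at)
  have second: "vf_apply A U (vf_apply A Z f) p =
      ?D (at x) (frechet_derivative (local_rep A C Z) (at x) (U p)) +
      frechet_derivative (\<lambda>y. ?D (at y) (U p)) (at x) (Z p)"
    if Z: "Z \<in> vector_fields A" for U Z
  proof -
    let ?g = "\<lambda>y. ?D (at y) (local_rep A C Z y)"
    have sm: "smooth_on (img C) ?g"
      by (rule smooth_on_frechet_apply[OF open_img[OF C(1)] smooth_funD[OF f C(1)] vector_fieldsD[OF Z C(1)]])
    have "frechet_derivative (vf_apply A Z f \<circ> chart_inv C) (at x) = frechet_derivative ?g (at x)"
      by (rule frechet_derivative_transform_within_open[symmetric, OF _ open_img[OF C(1)] x])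
        (use smooth_on_has_derivative[OF sm x] differentiableI vf_apply_img[OF f C(1)] in auto)
    then have "vf_apply A U (vf_apply A Z f) p = frechet_derivative ?g (at x) (U p)"
      by (simp add: vf_apply_def C_def x_def)
    also have "\<dots> = ?D (at x) (frechet_derivative (local_rep A C Z) (at x) (U p)) +
      frechet_derivative (\<lambda>y. ?D (at y) (U p)) (at x) (local_rep A C Z x)"
      by (rule frechet_derivative_directional[OF open_img[OF C(1)] x smooth_funD[OF f C(1)] vector_fieldsD[OF Z C(1)]])
    finally show ?thesis by (simp add: rep)
  qed
  have lin: "linear (?D (at x))"
    using smooth_on_has_derivative[OF smooth_funD[OF f C(1)] x] has_derivative_linear by blast
  have "vf_apply A (lie_bracket A X Y) f p = ?D (at x) (lie_bracket A X Y p)"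
    by (simp add: vf_apply_def C_def x_def)
  also have "\<dots> = ?D (at x) (frechet_derivative (local_rep A C Y) (at x) (X p)) -
      ?D (at x) (frechet_derivative (local_rep A C X) (at x) (Y p))"
    by (simp add: lie_bracket_def Let_def C_def[symmetric] x_def[symmetric] linear_diff[OF lin])
  finally show ?thesis
    using second_derivative_symmetric[OF smooth_on_ck[OF smooth_funD[OF f C(1)]] open_img[OF C(1)] x, of "X p" "Y p"]
    by (simp add: second[OF X] second[OF Y])
qed

section \<open>Cut-off functions, cut-off vector fields and tensoriality\<close>

definition bump_radius :: "('m, 'e) chart \<Rightarrow> 'm \<Rightarrow> real" where
  "bump_radius C p = (SOME r. r > 0 \<and> cball (chart_map C p) r \<subseteq> img C)"

definition bump_at :: "('m, 'e) chart \<Rightarrow> 'm \<Rightarrow> 'e \<Rightarrow> real" where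
  "bump_at C p = bump (chart_map C p) (bump_radius C p)"

context
  fixes C p assumes C: "C \<in> A" "p \<in> chart_dom C"
begin

lemma bump_radius: "bump_radius C p > 0" "cball (chart_map C p) (bump_radius C p) \<subseteq> img C"
proof -
  have "\<exists>r. r > 0 \<and> cball (chart_map C p) r \<subseteq> img C"
    using open_img[OF C(1)] C(2) open_contains_cball by blast
  from someI_ex[OF this] show "bump_radius C p > 0" "cball (chart_map C p) (bump_radius C p) \<subseteq> img C"
    by (simp_all add: bump_radius_def)
qed

lemma bump_at_center: "bump_at C p (chart_map C p) = 1"
  by (simp add: bump_at_def bump_center bump_radius)

lemma bump_at_smooth: "smooth_on S (bump_at C p)"
  unfolding bump_at_def by (rule smooth_on_subset[OF bump_smooth]) auto

text \<open>The closed ball is compact, so its image in the manifold is compact and, the manifold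
  being Hausdorff, closed.\<close>

lemma bump_at_support:
  obtains K where "closed K" "\<And>q. q \<in> chart_dom C \<Longrightarrow> q \<notin> K \<Longrightarrow> bump_at C p (chart_map C q) = 0"
    "K \<subseteq> chart_dom C"
proof
  let ?B = "cball (chart_map C p) (bump_radius C p)"
  have "compact (chart_inv C ` ?B)"
    by (rule compact_continuous_image[OF continuous_on_subset[OF cont_inv[OF C(1)] bump_radius(2)]]) simp
  then show "closed (chart_inv C ` ?B)" by (rule compact_imp_closed)
  show "bump_at C p (chart_map C q) = 0" if "q \<in> chart_dom C" "q \<notin> chart_inv C ` ?B" for q
  proof -
    have "chart_map C q \<notin> ?B" using that inv_map[OF C(1) that(1)] by (metis image_eqI)
    then show ?thesis unfolding bump_at_def by (intro bump_outside bump_radius) auto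
  qed
  show "chart_inv C ` ?B \<subseteq> chart_dom C" using bump_radius(2) inv_dom[OF C(1)] by blast
qed

text \<open>Smoothness is checked locally in \<open>D\<close>. Over the domain of \<open>C\<close>
  it is the assumption \<open>sm\<close>; at any other point the complement of the closed set
  \<open>K\<close> is a neighbourhood on which \<open>F\<close> vanishes.\<close>

lemma smooth_on_cutoff:
  fixes F :: "'e \<Rightarrow> 'b::real_normed_vector"
  assumes D: "D \<in> A" and sm: "smooth_on (chart_map D ` (chart_dom D \<inter> chart_dom C)) F"
    and out: "\<And>x. x \<in> img D \<Longrightarrow> chart_inv D x \<notin> chart_dom C \<Longrightarrow> F x = 0"
    and zero: "\<And>x. x \<in> img D \<Longrightarrow> chart_inv D x \<in> chart_dom C \<Longrightarrow> bump_at C p (trans_map D C x) = 0 \<Longrightarrow> F x = 0"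
  shows "smooth_on (img D) F"
proof (rule smooth_on_local)
  fix x assume x: "x \<in> img D"
  obtain K where K: "closed K" "\<And>q. q \<in> chart_dom C \<Longrightarrow> q \<notin> K \<Longrightarrow> bump_at C p (chart_map C q) = 0"
    "K \<subseteq> chart_dom C" using bump_at_support by blast
  show "\<exists>U. open U \<and> x \<in> U \<and> smooth_on U F"
  proof (cases "chart_inv D x \<in> chart_dom C")
    case True
    then show ?thesis
      using x sm open_overlap[OF D open_dom[OF C(1)]] unfolding image_overlap[OF D] by blast
  next
    case False
    let ?U = "{x \<in> img D. chart_inv D x \<in> - K}"
    have U: "open ?U" using open_preimage[OF D, of "- K"] K(1) by (simp add: open_Compl)
    have "F y = 0" if "y \<in> ?U" for y
      using that out[of y] zero[of y] K(2)[of "chart_inv D y"] by auto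
    then have "smooth_on ?U F"
      by (intro smooth_on_cong[OF U smooth_on_const[of ?U 0]]) simp
    moreover have "x \<in> ?U" using x False K(3) by auto
    ultimately show ?thesis using U by blast
  qed
qed

lemma smooth_on_trans_compose:
  assumes "D \<in> A" "smooth_on (img C) h"
  shows "smooth_on (chart_map D ` (chart_dom D \<inter> chart_dom C)) (\<lambda>x. h (trans_map D C x))"
  by (rule smooth_on_compose[OF open_overlap[OF assms(1) open_dom[OF C(1)]] open_img[OF C(1)] _ trans_smooth[OF assms(1) C(1)] assms(2)])
    (use inv_map[OF assms(1)] in auto)

lemma smooth_fun_cutoff:
  assumes h: "smooth_on (img C) h"
  shows "smooth_fun A (\<lambda>q. if q \<in> chart_dom C then bump_at C p (chart_map C q) * h (chart_map C q) else 0)"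
    (is "smooth_fun A ?f")
  unfolding smooth_fun_def
proof
  fix D assume D: "D \<in> A"
  let ?S = "chart_map D ` (chart_dom D \<inter> chart_dom C)"
  show "smooth_on (img D) (?f \<circ> chart_inv D)"
  proof (rule smooth_on_cutoff[OF D])
    have "smooth_on ?S (\<lambda>x. bump_at C p (trans_map D C x) * h (trans_map D C x))"
      by (rule smooth_on_trans_compose[OF D smooth_on_mult[OF open_img[OF C(1)] bump_at_smooth h]])
    then show "smooth_on ?S (?f \<circ> chart_inv D)"
      by (rule smooth_on_cong[OF open_overlap[OF D open_dom[OF C(1)]]]) (auto simp: inv_map[OF D])
  qed auto
qed

text \<open>The coordinate field of \<open>C\<close> with constant components \<open>e\<close>, cut
  off near \<open>p\<close>; \<open>trans_deriv\<close> rewrites it in the preferred chart of each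
  point, where tangent vectors are stored.\<close>

definition cutoff_field :: "'e \<Rightarrow> 'm \<Rightarrow> 'e" where
  "cutoff_field e q = (if q \<in> chart_dom C
     then bump_at C p (chart_map C q) *\<^sub>R trans_deriv C (at_pt q) q e else 0)"

lemma cutoff_field: "cutoff_field e \<in> vector_fields A"
  unfolding vector_fields_def
proof safe
  fix D assume D: "D \<in> A"
  let ?S = "chart_map D ` (chart_dom D \<inter> chart_dom C)"
  let ?F = "local_rep A D (cutoff_field e)"
  have lin: "linear (tangent_coord A D (chart_inv D x))" if "x \<in> img D" for x
    by (rule linear_tangent_coord[OF D inv_dom[OF D that]])
  have F: "?F x = bump_at C p (trans_map D C x) *\<^sub>R
      frechet_derivative (trans_map C D) (at (trans_map D C x)) e"
    if "x \<in> img D" "chart_inv D x \<in> chart_dom C" for x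
    using that tangent_coord_trans_deriv[OF C(1) D that(2) inv_dom[OF D that(1)]]
    by (simp add: local_rep_def cutoff_field_def linear_cmul[OF lin])
  show "smooth_on (img D) ?F"
  proof (rule smooth_on_cutoff[OF D])
    have o: "open ?S" by (rule open_overlap[OF D open_dom[OF C(1)]])
    have "smooth_on ?S (\<lambda>x. frechet_derivative (trans_map C D) (at (trans_map D C x)) e)"
      by (rule smooth_on_compose[OF o open_overlap[OF C(1) open_dom[OF D]] _ trans_smooth[OF D C(1)] smooth_on_frechet[OF trans_smooth[OF C(1) D]]])
        (use inv_map[OF D] in auto)
    then have "smooth_on ?S (\<lambda>x. bump_at C p (trans_map D C x) *\<^sub>R
      frechet_derivative (trans_map C D) (at (trans_map D C x)) e)"
      by (rule smooth_on_scaleR[OF o smooth_on_trans_compose[OF D bump_at_smooth]])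
    then show "smooth_on ?S ?F"
      by (rule smooth_on_cong[OF o]) (auto simp: F inv_map[OF D])
  qed (use F lin linear_0 in \<open>auto simp: local_rep_def cutoff_field_def\<close>)
qed

end

text \<open>Every tangent vector extends to a global field, which lets identities between fields be
  read as identities between vectors at a point.\<close>

lemma vector_field_through:
  obtains X where "X \<in> vector_fields A" "X p = v"
proof
  show "cutoff_field (at_pt p) p v \<in> vector_fields A" by (rule cutoff_field[OF chart_at])
  show "cutoff_field (at_pt p) p v p = v"
    by (simp add: cutoff_field_def[OF chart_at] chart_at bump_at_center[OF chart_at] trans_deriv_self[OF chart_at])
qed

text \<open>The test function is the cut-off of the affine coordinate function with gradient
  \<open>v\<close>. It vanishes at \<open>p\<close> before the cut-off, so the bump contributes no
  derivative and the result is \<open>v \<bullet> v\<close>.\<close>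

lemma vector_eq_0I:
  assumes "\<And>f. smooth_fun A f \<Longrightarrow> vf_apply A (\<lambda>_. v) f p = 0" shows "v = 0"
proof -
  let ?C = "at_pt p"
  let ?x = "chart_map ?C p"
  let ?h = "\<lambda>x. (x + - ?x) \<bullet> v"
  let ?f = "\<lambda>q. if q \<in> chart_dom ?C then bump_at ?C p (chart_map ?C q) * ?h (chart_map ?C q) else 0"
  have h: "smooth_on (img ?C) ?h"
    by (intro smooth_on_inner smooth_on_add smooth_on_bounded_linear bounded_linear_ident
        smooth_on_const open_img chart_at)
  have f: "smooth_fun A ?f" by (rule smooth_fun_cutoff[OF chart_at h])
  have x: "?x \<in> img ?C" using chart_at by simp
  have b: "(bump_at ?C p has_derivative frechet_derivative (bump_at ?C p) (at ?x)) (at ?x)"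
    by (rule smooth_on_has_derivative[OF bump_at_smooth[OF chart_at, of UNIV]]) simp
  have "((\<lambda>x. bump_at ?C p x * ?h x) has_derivative
      (\<lambda>w. bump_at ?C p ?x * (w \<bullet> v) + frechet_derivative (bump_at ?C p) (at ?x) w * ?h ?x)) (at ?x)"
    by (rule has_derivative_mult[OF b]) (auto intro!: derivative_eq_intros)
  then have "((\<lambda>x. bump_at ?C p x * ?h x) has_derivative (\<lambda>w. w \<bullet> v)) (at ?x)"
    by (simp add: bump_at_center[OF chart_at])
  then have "(?f \<circ> chart_inv ?C has_derivative (\<lambda>w. w \<bullet> v)) (at ?x)"
    by (rule has_derivative_transform_within_open[OF _ open_img[OF chart_at(1)] x])
      (use chart_at inv_map[OF chart_at(1)] in auto)
  from frechet_derivative_at[OF this, symmetric]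
  have "vf_apply A (\<lambda>_. v) ?f p = v \<bullet> v" by (simp add: vf_apply_def)
  then show ?thesis using assms[OF f] by simp
qed

text \<open>The coordinate expansion of \<open>X\<close> made global. Both the components and the
  coordinate fields need a bump factor, so \<open>\<rho>\<close> is the square of the bump.\<close>

lemma cutoff_decomposition:
  assumes X: "X \<in> vector_fields A" "X p = 0"
  shows "\<exists>\<rho> f F. smooth_fun A \<rho> \<and> \<rho> p = 1 \<and>
    (\<forall>i. smooth_fun A (f i) \<and> f i p = 0 \<and> F i \<in> vector_fields A) \<and>
    (\<forall>q. \<rho> q *\<^sub>R X q = (\<Sum>i\<in>Basis. f i q *\<^sub>R F (i::'e) q))"
proof -
  let ?C = "at_pt p"
  note C = chart_at(1)[of p] chart_at(2)[of p]
  let ?r = "\<lambda>q. if q \<in> chart_dom ?C then bump_at ?C p (chart_map ?C q) * 1 else 0"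
  let ?f = "\<lambda>i q. if q \<in> chart_dom ?C
    then bump_at ?C p (chart_map ?C q) * (local_rep A ?C X (chart_map ?C q) \<bullet> i) else 0"
  let ?F = "cutoff_field ?C p"
  have 1: "smooth_fun A (\<lambda>q. ?r q * ?r q)"
    by (intro smooth_fun_mult smooth_fun_cutoff[OF C] smooth_on_const)
  have 2: "?r p * ?r p = 1" using C by (simp add: bump_at_center[OF C])
  have 3: "smooth_fun A (?f i)" for i
    by (intro smooth_fun_cutoff[OF C] smooth_on_inner smooth_on_const open_img vector_fieldsD X C)
  have 4: "?f i p = 0" for i
    using X(2) by (simp add: local_rep_map[OF C] linear_0[OF linear_tangent_coord[OF C]])
  have 5: "?F i \<in> vector_fields A" for i by (rule cutoff_field[OF C])
  have 6: "(?r q * ?r q) *\<^sub>R X q = (\<Sum>i\<in>Basis. ?f i q *\<^sub>R ?F i q)" for q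
  proof (cases "q \<in> chart_dom ?C")
    case True
    let ?b = "bump_at ?C p (chart_map ?C q)"
    have "X q = trans_deriv ?C (at_pt q) q (local_rep A ?C X (chart_map ?C q))"
      by (simp add: local_rep_map[OF C(1) True] tangent_coord_inverse[OF C(1) True])
    also have "\<dots> = (\<Sum>i\<in>Basis. (local_rep A ?C X (chart_map ?C q) \<bullet> i) *\<^sub>R trans_deriv ?C (at_pt q) q i)"
      by (rule linear_euclidean_expansion[OF linear_trans_deriv[OF C(1) chart_at(1) True chart_at(2)]])
    finally have "(?b * ?b) *\<^sub>R X q =
      (?b * ?b) *\<^sub>R (\<Sum>i\<in>Basis. (local_rep A ?C X (chart_map ?C q) \<bullet> i) *\<^sub>R trans_deriv ?C (at_pt q) q i)"
      by (rule arg_cong)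
    then show ?thesis
      using True by (simp add: cutoff_field_def[OF C] scaleR_sum_right algebra_simps)
  qed (simp add: cutoff_field_def[OF C])
  show ?thesis
    by (rule exI[of _ "\<lambda>q. ?r q * ?r q"], rule exI[of _ ?f], rule exI[of _ ?F])
      (use 1 2 3 4 5 6 in blast)
qed

text \<open>The difference of the two fields vanishes at \<open>p\<close>. After multiplication by
  \<open>\<rho>\<close> it is a combination of fields with coefficients vanishing at
  \<open>p\<close>, which \<open>T\<close> sends to 0; and \<open>\<rho> p = 1\<close> removes the
  factor again.\<close>

lemma tensorial:
  fixes T :: "('m \<Rightarrow> 'e) \<Rightarrow> 'b::real_vector"
  assumes add: "\<And>X Y. X \<in> vector_fields A \<Longrightarrow> Y \<in> vector_fields A \<Longrightarrow> T (\<lambda>q. X q + Y q) = T X + T Y"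
    and scale: "\<And>f X. smooth_fun A f \<Longrightarrow> X \<in> vector_fields A \<Longrightarrow> T (\<lambda>q. f q *\<^sub>R X q) = f p *\<^sub>R T X"
    and X: "X \<in> vector_fields A" and Y: "Y \<in> vector_fields A" and eq: "X p = Y p"
  shows "T X = T Y"
proof -
  have T0: "T (\<lambda>q. 0) = 0" using scale[OF smooth_fun_const[of 0] X] by simp
  let ?Z = "\<lambda>q. X q - Y q"
  have Z: "?Z \<in> vector_fields A" "?Z p = 0" using vector_fields_diff[OF X Y] eq by auto
  obtain \<rho> f F where
    "smooth_fun A \<rho> \<and> \<rho> p = (1::real) \<and>
    (\<forall>i. smooth_fun A (f i) \<and> f i p = (0::real) \<and> F i \<in> vector_fields A) \<and>
    (\<forall>q. \<rho> q *\<^sub>R ?Z q = (\<Sum>i\<in>Basis. f i q *\<^sub>R F (i::'e) q))"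
    using cutoff_decomposition[OF Z] by (elim exE)
  then have *: "smooth_fun A \<rho>" "\<rho> p = (1::real)"
    "smooth_fun A (f i)" "f i p = (0::real)" "F i \<in> vector_fields A"
    "\<rho> q *\<^sub>R ?Z q = (\<Sum>i\<in>Basis. f i q *\<^sub>R F (i::'e) q)" for i q
    by blast+
  have "(\<lambda>q. \<Sum>i\<in>I. f i q *\<^sub>R F i q) \<in> vector_fields A \<and> T (\<lambda>q. \<Sum>i\<in>I. f i q *\<^sub>R F i q) = 0" for I
  proof (induction I rule: infinite_finite_induct)
    case (insert i I)
    have i: "(\<lambda>q. f i q *\<^sub>R F i q) \<in> vector_fields A" by (rule vector_fields_scaleR[OF *(3,5)])
    have "T (\<lambda>q. f i q *\<^sub>R F i q + (\<Sum>i\<in>I. f i q *\<^sub>R F i q)) = 0"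
      using insert.IH add[OF i, of "\<lambda>q. \<Sum>i\<in>I. f i q *\<^sub>R F i q"] scale[OF *(3,5)] *(4) by simp
    then show ?case using insert vector_fields_add[OF i] by simp
  qed (use T0 vector_fields_scaleR[OF smooth_fun_const[of 0] X] in auto)
  then have "T (\<lambda>q. \<rho> q *\<^sub>R ?Z q) = 0" unfolding *(6) by blast
  then have "T ?Z = 0" using scale[OF *(1) Z(1)] *(2) by simp
  then show ?thesis using add[OF Z(1) Y] by simp
qed

end

section \<open>The Levi-Civita connection and exterior derivatives\<close>

locale metric_connection = smooth_atlas A
  for A :: "('m::{t2_space, second_countable_topology}, 'e::euclidean_space) chart set" +
  fixes g :: "'m \<Rightarrow> 'e \<Rightarrow> 'e \<Rightarrow> real" and nabla :: "('m \<Rightarrow> 'e) \<Rightarrow> ('m \<Rightarrow> 'e) \<Rightarrow> 'm \<Rightarrow> 'e"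
  assumes riemannian: "riemannian_metric A g" and levi_civita: "levi_civita A g nabla"
begin

abbreviation V :: "('m \<Rightarrow> 'e) set" where "V \<equiv> vector_fields A"

sublocale metric: scalar_product "g p" for p
  by (rule scalar_product.intro) (use riemannian in \<open>auto simp: riemannian_metric_def\<close>)

lemma nabla_closed: "X \<in> V \<Longrightarrow> Y \<in> V \<Longrightarrow> nabla X Y \<in> V"
  and nabla_add_left: "X \<in> V \<Longrightarrow> X' \<in> V \<Longrightarrow> Y \<in> V \<Longrightarrow> nabla (\<lambda>q. X q + X' q) Y p = nabla X Y p + nabla X' Y p"
  and nabla_scale_left: "smooth_fun A f \<Longrightarrow> X \<in> V \<Longrightarrow> Y \<in> V \<Longrightarrow> nabla (\<lambda>q. f q *\<^sub>R X q) Y p = f p *\<^sub>R nabla X Y p"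
  and nabla_add: "X \<in> V \<Longrightarrow> Y \<in> V \<Longrightarrow> Y' \<in> V \<Longrightarrow> nabla X (\<lambda>q. Y q + Y' q) p = nabla X Y p + nabla X Y' p"
  and nabla_scale: "smooth_fun A f \<Longrightarrow> X \<in> V \<Longrightarrow> Y \<in> V \<Longrightarrow>
    nabla X (\<lambda>q. f q *\<^sub>R Y q) p = vf_apply A X f p *\<^sub>R Y p + f p *\<^sub>R nabla X Y p"
  and torsion_free: "X \<in> V \<Longrightarrow> Y \<in> V \<Longrightarrow> lie_bracket A X Y p = nabla X Y p - nabla Y X p"
  and metric_compat: "X \<in> V \<Longrightarrow> Y \<in> V \<Longrightarrow> W \<in> V \<Longrightarrow>
    vf_apply A X (\<lambda>q. g q (Y q) (W q)) p = g p (nabla X Y p) (W p) + g p (Y p) (nabla X W p)"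
  using levi_civita by (simp_all add: levi_civita_def affine_connection_def)

lemma nabla_minus: "X \<in> V \<Longrightarrow> Y \<in> V \<Longrightarrow> nabla X (\<lambda>q. - Y q) p = - nabla X Y p"
  using nabla_scale[OF smooth_fun_const[of "-1"], of X Y p] by (simp add: vf_apply_const)

lemma nabla_diff: "X \<in> V \<Longrightarrow> Y \<in> V \<Longrightarrow> Y' \<in> V \<Longrightarrow> nabla X (\<lambda>q. Y q - Y' q) p = nabla X Y p - nabla X Y' p"
  using nabla_add[OF _ _ vector_fields_minus, of X Y Y' p] by (simp add: nabla_minus)

lemma nabla_zero: "X \<in> V \<Longrightarrow> nabla X (\<lambda>q. 0) p = 0"
  using nabla_diff[of X X X p] by simp

lemma nabla_pointwise:
  assumes "X \<in> V" "X' \<in> V" "Y \<in> V" "X p = X' p" shows "nabla X Y p = nabla X' Y p"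
  by (rule tensorial[where T = "\<lambda>X. nabla X Y p" and p = p])
    (simp_all add: assms nabla_add_left nabla_scale_left)

lemma lie_bracket_closed:
  assumes "X \<in> V" "Y \<in> V" shows "lie_bracket A X Y \<in> V"
proof -
  have "lie_bracket A X Y = (\<lambda>p. nabla X Y p - nabla Y X p)"
    using torsion_free[OF assms] by blast
  then show ?thesis
    using vector_fields_diff[OF nabla_closed[OF assms] nabla_closed[OF assms(2,1)]] by simp
qed

lemma lie_bracket_anti: "lie_bracket A X Y p = - lie_bracket A Y X p"
  by (simp add: lie_bracket_def Let_def)

lemma smooth_metric: "X \<in> V \<Longrightarrow> Y \<in> V \<Longrightarrow> smooth_fun A (\<lambda>q. g q (X q) (Y q))"
  using riemannian by (simp add: riemannian_metric_def)

section \<open>The Jacobi identity and closedness of exterior derivatives\<close>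

lemma vf_apply_bracket_bracket:
  assumes "X \<in> V" "Y \<in> V" "W \<in> V" and f: "smooth_fun A f"
  shows "vf_apply A (lie_bracket A X (lie_bracket A Y W)) f p =
    vf_apply A X (vf_apply A Y (vf_apply A W f)) p - vf_apply A X (vf_apply A W (vf_apply A Y f)) p -
    (vf_apply A Y (vf_apply A W (vf_apply A X f)) p - vf_apply A W (vf_apply A Y (vf_apply A X f)) p)"
proof -
  note sm = smooth_fun_vf_apply[OF smooth_fun_vf_apply[OF f]]
  have "vf_apply A (lie_bracket A Y W) f = (\<lambda>q. vf_apply A Y (vf_apply A W f) q - vf_apply A W (vf_apply A Y f) q)"
    using vf_apply_lie_bracket[OF assms(2,3) f] by blast
  then show ?thesis
    using vf_apply_lie_bracket[OF assms(1) lie_bracket_closed[OF assms(2,3)] f, of p]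
      vf_apply_lie_bracket[OF assms(2,3) smooth_fun_vf_apply[OF f assms(1)], of p]
      vf_apply_diff[OF sm sm, of W Y Y W X p] assms by simp
qed

text \<open>Each double bracket acts on functions as a combination of four triple derivatives; the
  twelve terms cancel, and a tangent vector is determined by its action on functions.\<close>

lemma jacobi_identity:
  assumes "X \<in> V" "Y \<in> V" "W \<in> V"
  shows "lie_bracket A X (lie_bracket A Y W) p + lie_bracket A Y (lie_bracket A W X) p
    + lie_bracket A W (lie_bracket A X Y) p = 0"
proof (rule vector_eq_0I[of _ p])
  fix f assume f: "smooth_fun A f"
  have "vf_apply A (\<lambda>_. lie_bracket A X (lie_bracket A Y W) p + lie_bracket A Y (lie_bracket A W X) p
      + lie_bracket A W (lie_bracket A X Y) p) f p =
    vf_apply A (lie_bracket A X (lie_bracket A Y W)) f p + vf_apply A (lie_bracket A Y (lie_bracket A W X)) f p +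
    vf_apply A (lie_bracket A W (lie_bracket A X Y)) f p"
    unfolding vf_apply_at[of "lie_bracket A _ _"] using linear_add[OF linear_vf_apply[OF f, of p]] by simp
  also have "\<dots> = 0"
    using assms f by (simp add: vf_apply_bracket_bracket)
  finally show "vf_apply A (\<lambda>_. lie_bracket A X (lie_bracket A Y W) p + lie_bracket A Y (lie_bracket A W X) p
      + lie_bracket A W (lie_bracket A X Y) p) f p = 0" .
qed

text \<open>This is \<open>d (d \<alpha>) = 0\<close> in invariant form. The iterated derivatives of
  functions combine into derivatives along brackets, and the values of \<open>\<alpha>\<close> on
  double brackets add up to 0 by the Jacobi identity.\<close>

lemma d_fields_closed:
  assumes \<alpha>: "one_form A \<alpha>" and XYW: "X \<in> V" "Y \<in> V" "W \<in> V"
  shows "vf_apply A X (d_fields A \<alpha> Y W) p + vf_apply A Y (d_fields A \<alpha> W X) p + vf_apply A W (d_fields A \<alpha> X Y) p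
    = d_fields A \<alpha> (lie_bracket A X Y) W p + d_fields A \<alpha> (lie_bracket A Y W) X p + d_fields A \<alpha> (lie_bracket A W X) Y p"
proof -
  let ?a = "\<lambda>Y q. \<alpha> q (Y q)"
  have sm: "smooth_fun A (?a Y)" if "Y \<in> V" for Y using \<alpha> that by (simp add: one_form_def)
  have lin: "linear (\<alpha> p)" using \<alpha> by (simp add: one_form_def)
  have d: "vf_apply A X (d_fields A \<alpha> Y W) p = (1/2) * (vf_apply A X (vf_apply A Y (?a W)) p
     - vf_apply A X (vf_apply A W (?a Y)) p - vf_apply A X (?a (lie_bracket A Y W)) p)"
    if "X \<in> V" "Y \<in> V" "W \<in> V" for X Y W
  proof -
    let ?F = "\<lambda>q. vf_apply A Y (?a W) q - vf_apply A W (?a Y) q - ?a (lie_bracket A Y W) q"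
    have s: "smooth_fun A (vf_apply A Y (?a W))" "smooth_fun A (vf_apply A W (?a Y))" "smooth_fun A (?a (lie_bracket A Y W))"
      using that by (auto intro!: smooth_fun_vf_apply sm lie_bracket_closed)
    have half: "smooth_fun A (\<lambda>q. (1/2) * ?F q)"
      by (intro smooth_fun_mult smooth_fun_const smooth_fun_diff s)
    \<comment> \<open>The factor 1/2 passes through the derivative by additivity alone:
      \<open>?F\<close> is the sum of two copies of its half.\<close>
    have 1: "vf_apply A X ?F p = vf_apply A X (\<lambda>q. (1/2) * ?F q) p + vf_apply A X (\<lambda>q. (1/2) * ?F q) p"
      unfolding vf_apply_add[OF half half, symmetric] by simp
    have 2: "d_fields A \<alpha> Y W = (\<lambda>q. (1/2) * ?F q)" by (simp add: d_fields_def fun_eq_iff)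
    have 3: "vf_apply A X ?F p = vf_apply A X (vf_apply A Y (?a W)) p
     - vf_apply A X (vf_apply A W (?a Y)) p - vf_apply A X (?a (lie_bracket A Y W)) p"
      by (simp only: vf_apply_diff[OF smooth_fun_diff[OF s(1,2)] s(3)] vf_apply_diff[OF s(1,2)])
    have half_sum: "x = (1/2) * r" if "r = x + x" for x r :: real using that by simp
    show ?thesis unfolding 2 by (rule half_sum[OF 1[unfolded 3]])
  qed
  have J: "\<alpha> p (lie_bracket A (lie_bracket A X Y) W p) + \<alpha> p (lie_bracket A (lie_bracket A Y W) X p)
     + \<alpha> p (lie_bracket A (lie_bracket A W X) Y p) = 0"
  proof -
    have "lie_bracket A (lie_bracket A X Y) W p + lie_bracket A (lie_bracket A Y W) X p
       + lie_bracket A (lie_bracket A W X) Y p =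
       - (lie_bracket A X (lie_bracket A Y W) p + lie_bracket A Y (lie_bracket A W X) p + lie_bracket A W (lie_bracket A X Y) p)"
      by (simp add: lie_bracket_anti[of "lie_bracket A _ _"])
    then show ?thesis
      unfolding jacobi_identity[OF XYW] by (simp add: linear_0[OF lin] flip: linear_add[OF lin])
  qed
  show ?thesis
    unfolding d[OF XYW(1,2,3)] d[OF XYW(2,3,1)] d[OF XYW(3,1,2)]
    using J by (simp add: d_fields_def vf_apply_lie_bracket XYW sm lie_bracket_closed field_simps)
qed

section \<open>Covariant derivatives and torsion of almost complex structures\<close>

lemma nijenhuis_nabla:
  assumes J: "tensor11 A J" and XY: "X \<in> V" "Y \<in> V"
  shows "nijenhuis A J X Y p =
    nabla_tensor11 nabla J (\<lambda>q. J q (X q)) Y p - nabla_tensor11 nabla J (\<lambda>q. J q (Y q)) X p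
    + J p (nabla_tensor11 nabla J Y X p) - J p (nabla_tensor11 nabla J X Y p)"
proof -
  have JV: "(\<lambda>q. J q (X q)) \<in> V" if "X \<in> V" for X using J that by (simp add: tensor11_def)
  have lin: "linear (J p)" using J by (simp add: tensor11_def)
  \<comment> \<open>Each bracket is a difference of covariant derivatives by torsion-freeness, and
    the eight terms pair up into four values of the derivative of \<open>J\<close>.\<close>
  show ?thesis
    using XY JV by (simp add: nijenhuis_def nabla_tensor11_def torsion_free linear_diff[OF lin])
qed

lemma nabla_tensor11_add:
  assumes "tensor11 A J" "tensor11 A K" "X \<in> V" "Y \<in> V"
  shows "nabla_tensor11 nabla (\<lambda>p v. J p v + K p v) X Y p = nabla_tensor11 nabla J X Y p + nabla_tensor11 nabla K X Y p"
  using assms by (simp add: nabla_tensor11_def tensor11_def nabla_add)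

text \<open>Differentiate \<open>g (J Y) W = - g Y (J W)\<close> along \<open>X\<close> using metric
  compatibility.\<close>

lemma nabla_tensor11_skew:
  assumes J: "tensor11 A J" and skew: "\<And>p u v. g p (J p u) v = - g p u (J p v)"
    and XYW: "X \<in> V" "Y \<in> V" "W \<in> V"
  shows "g p (nabla_tensor11 nabla J X Y p) (W p) = - g p (nabla_tensor11 nabla J X W p) (Y p)"
proof -
  have JV: "(\<lambda>q. J q (X q)) \<in> V" if "X \<in> V" for X using J that by (simp add: tensor11_def)
  have "vf_apply A X (\<lambda>q. g q (J q (Y q)) (W q)) p = - vf_apply A X (\<lambda>q. g q (Y q) (J q (W q))) p"
    unfolding skew by (rule vf_apply_minus[OF smooth_metric[OF XYW(2) JV[OF XYW(3)]]])
  then have "g p (nabla X (\<lambda>q. J q (Y q)) p) (W p) + g p (J p (Y p)) (nabla X W p) =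
    - (g p (nabla X Y p) (J p (W p)) + g p (Y p) (nabla X (\<lambda>q. J q (W q)) p))"
    using XYW JV by (simp add: metric_compat)
  then show ?thesis
    using skew[of p "Y p" "nabla X W p"] skew[of p "nabla X Y p" "W p"]
      metric.g_sym[of p "Y p" "nabla X (\<lambda>q. J q (W q)) p"] metric.g_sym[of p "Y p" "J p (nabla X W p)"]
    by (simp add: nabla_tensor11_def metric.bilin)
qed

text \<open>With \<open>\<Psi>(X, Y, W) = g((\<nabla>\<^sub>X J) Y, W)\<close>, the torsion of \<open>J\<close> vanishes iff
  \<open>D(X, Y, W) = \<Psi>(JX, Y, W) + \<Psi>(X, Y, JW)\<close> is symmetric in \<open>X, Y\<close>. As \<open>D\<close> is skew in \<open>Y, W\<close>, it is zero.\<close>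

lemma hermitian_nabla:
  fixes p
  assumes J: "tensor11 A J" and skew: "\<And>p u v. g p (J p u) v = - g p u (J p v)"
    and JJ: "\<And>p v. J p (J p v) = - v"
    and N: "\<And>X Y p. X \<in> V \<Longrightarrow> Y \<in> V \<Longrightarrow> nijenhuis A J X Y p = 0"
    and XYW: "X \<in> V" "Y \<in> V" "W \<in> V"
  defines "\<Psi> \<equiv> \<lambda>X Y W. g p (nabla_tensor11 nabla J X Y p) (W p)"
  defines "S \<equiv> \<lambda>X Y W. \<Psi> X Y W + \<Psi> Y W X + \<Psi> W X Y"
  shows "2 * \<Psi> X Y W = S X Y W - S X (\<lambda>q. J q (Y q)) (\<lambda>q. J q (W q))"
proof -
  let ?J = "\<lambda>X q. J q (X q)"
  have JV: "?J X \<in> V" if "X \<in> V" for X using J that by (simp add: tensor11_def)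
  have lin: "linear (J p)" for p using J by (simp add: tensor11_def)
  have sk: "\<Psi> X Y W = - \<Psi> X W Y" if "X \<in> V" "Y \<in> V" "W \<in> V" for X Y W
    unfolding \<Psi>_def by (rule nabla_tensor11_skew[OF J skew that])
  \<comment> \<open>This is the derivative of \<open>J (J Y) = - Y\<close>.\<close>
  have anti: "nabla_tensor11 nabla J X (?J Y) p = - J p (nabla_tensor11 nabla J X Y p)"
    if "X \<in> V" "Y \<in> V" for X Y
    using that JV by (simp add: nabla_tensor11_def JJ nabla_minus linear_diff[OF lin])
  have jl: "\<Psi> X (?J Y) W = \<Psi> X Y (?J W)" if "X \<in> V" "Y \<in> V" "W \<in> V" for X Y W
    using that by (simp add: \<Psi>_def anti skew metric.bilin)
  have sym: "\<Psi> (?J X) Y W + \<Psi> X Y (?J W) = \<Psi> (?J Y) X W + \<Psi> Y X (?J W)"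
    if "X \<in> V" "Y \<in> V" "W \<in> V" for X Y W
  proof -
    have "g p (nijenhuis A J X Y p) (W p) = 0" using N that by (simp add: metric.bilin)
    then show ?thesis
      using that by (simp add: nijenhuis_nabla[OF J] \<Psi>_def metric.bilin skew)
  qed
  have D: "\<Psi> (?J X) Y W = - \<Psi> X Y (?J W)" if v: "X \<in> V" "Y \<in> V" "W \<in> V" for X Y W
  proof -
    define D where "D X Y W = \<Psi> (?J X) Y W + \<Psi> X Y (?J W)" for X Y W
    have s: "D X Y W = D Y X W" if "X \<in> V" "Y \<in> V" "W \<in> V" for X Y W
      unfolding D_def by (rule sym[OF that])
    have a: "D X Y W = - D X W Y" if "X \<in> V" "Y \<in> V" "W \<in> V" for X Y W
      unfolding D_def using sk[OF JV[OF that(1)] that(2,3)] sk[OF that(1,2) JV[OF that(3)]] jl[OF that(1,3,2)] by simp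
    \<comment> \<open>Symmetry in the first two slots and skewness in the last two are applied
      alternately, three times each. All arguments return to their places with sign -1.\<close>
    have "D X Y W = - D X Y W"
      using s[OF v(1,2,3)] a[OF v(2,1,3)] s[OF v(2,3,1)] a[OF v(3,2,1)] s[OF v(3,1,2)] a[OF v(1,3,2)] by simp
    then show ?thesis by (simp add: D_def)
  qed
  note JY = JV[OF XYW(2)] and JW = JV[OF XYW(3)]
  have JJf: "\<Psi> Y W (?J (?J X)) = - \<Psi> Y W X" for X Y W by (simp add: \<Psi>_def JJ metric.bilin)
  \<comment> \<open>Replacing \<open>Y\<close>, \<open>W\<close> by \<open>J Y\<close>,
    \<open>J W\<close> flips the first summand of the cyclic sum and fixes the other two, so the
    difference of the two cyclic sums is twice the first summand.\<close>
  have 1: "\<Psi> X (?J Y) (?J W) = - \<Psi> X Y W"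
    using jl[OF XYW(1,2) JW] JJf[of X Y W] by simp
  have 2: "\<Psi> (?J Y) (?J W) X = \<Psi> Y W X"
    using D[OF XYW(2) JW XYW(1)] jl[OF XYW(2,3) JV[OF XYW(1)]] JJf[of Y W X] by simp
  have 3: "\<Psi> (?J W) X (?J Y) = \<Psi> W X Y"
    using D[OF XYW(3,1) JY] JJf[of W X Y] by simp
  show ?thesis unfolding S_def 1 2 3 by simp
qed

section \<open>Exterior derivatives of one-forms with a metric dual\<close>

definition dual_field :: "('m \<Rightarrow> 'e \<Rightarrow> real) \<Rightarrow> ('m \<Rightarrow> 'e) \<Rightarrow> bool" where
  "dual_field \<alpha> Z \<longleftrightarrow> one_form A \<alpha> \<and> Z \<in> V \<and> (\<forall>p v. g p v (Z p) = \<alpha> p v)"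

context
  fixes \<alpha> Z assumes dual: "dual_field \<alpha> Z"
begin

lemma dual_form: "one_form A \<alpha>" "Z \<in> V" "\<alpha> p v = g p v (Z p)"
  using dual by (auto simp: dual_field_def)

lemma vf_apply_form:
  "X \<in> V \<Longrightarrow> Y \<in> V \<Longrightarrow>
    vf_apply A X (\<lambda>q. \<alpha> q (Y q)) p = \<alpha> p (nabla X Y p) + g p (nabla X Z p) (Y p)"
  using metric_compat[of X Y Z p] dual_form by (simp add: metric.g_sym)

text \<open>\<open>d \<alpha>\<close> is the skew part of the covariant derivative of the dual
  field: the values of \<open>\<alpha>\<close> on covariant derivatives cancel against the bracket
  term.\<close>

lemma d_fields_nabla:
  "X \<in> V \<Longrightarrow> Y \<in> V \<Longrightarrow> 2 * d_fields A \<alpha> X Y p = g p (nabla X Z p) (Y p) - g p (nabla Y Z p) (X p)"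
  by (simp add: d_fields_def vf_apply_form torsion_free) (simp add: dual_form metric.bilin)

text \<open>The description in \<open>ext_d\<close> is met because \<open>d_fields_nabla\<close>
  involves \<open>X\<close> and \<open>Y\<close> only through their values at \<open>p\<close> and
  through the covariant derivatives of \<open>Z\<close> along them, which are pointwise in the
  direction.\<close>

lemma ext_d_fields:
  assumes "X \<in> V" "Y \<in> V" shows "ext_d A \<alpha> p (X p) (Y p) = d_fields A \<alpha> X Y p"
  unfolding ext_d_def
proof (rule the_equality)
  show "\<forall>X'\<in>V. \<forall>Y'\<in>V. X' p = X p \<longrightarrow> Y' p = Y p \<longrightarrow> d_fields A \<alpha> X' Y' p = d_fields A \<alpha> X Y p"
  proof (intro ballI impI)
    fix X' Y' assume v: "X' \<in> V" "Y' \<in> V" and eq: "X' p = X p" "Y' p = Y p"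
    have "nabla X' Z p = nabla X Z p" "nabla Y' Z p = nabla Y Z p"
      using nabla_pointwise v assms eq dual_form(2) by blast+
    then show "d_fields A \<alpha> X' Y' p = d_fields A \<alpha> X Y p"
      using d_fields_nabla[OF v, of p] d_fields_nabla[OF assms, of p] eq by simp
  qed
qed (use assms in blast)

lemma ext_d_nabla:
  "X \<in> V \<Longrightarrow> Y \<in> V \<Longrightarrow> 2 * ext_d A \<alpha> p (X p) (Y p) = g p (nabla X Z p) (Y p) - g p (nabla Y Z p) (X p)"
  using ext_d_fields d_fields_nabla by simp

lemma ext_d_skew: "ext_d A \<alpha> p u v = - ext_d A \<alpha> p v u"
proof -
  obtain X where X: "X \<in> V" "X p = u" by (rule vector_field_through)
  obtain Y where Y: "Y \<in> V" "Y p = v" by (rule vector_field_through)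
  show ?thesis using ext_d_nabla[OF X(1) Y(1), of p] ext_d_nabla[OF Y(1) X(1), of p] X Y by simp
qed

lemma linear_ext_d: "linear (ext_d A \<alpha> p u)"
proof (rule linearI)
  obtain X where X: "X \<in> V" "X p = u" by (rule vector_field_through)
  show "ext_d A \<alpha> p u (v + w) = ext_d A \<alpha> p u v + ext_d A \<alpha> p u w" for v w
  proof -
    obtain Y where Y: "Y \<in> V" "Y p = v" by (rule vector_field_through)
    obtain W where W: "W \<in> V" "W p = w" by (rule vector_field_through)
    show ?thesis
      using ext_d_nabla[OF X(1) Y(1), of p] ext_d_nabla[OF X(1) W(1), of p] nabla_add_left[OF Y(1) W(1) dual_form(2), of p]
        ext_d_nabla[OF X(1) vector_fields_add[OF Y(1) W(1)], of p] X(2) Y(2) W(2) by (simp add: metric.bilin)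
  qed
  show "ext_d A \<alpha> p u (c *\<^sub>R v) = c *\<^sub>R ext_d A \<alpha> p u v" for c v
  proof -
    obtain Y where Y: "Y \<in> V" "Y p = v" by (rule vector_field_through)
    have "2 * ext_d A \<alpha> p u (c *\<^sub>R v) = c * (g p (nabla X Z p) v - g p (nabla Y Z p) u)"
      using nabla_scale_left[OF smooth_fun_const[of c] Y(1) dual_form(2), of p]
        ext_d_nabla[OF X(1) vector_fields_scaleR[OF smooth_fun_const[of c] Y(1)], of p] X(2) Y(2)
      by (simp add: metric.bilin algebra_simps)
    also have "\<dots> = c * (2 * ext_d A \<alpha> p u v)"
      using ext_d_nabla[OF X(1) Y(1), of p] X(2) Y(2) by simp
    finally show ?thesis by simp
  qed
qed

lemma ext_d_bilin:
  "ext_d A \<alpha> p u (v + w) = ext_d A \<alpha> p u v + ext_d A \<alpha> p u w"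
  "ext_d A \<alpha> p u (v - w) = ext_d A \<alpha> p u v - ext_d A \<alpha> p u w"
  "ext_d A \<alpha> p u (- v) = - ext_d A \<alpha> p u v"
  "ext_d A \<alpha> p u (c *\<^sub>R v) = c * ext_d A \<alpha> p u v"
  "ext_d A \<alpha> p u 0 = 0"
  "ext_d A \<alpha> p (v + w) u = ext_d A \<alpha> p v u + ext_d A \<alpha> p w u"
  "ext_d A \<alpha> p (v - w) u = ext_d A \<alpha> p v u - ext_d A \<alpha> p w u"
  "ext_d A \<alpha> p (- v) u = - ext_d A \<alpha> p v u"
  "ext_d A \<alpha> p (c *\<^sub>R v) u = c * ext_d A \<alpha> p v u"
  "ext_d A \<alpha> p 0 u = 0"
proof -
  note l = linear_ext_d[of p]
  show *: "ext_d A \<alpha> p u (v + w) = ext_d A \<alpha> p u v + ext_d A \<alpha> p u w"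
    "ext_d A \<alpha> p u (v - w) = ext_d A \<alpha> p u v - ext_d A \<alpha> p u w"
    "ext_d A \<alpha> p u (- v) = - ext_d A \<alpha> p u v"
    "ext_d A \<alpha> p u (c *\<^sub>R v) = c * ext_d A \<alpha> p u v"
    "ext_d A \<alpha> p u 0 = 0" for u v w c
    by (simp_all add: linear_add[OF l] linear_diff[OF l] linear_neg[OF l] linear_cmul[OF l] linear_0[OF l])
  show "ext_d A \<alpha> p (v + w) u = ext_d A \<alpha> p v u + ext_d A \<alpha> p w u"
    "ext_d A \<alpha> p (v - w) u = ext_d A \<alpha> p v u - ext_d A \<alpha> p w u"
    "ext_d A \<alpha> p (- v) u = - ext_d A \<alpha> p v u"
    "ext_d A \<alpha> p (c *\<^sub>R v) u = c * ext_d A \<alpha> p v u"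
    "ext_d A \<alpha> p 0 u = 0"
    unfolding ext_d_skew[of p _ u] by (simp_all add: *)
qed

text \<open>Closedness as the vanishing of the cyclic sum of the covariant derivative of
  \<open>d \<alpha>\<close>. The brackets in \<open>d_fields_closed\<close> split into covariant
  derivatives, which skewness regroups.\<close>

lemma ext_d_closed:
  fixes p
  assumes XYW: "X \<in> V" "Y \<in> V" "W \<in> V"
  defines "b \<equiv> ext_d A \<alpha> p"
  shows "vf_apply A X (\<lambda>q. ext_d A \<alpha> q (Y q) (W q)) p - b (nabla X Y p) (W p) - b (Y p) (nabla X W p)
    + (vf_apply A Y (\<lambda>q. ext_d A \<alpha> q (W q) (X q)) p - b (nabla Y W p) (X p) - b (W p) (nabla Y X p))
    + (vf_apply A W (\<lambda>q. ext_d A \<alpha> q (X q) (Y q)) p - b (nabla W X p) (Y p) - b (X p) (nabla W Y p)) = 0"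
proof -
  have br: "d_fields A \<alpha> (lie_bracket A X Y) W p = b (nabla X Y p) (W p) - b (nabla Y X p) (W p)"
    if "X \<in> V" "Y \<in> V" "W \<in> V" for X Y W
    unfolding b_def using ext_d_fields[OF lie_bracket_closed[OF that(1,2)] that(3), of p] that
    by (simp add: torsion_free ext_d_bilin)
  have fields: "(\<lambda>q. ext_d A \<alpha> q (X q) (Y q)) = d_fields A \<alpha> X Y" if "X \<in> V" "Y \<in> V" for X Y
    using ext_d_fields[OF that] by blast
  have sk: "b u v = - b v u" for u v unfolding b_def by (rule ext_d_skew)
  show ?thesis
    using d_fields_closed[OF dual_form(1) XYW, of p] XYW
      sk[of "Y p" "nabla X W p"] sk[of "W p" "nabla Y X p"] sk[of "X p" "nabla W Y p"]
    by (simp add: fields br)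
qed

lemma subspace_char_foliation: "subspace (char_foliation A \<alpha> p)"
proof -
  have lin: "linear (\<alpha> p)" using dual_form(1) by (simp add: one_form_def)
  show ?thesis
    unfolding char_foliation_def
    by (auto simp: subspace_def ext_d_bilin linear_add[OF lin] linear_cmul[OF lin] linear_0[OF lin])
qed

end

lemma smooth_fun_ext_d:
  assumes "dual_field \<alpha> Z" "X \<in> V" "Y \<in> V"
  shows "smooth_fun A (\<lambda>q. ext_d A \<alpha> q (X q) (Y q))"
proof -
  have sm: "smooth_fun A (\<lambda>q. \<alpha> q (Y q))" if "Y \<in> V" for Y
    using dual_form(1)[OF assms(1)] that by (simp add: one_form_def)
  have "(\<lambda>q. ext_d A \<alpha> q (X q) (Y q)) = (\<lambda>q. (1/2) * (vf_apply A X (\<lambda>q. \<alpha> q (Y q)) q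
      - vf_apply A Y (\<lambda>q. \<alpha> q (X q)) q - \<alpha> q (lie_bracket A X Y q)))"
    using ext_d_fields[OF assms] by (auto simp: d_fields_def)
  then show ?thesis
    by (simp only:) (intro smooth_fun_mult smooth_fun_const smooth_fun_diff smooth_fun_vf_apply sm
      lie_bracket_closed assms)
qed

end

section \<open>Contact pair structures with a compatible metric\<close>

locale contact_metric = metric_connection A g nabla
  for A :: "('m::{t2_space, second_countable_topology}, 'e::euclidean_space) chart set"
    and g :: "'m \<Rightarrow> 'e \<Rightarrow> 'e \<Rightarrow> real" and nabla :: "('m \<Rightarrow> 'e) \<Rightarrow> ('m \<Rightarrow> 'e) \<Rightarrow> 'm \<Rightarrow> 'e" +
  fixes h k :: nat and \<alpha>1 \<alpha>2 :: "'m \<Rightarrow> 'e \<Rightarrow> real" and Z1 Z2 :: "'m \<Rightarrow> 'e" and \<phi> :: "'m \<Rightarrow> 'e \<Rightarrow> 'e"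
  assumes form: "one_form A \<alpha>1" "one_form A \<alpha>2"
    and dimension: "DIM('e) = 2 * h + 2 * k + 2"
    and rank: "\<And>p v. wedge_power2 (ext_d A \<alpha>1 p) (h + 1) v = 0"
      "\<And>p v. wedge_power2 (ext_d A \<alpha>2 p) (k + 1) v = 0"
    and reeb: "reeb_fields A \<alpha>1 \<alpha>2 Z1 Z2"
    and tensor: "tensor11 A \<phi>"
    and phi_phi: "\<And>p v. \<phi> p (\<phi> p v) = - v + \<alpha>1 p v *\<^sub>R Z1 p + \<alpha>2 p v *\<^sub>R Z2 p"
    and phi_Z: "\<And>p. \<phi> p (Z1 p) = 0" "\<And>p. \<phi> p (Z2 p) = 0"
    and decomp: "decomposable A \<alpha>1 \<alpha>2 \<phi>"
    and compatible: "compatible_metric A \<alpha>1 \<alpha>2 \<phi> g"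

text \<open>All hypotheses are symmetric in the two indices, with \<open>h\<close> and
  \<open>k\<close> exchanged as well. Later facts about index 1 or about \<open>J\<close> are
  thereby transferred to index 2 and to \<open>T\<close>.\<close>

lemma (in contact_metric) swap: "contact_metric A g nabla k h \<alpha>2 \<alpha>1 Z2 Z1 \<phi>"
proof -
  have "reeb_fields A \<alpha>2 \<alpha>1 Z2 Z1" using reeb by (auto simp: reeb_fields_def)
  moreover have "decomposable A \<alpha>2 \<alpha>1 \<phi>" using decomp by (auto simp: decomposable_def)
  moreover have "compatible_metric A \<alpha>2 \<alpha>1 \<phi> g" using compatible by (auto simp: compatible_metric_def)
  ultimately show ?thesis
    using form dimension rank tensor phi_phi phi_Z
    by (intro contact_metric.intro metric_connection_axioms contact_metric_axioms.intro) auto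
qed

context contact_metric
begin

lemma reeb_closed: "Z1 \<in> V" "Z2 \<in> V"
  and form_reeb: "\<alpha>1 p (Z1 p) = 1" "\<alpha>1 p (Z2 p) = 0" "\<alpha>2 p (Z1 p) = 0" "\<alpha>2 p (Z2 p) = 1"
  and reeb_ext_d: "ext_d A \<alpha>1 p (Z1 p) v = 0" "ext_d A \<alpha>1 p (Z2 p) v = 0"
    "ext_d A \<alpha>2 p (Z1 p) v = 0" "ext_d A \<alpha>2 p (Z2 p) v = 0"
  using reeb by (auto simp: reeb_fields_def)

lemma linear_form: "linear (\<alpha>1 p)" "linear (\<alpha>2 p)"
  using form by (auto simp: one_form_def)

lemma form_lin: "\<alpha>1 p (u + v) = \<alpha>1 p u + \<alpha>1 p v" "\<alpha>1 p (u - v) = \<alpha>1 p u - \<alpha>1 p v"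
  "\<alpha>1 p (- u) = - \<alpha>1 p u" "\<alpha>1 p (c *\<^sub>R u) = c * \<alpha>1 p u" "\<alpha>1 p 0 = 0"
  "\<alpha>2 p (u + v) = \<alpha>2 p u + \<alpha>2 p v" "\<alpha>2 p (u - v) = \<alpha>2 p u - \<alpha>2 p v"
  "\<alpha>2 p (- u) = - \<alpha>2 p u" "\<alpha>2 p (c *\<^sub>R u) = c * \<alpha>2 p u" "\<alpha>2 p 0 = 0"
  using linear_form[of p] by (simp_all add: linear_add linear_diff linear_neg linear_cmul linear_0)

lemma linear_phi: "linear (\<phi> p)" using tensor by (simp add: tensor11_def)

lemma phi_closed: "X \<in> V \<Longrightarrow> (\<lambda>q. \<phi> q (X q)) \<in> V" using tensor by (simp add: tensor11_def)

lemma phi_lin: "\<phi> p (u + v) = \<phi> p u + \<phi> p v" "\<phi> p (u - v) = \<phi> p u - \<phi> p v"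
  "\<phi> p (- u) = - \<phi> p u" "\<phi> p (c *\<^sub>R u) = c *\<^sub>R \<phi> p u" "\<phi> p 0 = 0"
  using linear_phi[of p] by (simp_all add: linear_add linear_diff linear_neg linear_cmul linear_0)

text \<open>Computing the cube of \<open>\<phi>\<close> in two ways leaves a vanishing combination
  of \<open>Z1\<close> and \<open>Z2\<close>, whose coefficients are the two claimed values.\<close>

lemma form_phi: "\<alpha>1 p (\<phi> p v) = 0" "\<alpha>2 p (\<phi> p v) = 0"
proof -
  have "\<phi> p (\<phi> p (\<phi> p v)) = - \<phi> p v"
    by (simp only: phi_phi[of p v] phi_lin phi_Z) simp
  then have *: "\<alpha>1 p (\<phi> p v) *\<^sub>R Z1 p + \<alpha>2 p (\<phi> p v) *\<^sub>R Z2 p = 0"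
    using phi_phi[of p "\<phi> p v"] by simp
  from arg_cong[OF *, of "\<alpha>1 p"] arg_cong[OF *, of "\<alpha>2 p"]
  show "\<alpha>1 p (\<phi> p v) = 0" "\<alpha>2 p (\<phi> p v) = 0" by (simp_all add: form_lin form_reeb)
qed

lemma metric_phi: "g p (\<phi> p u) (\<phi> p v) = g p u v - \<alpha>1 p u * \<alpha>1 p v - \<alpha>2 p u * \<alpha>2 p v"
  using compatible by (simp add: compatible_metric_def)

text \<open>Compatibility with one argument a Reeb vector has left side 0, since
  \<open>\<phi>\<close> kills it. A compatible metric thus makes the Reeb fields dual to the
  forms.\<close>

lemma metric_reeb: "g p v (Z1 p) = \<alpha>1 p v" "g p v (Z2 p) = \<alpha>2 p v"
  "g p (Z1 p) v = \<alpha>1 p v" "g p (Z2 p) v = \<alpha>2 p v"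
  using metric_phi[of p v "Z1 p"] metric_phi[of p v "Z2 p"] metric.g_sym[of p _ v]
  by (simp_all add: phi_Z metric.bilin form_reeb)

lemma phi_skew: "g p (\<phi> p u) v = - g p u (\<phi> p v)"
  using metric_phi[of p u "\<phi> p v"] by (simp add: phi_phi metric.bilin metric_reeb form_phi)

lemma dual: "dual_field \<alpha>1 Z1" "dual_field \<alpha>2 Z2"
  by (auto simp: dual_field_def form reeb_closed metric_reeb)

lemmas bilin1 = ext_d_bilin[OF dual(1)] and bilin2 = ext_d_bilin[OF dual(2)]

lemma reeb_ext_d': "ext_d A \<alpha>1 p v (Z1 p) = 0" "ext_d A \<alpha>1 p v (Z2 p) = 0"
    "ext_d A \<alpha>2 p v (Z1 p) = 0" "ext_d A \<alpha>2 p v (Z2 p) = 0"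
  using ext_d_skew[OF dual(1), of p v] ext_d_skew[OF dual(2), of p v] by (simp_all add: reeb_ext_d)

section \<open>Characteristic foliations and their orthogonal projections\<close>

abbreviation "K1 \<equiv> char_foliation A \<alpha>1"
abbreviation "K2 \<equiv> char_foliation A \<alpha>2"

lemma subspace_K: "subspace (K1 p)" "subspace (K2 p)"
  by (rule subspace_char_foliation dual)+

lemma K_iff: "v \<in> K1 p \<longleftrightarrow> \<alpha>1 p v = 0 \<and> (\<forall>w. ext_d A \<alpha>1 p v w = 0)"
  "v \<in> K2 p \<longleftrightarrow> \<alpha>2 p v = 0 \<and> (\<forall>w. ext_d A \<alpha>2 p v w = 0)"
  by (auto simp: char_foliation_def)

lemma reeb_in_K: "Z1 p \<in> K2 p" "Z2 p \<in> K1 p"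
  by (auto simp: K_iff form_reeb reeb_ext_d)

lemma phi_K: "v \<in> K1 p \<Longrightarrow> \<phi> p v \<in> K1 p" "v \<in> K2 p \<Longrightarrow> \<phi> p v \<in> K2 p"
  using decomp unfolding decomposable_def by blast+

text \<open>The indices cross: the component with index 1 is tangent to the second foliation, which
  contains \<open>Z1\<close>.\<close>

definition pr1 :: "'m \<Rightarrow> 'e \<Rightarrow> 'e" where "pr1 p = orth_proj (g p) (K2 p)"
definition pr2 :: "'m \<Rightarrow> 'e \<Rightarrow> 'e" where "pr2 p = orth_proj (g p) (K1 p)"

lemma pr_in: "pr1 p v \<in> K2 p" "pr2 p v \<in> K1 p"
  unfolding pr1_def pr2_def by (rule metric.orth_proj subspace_K)+

lemma pr_metric: "u \<in> K2 p \<Longrightarrow> g p u (pr1 p v) = g p u v" "u \<in> K1 p \<Longrightarrow> g p u (pr2 p v) = g p u v"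
  unfolding pr1_def pr2_def by (simp_all add: metric.orth_proj subspace_K)

lemma pr_metric': "u \<in> K2 p \<Longrightarrow> g p (pr1 p v) u = g p v u" "u \<in> K1 p \<Longrightarrow> g p (pr2 p v) u = g p v u"
  using pr_metric metric.g_sym by metis+

lemma pr_same: "v \<in> K2 p \<Longrightarrow> pr1 p v = v" "v \<in> K1 p \<Longrightarrow> pr2 p v = v"
  unfolding pr1_def pr2_def by (rule metric.orth_proj_eq; simp add: subspace_K metric.bilin)+

lemma form_pr: "\<alpha>1 p (pr1 p v) = \<alpha>1 p v" "\<alpha>2 p (pr2 p v) = \<alpha>2 p v"
  "\<alpha>2 p (pr1 p v) = 0" "\<alpha>1 p (pr2 p v) = 0"
  using pr_metric(1)[OF reeb_in_K(1), of p v] pr_metric(2)[OF reeb_in_K(2), of p v] pr_in[of p v]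
  by (auto simp: metric_reeb K_iff)

lemma pr_reeb: "pr1 p (Z1 p) = Z1 p" "pr2 p (Z2 p) = Z2 p" "pr1 p (Z2 p) = 0" "pr2 p (Z1 p) = 0"
proof -
  show "pr1 p (Z1 p) = Z1 p" "pr2 p (Z2 p) = Z2 p" by (simp_all add: pr_same reeb_in_K)
  show "pr1 p (Z2 p) = 0" unfolding pr1_def
    by (rule metric.orth_proj_eq) (auto simp: subspace_K metric_reeb K_iff form_lin bilin1 bilin2)
  show "pr2 p (Z1 p) = 0" unfolding pr2_def
    by (rule metric.orth_proj_eq) (auto simp: subspace_K metric_reeb K_iff form_lin bilin1 bilin2)
qed

text \<open>The rank bounds give dimensions at least \<open>DIM('e) - (2 * h + 1)\<close> and
  \<open>DIM('e) - (2 * k + 1)\<close>, whose sum is \<open>DIM('e)\<close>. Orthogonality makes the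
  intersection trivial; it is a premise because each direction of the equivalence proves it in its
  own way.\<close>

lemma orthogonal_decomposition:
  assumes perp: "\<And>u v. u \<in> K1 p \<Longrightarrow> v \<in> K2 p \<Longrightarrow> g p u v = 0"
  shows "v = pr1 p v + pr2 p v"
proof -
  have "K1 p \<inter> K2 p \<subseteq> {0}"
  proof
    fix v assume "v \<in> K1 p \<inter> K2 p"
    then show "v \<in> {0}" using perp[of v v] metric.g_pos[of v p] by auto
  qed
  moreover have "DIM('e) \<le> dim (K1 p) + dim (K2 p)"
    using dim_form_kernel[OF linear_ext_d[OF dual(1)] ext_d_skew[OF dual(1)] rank(1) linear_form(1), of p p]
      dim_form_kernel[OF linear_ext_d[OF dual(2)] ext_d_skew[OF dual(2)] rank(2) linear_form(2), of p p]
      dimension by (simp add: char_foliation_def)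
  ultimately obtain x y where xy: "x \<in> K1 p" "y \<in> K2 p" "v = x + y"
    using subspace_sum_UNIV[OF subspace_K(1,2)] by blast
  have "pr2 p v = x" unfolding pr2_def
    by (rule metric.orth_proj_eq[OF subspace_K(1) xy(1)]) (simp add: xy metric.g_sym[of p y] perp)
  moreover have "pr1 p v = y" unfolding pr1_def
    by (rule metric.orth_proj_eq[OF subspace_K(2) xy(2)]) (simp add: xy perp)
  ultimately show ?thesis using xy by simp
qed

section \<open>The almost complex structure J and its covariant derivative\<close>

definition rhs :: "'m \<Rightarrow> 'e \<Rightarrow> 'e \<Rightarrow> 'e" where
  "rhs p x y = (g p (pr1 p x) (pr1 p y) *\<^sub>R Z1 p - \<alpha>1 p (pr1 p y) *\<^sub>R pr1 p x) +
    (g p (pr2 p x) (pr2 p y) *\<^sub>R Z2 p - \<alpha>2 p (pr2 p y) *\<^sub>R pr2 p x)"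

definition J :: "'m \<Rightarrow> 'e \<Rightarrow> 'e" where "J p v = \<phi> p v - \<alpha>2 p v *\<^sub>R Z1 p + \<alpha>1 p v *\<^sub>R Z2 p"

definition \<psi> :: "'m \<Rightarrow> 'e \<Rightarrow> 'e" where "\<psi> p v = \<alpha>1 p v *\<^sub>R Z2 p - \<alpha>2 p v *\<^sub>R Z1 p"

lemma smooth_form: "X \<in> V \<Longrightarrow> smooth_fun A (\<lambda>q. \<alpha>1 q (X q))" "X \<in> V \<Longrightarrow> smooth_fun A (\<lambda>q. \<alpha>2 q (X q))"
  using form by (auto simp: one_form_def)

lemma tensor_psi: "tensor11 A \<psi>"
  unfolding tensor11_def \<psi>_def
proof (intro conjI allI ballI)
  show "linear (\<lambda>v. \<alpha>1 p v *\<^sub>R Z2 p - \<alpha>2 p v *\<^sub>R Z1 p)" for p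
    by (rule linearI) (simp_all add: form_lin algebra_simps)
  show "(\<lambda>q. \<alpha>1 q (X q) *\<^sub>R Z2 q - \<alpha>2 q (X q) *\<^sub>R Z1 q) \<in> V" if "X \<in> V" for X
    by (intro vector_fields_diff vector_fields_scaleR smooth_form reeb_closed that)
qed

lemma J_eq: "J = (\<lambda>p v. \<phi> p v + \<psi> p v)"
  by (simp add: J_def \<psi>_def fun_eq_iff)

lemma tensor_J: "tensor11 A J"
  using tensor tensor_psi unfolding J_eq tensor11_def
  by (auto intro!: vector_fields_add linear_compose_add)

lemma J_J: "J p (J p v) = - v"
  by (simp add: J_def phi_lin form_lin form_phi phi_Z form_reeb phi_phi)

lemma J_skew: "g p (J p u) v = - g p u (J p v)"
  by (simp add: J_def metric.bilin phi_skew metric_reeb)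

text \<open>By the product rule; \<open>vf_apply_form\<close> turns the derivative of a form along
  \<open>X\<close> into the covariant derivative of its Reeb field.\<close>

lemma nabla_psi:
  assumes "X \<in> V" "Y \<in> V"
  shows "nabla_tensor11 nabla \<psi> X Y p = g p (nabla X Z1 p) (Y p) *\<^sub>R Z2 p + \<alpha>1 p (Y p) *\<^sub>R nabla X Z2 p
    - g p (nabla X Z2 p) (Y p) *\<^sub>R Z1 p - \<alpha>2 p (Y p) *\<^sub>R nabla X Z1 p"
proof -
  have v: "(\<lambda>q. \<alpha>1 q (Y q) *\<^sub>R Z2 q) \<in> V" "(\<lambda>q. \<alpha>2 q (Y q) *\<^sub>R Z1 q) \<in> V"
    by (intro vector_fields_scaleR smooth_form reeb_closed assms)+
  have "nabla X (\<lambda>q. \<psi> q (Y q)) p =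
    (vf_apply A X (\<lambda>q. \<alpha>1 q (Y q)) p *\<^sub>R Z2 p + \<alpha>1 p (Y p) *\<^sub>R nabla X Z2 p) -
    (vf_apply A X (\<lambda>q. \<alpha>2 q (Y q)) p *\<^sub>R Z1 p + \<alpha>2 p (Y p) *\<^sub>R nabla X Z1 p)"
    unfolding \<psi>_def by (simp add: nabla_diff[OF assms(1) v] nabla_scale smooth_form assms reeb_closed)
  then show ?thesis
    by (simp add: nabla_tensor11_def vf_apply_form[OF dual(1)] vf_apply_form[OF dual(2)] assms)
      (simp add: \<psi>_def algebra_simps)
qed

lemma nabla_J:
  assumes "X \<in> V" "Y \<in> V"
  shows "nabla_tensor11 nabla J X Y p = nabla_tensor11 nabla \<phi> X Y p +
    (g p (nabla X Z1 p) (Y p) *\<^sub>R Z2 p + \<alpha>1 p (Y p) *\<^sub>R nabla X Z2 p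
    - g p (nabla X Z2 p) (Y p) *\<^sub>R Z1 p - \<alpha>2 p (Y p) *\<^sub>R nabla X Z1 p)"
  unfolding J_eq nabla_tensor11_add[OF tensor tensor_psi assms] nabla_psi[OF assms] ..

subsection \<open>From a normal metric contact pair to the covariant derivative\<close>

context
  assumes assoc: "\<And>p u v. g p u (\<phi> p v) = ext_d A \<alpha>1 p u v + ext_d A \<alpha>2 p u v"
begin

text \<open>By \<open>assoc\<close> the fundamental form of \<open>\<phi>\<close> is the sum of two
  exterior derivatives. The terms are, up to sign, its covariant derivatives, and their cyclic sum
  vanishes by closedness.\<close>

lemma cyclic_nabla_phi:
  assumes XYW: "X \<in> V" "Y \<in> V" "W \<in> V"
  shows "g p (nabla_tensor11 nabla \<phi> X Y p) (W p) + g p (nabla_tensor11 nabla \<phi> Y W p) (X p)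
    + g p (nabla_tensor11 nabla \<phi> W X p) (Y p) = 0"
proof -
  let ?e = "\<lambda>\<alpha> X Y q. ext_d A \<alpha> q (X q) (Y q)"
  have sk: "ext_d A \<alpha>1 q u v = - ext_d A \<alpha>1 q v u" "ext_d A \<alpha>2 q u v = - ext_d A \<alpha>2 q v u" for q u v
    by (rule ext_d_skew dual)+
  have \<phi>: "g q (\<phi> q u) v = - (ext_d A \<alpha>1 q u v + ext_d A \<alpha>2 q u v)" for q u v
    using assoc[of q u v] by (simp add: phi_skew)
  note sm = smooth_fun_ext_d[OF dual(1)] smooth_fun_ext_d[OF dual(2)]
  have N: "g p (nabla_tensor11 nabla \<phi> X Y p) (W p) =
    - (vf_apply A X (?e \<alpha>1 Y W) p - ext_d A \<alpha>1 p (nabla X Y p) (W p) - ext_d A \<alpha>1 p (Y p) (nabla X W p))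
    - (vf_apply A X (?e \<alpha>2 Y W) p - ext_d A \<alpha>2 p (nabla X Y p) (W p) - ext_d A \<alpha>2 p (Y p) (nabla X W p))"
    if "X \<in> V" "Y \<in> V" "W \<in> V" for X Y W
  proof -
    have "vf_apply A X (\<lambda>q. g q (\<phi> q (Y q)) (W q)) p = - (vf_apply A X (?e \<alpha>1 Y W) p + vf_apply A X (?e \<alpha>2 Y W) p)"
      unfolding \<phi> vf_apply_minus[OF smooth_fun_add[OF sm(1)[OF that(2,3)] sm(2)[OF that(2,3)]]]
        vf_apply_add[OF sm(1)[OF that(2,3)] sm(2)[OF that(2,3)]] ..
    then show ?thesis
      using metric_compat[OF that(1) phi_closed[OF that(2)] that(3), of p]
      by (simp add: nabla_tensor11_def metric.bilin \<phi>)
  qed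
  show ?thesis
    unfolding N[OF XYW(1,2,3)] N[OF XYW(2,3,1)] N[OF XYW(3,1,2)]
    using ext_d_closed[OF dual(1) XYW, of p] ext_d_closed[OF dual(2) XYW, of p] by linarith
qed

text \<open>\<open>hermitian_nabla\<close> needs only the cyclic sums of the derivative of
  \<open>J\<close>. There \<open>\<phi>\<close> contributes nothing, and the contribution of
  \<open>\<psi>\<close> is algebraic because the skew part of the derivative of a Reeb field is the
  exterior derivative of its form.\<close>

lemma nabla_J_integrable:
  fixes p
  assumes N: "\<And>X Y p. X \<in> V \<Longrightarrow> Y \<in> V \<Longrightarrow> nijenhuis A J X Y p = 0"
    and XYW: "X \<in> V" "Y \<in> V" "W \<in> V"
  defines "b1 \<equiv> ext_d A \<alpha>1 p" and "b2 \<equiv> ext_d A \<alpha>2 p"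
  defines "x \<equiv> X p" and "y \<equiv> Y p" and "w \<equiv> W p"
  shows "g p (nabla_tensor11 nabla J X Y p) w =
    b1 x y * \<alpha>2 p w - b2 x y * \<alpha>1 p w + b1 y w * \<alpha>2 p x - b2 y w * \<alpha>1 p x + b1 w x * \<alpha>2 p y - b2 w x * \<alpha>1 p y
    - (b1 x (\<phi> p y) * \<alpha>1 p w + b2 x (\<phi> p y) * \<alpha>2 p w + b1 (\<phi> p y) (\<phi> p w) * \<alpha>2 p x
       - b2 (\<phi> p y) (\<phi> p w) * \<alpha>1 p x + b1 (\<phi> p w) x * \<alpha>1 p y + b2 (\<phi> p w) x * \<alpha>2 p y)"
proof -
  let ?\<Psi> = "\<lambda>X Y W. g p (nabla_tensor11 nabla J X Y p) (W p)"
  let ?S = "\<lambda>x y w. 2 * (b1 x y * \<alpha>2 p w - b2 x y * \<alpha>1 p w + b1 y w * \<alpha>2 p x - b2 y w * \<alpha>1 p x + b1 w x * \<alpha>2 p y - b2 w x * \<alpha>1 p y)"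
  have S: "?\<Psi> X Y W + ?\<Psi> Y W X + ?\<Psi> W X Y = ?S (X p) (Y p) (W p)" if v: "X \<in> V" "Y \<in> V" "W \<in> V" for X Y W
  proof -
    have e: "2 * b1 (X p) (Y p) = g p (nabla X Z1 p) (Y p) - g p (nabla Y Z1 p) (X p)"
      "2 * b2 (X p) (Y p) = g p (nabla X Z2 p) (Y p) - g p (nabla Y Z2 p) (X p)"
      if "X \<in> V" "Y \<in> V" for X Y
      unfolding b1_def b2_def by (rule ext_d_nabla dual that)+
    have "?S (X p) (Y p) (W p) = (2 * b1 (X p) (Y p)) * \<alpha>2 p (W p) - (2 * b2 (X p) (Y p)) * \<alpha>1 p (W p)
      + (2 * b1 (Y p) (W p)) * \<alpha>2 p (X p) - (2 * b2 (Y p) (W p)) * \<alpha>1 p (X p)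
      + (2 * b1 (W p) (X p)) * \<alpha>2 p (Y p) - (2 * b2 (W p) (X p)) * \<alpha>1 p (Y p)" by simp
    also have "\<dots> = ?\<Psi> X Y W + ?\<Psi> Y W X + ?\<Psi> W X Y"
      unfolding e[OF v(1,2)] e[OF v(2,3)] e[OF v(3,1)]
      using cyclic_nabla_phi[OF v, of p] v
      by (simp add: nabla_J metric.bilin metric_reeb algebra_simps)
    finally show ?thesis by simp
  qed
  have JV: "(\<lambda>q. J q (X q)) \<in> V" if "X \<in> V" for X using tensor_J that by (simp add: tensor11_def)
  have "2 * ?\<Psi> X Y W = ?S x y w - ?S x (J p y) (J p w)"
    using hermitian_nabla[OF tensor_J J_skew J_J N XYW, of p] S[OF XYW] S[OF XYW(1) JV[OF XYW(2)] JV[OF XYW(3)]]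
    by (simp add: x_def y_def w_def)
  \<comment> \<open>\<open>J\<close> and \<open>\<phi>\<close> differ by Reeb vectors, which lie in
    the kernels of \<open>b1\<close> and \<open>b2\<close>; on the forms themselves \<open>J\<close>
    acts as a rotation.\<close>
  moreover have "b1 (J p u) v = b1 (\<phi> p u) v" "b2 (J p u) v = b2 (\<phi> p u) v"
    "b1 u (J p v) = b1 u (\<phi> p v)" "b2 u (J p v) = b2 u (\<phi> p v)"
    "\<alpha>1 p (J p u) = - \<alpha>2 p u" "\<alpha>2 p (J p u) = \<alpha>1 p u" for u v
    by (simp_all add: J_def b1_def b2_def bilin1 bilin2 reeb_ext_d reeb_ext_d' form_lin form_phi form_reeb)
  ultimately show ?thesis by (simp add: w_def algebra_simps)
qed

text \<open>Up to Reeb vectors orthogonal to \<open>u\<close>, \<open>v\<close> is minus its image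
  under the square of \<open>\<phi>\<close>. In \<open>assoc\<close> at \<open>u\<close> and
  \<open>\<phi> p v\<close> the first form vanishes as \<open>u\<close> lies in \<open>K1\<close>,
  the second as \<open>K2\<close> is invariant under \<open>\<phi>\<close>.\<close>

lemma associated_perp:
  assumes "u \<in> K1 p" "v \<in> K2 p" shows "g p u v = 0"
proof -
  have "g p u (\<phi> p (\<phi> p v)) = 0"
    unfolding assoc using assms phi_K(2)[OF assms(2)] ext_d_skew[OF dual(2), of p u "\<phi> p v"] by (simp add: K_iff)
  then show ?thesis
    using assms by (simp add: phi_phi metric.bilin metric_reeb K_iff)
qed

text \<open>The first form sees only the components in \<open>K2\<close>, which
  \<open>\<phi>\<close> preserves. There the second form vanishes, so the first one alone equals
  \<open>g\<close> with \<open>\<phi>\<close> applied to its second argument.\<close>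

lemma ext_d_phi: "ext_d A \<alpha>1 p x (\<phi> p y) = \<alpha>1 p x * \<alpha>1 p y - g p (pr1 p x) (pr1 p y)"
proof -
  let ?b = "ext_d A \<alpha>1 p"
  note d = orthogonal_decomposition[OF associated_perp]
  have K1: "?b u v = 0" "?b v u = 0" if "u \<in> K1 p" for u v
    using that ext_d_skew[OF dual(1), of p v u] by (auto simp: K_iff)
  have "?b x (\<phi> p y) = ?b (pr1 p x + pr2 p x) (\<phi> p (pr1 p y + pr2 p y))"
    by (simp flip: d)
  also have "\<dots> = ?b (pr1 p x) (\<phi> p (pr1 p y))"
    by (simp add: phi_lin bilin1 K1 pr_in phi_K)
  also have "\<dots> = ?b (pr1 p x) (\<phi> p (pr1 p y)) + ext_d A \<alpha>2 p (pr1 p x) (\<phi> p (pr1 p y))"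
    using pr_in(1)[of p x] by (simp add: K_iff)
  also have "\<dots> = g p (pr1 p x) (\<phi> p (\<phi> p (pr1 p y)))" by (simp add: assoc)
  finally show ?thesis by (simp add: phi_phi metric.bilin metric_reeb form_pr)
qed

end

subsection \<open>From the covariant derivative to a normal metric contact pair\<close>

context
  assumes formula: "\<And>X Y p. X \<in> V \<Longrightarrow> Y \<in> V \<Longrightarrow> nabla_tensor11 nabla \<phi> X Y p = rhs p (X p) (Y p)"
begin

text \<open>Putting \<open>Y = Z1\<close> in the formula determines the image of
  \<open>nabla X Z1\<close> under \<open>\<phi>\<close>, and applying \<open>\<phi>\<close> once
  more recovers it up to Reeb components. Constant length of \<open>Z1\<close> removes the component
  along \<open>Z1\<close>.\<close>

lemma nabla_reeb_up_to:
  assumes "X \<in> V" shows "nabla X Z1 p = \<alpha>2 p (nabla X Z1 p) *\<^sub>R Z2 p - \<phi> p (pr1 p (X p))"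
proof -
  have "- \<phi> p (nabla X Z1 p) = rhs p (X p) (Z1 p)"
    using formula[OF assms reeb_closed(1), of p] by (simp add: nabla_tensor11_def phi_Z nabla_zero assms)
  also have "\<dots> = \<alpha>1 p (X p) *\<^sub>R Z1 p - pr1 p (X p)"
    by (simp add: rhs_def pr_reeb form_reeb metric_reeb metric.bilin form_lin form_pr)
  finally have "\<phi> p (nabla X Z1 p) = pr1 p (X p) - \<alpha>1 p (X p) *\<^sub>R Z1 p" by (metis minus_diff_eq minus_minus)
  from arg_cong[OF this, of "\<phi> p"]
  have *: "- nabla X Z1 p + \<alpha>1 p (nabla X Z1 p) *\<^sub>R Z1 p + \<alpha>2 p (nabla X Z1 p) *\<^sub>R Z2 p = \<phi> p (pr1 p (X p))"
    by (simp add: phi_phi phi_lin phi_Z)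
  have "\<alpha>1 p (nabla X Z1 p) = 0"
    using metric_compat[OF assms reeb_closed(1) reeb_closed(1), of p]
    by (simp add: metric_reeb form_reeb vf_apply_const)
  then show ?thesis using * by (simp add: algebra_simps flip: *)
qed

text \<open>The remaining components \<open>?w1\<close> and \<open>?w2\<close> have sum 0 because
  \<open>Z1\<close> and \<open>Z2\<close> are orthogonal. Since the exterior derivatives vanish on
  Reeb vectors, \<open>?w1\<close> is a multiple of \<open>\<alpha>2\<close> and \<open>?w2\<close>
  a multiple of \<open>\<alpha>1\<close>; evaluation at \<open>Z2\<close> shows that both are
  0.\<close>

lemma nabla_reeb:
  assumes X: "X \<in> V"
  shows "nabla X Z1 p = - \<phi> p (pr1 p (X p))" "nabla X Z2 p = - \<phi> p (pr2 p (X p))"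
proof -
  interpret s: contact_metric A g nabla k h \<alpha>2 \<alpha>1 Z2 Z1 \<phi> by (rule swap)
  have pr: "s.pr1 = pr2" "s.pr2 = pr1" by (simp_all add: fun_eq_iff s.pr1_def pr2_def s.pr2_def pr1_def)
  have rhs: "s.rhs p x y = rhs p x y" for p x y by (simp add: s.rhs_def rhs_def pr)
  have N1: "nabla X Z1 p = \<alpha>2 p (nabla X Z1 p) *\<^sub>R Z2 p - \<phi> p (pr1 p (X p))" if "X \<in> V" for X
    by (rule nabla_reeb_up_to[OF that])
  have N2: "nabla X Z2 p = \<alpha>1 p (nabla X Z2 p) *\<^sub>R Z1 p - \<phi> p (pr2 p (X p))" if "X \<in> V" for X
    using s.nabla_reeb_up_to[OF _ that, of p] formula by (simp add: rhs pr)
  let ?w1 = "\<lambda>X. \<alpha>2 p (nabla X Z1 p)" and ?w2 = "\<lambda>X. \<alpha>1 p (nabla X Z2 p)"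
  have sum: "?w1 X + ?w2 X = 0" if "X \<in> V" for X
    using metric_compat[OF that reeb_closed, of p] by (simp add: metric_reeb form_reeb vf_apply_const)
  have w1: "?w1 X = ?w1 Z2 * \<alpha>2 p (X p)" if "X \<in> V" for X
  proof -
    have "nabla Z2 Z1 p = ?w1 Z2 *\<^sub>R Z2 p" using N1[OF reeb_closed(2)] by (simp add: pr_reeb phi_lin)
    then have "g p (nabla Z2 Z1 p) (X p) = ?w1 Z2 * \<alpha>2 p (X p)" by (metis metric.bilin(9) metric_reeb(4))
    then show ?thesis
      using ext_d_nabla[OF dual(1) that reeb_closed(2), of p] by (simp add: reeb_ext_d' metric_reeb)
  qed
  have w2: "?w2 X = ?w2 Z1 * \<alpha>1 p (X p)" if "X \<in> V" for X
  proof -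
    have "nabla Z1 Z2 p = ?w2 Z1 *\<^sub>R Z1 p" using N2[OF reeb_closed(1)] by (simp add: pr_reeb phi_lin)
    then have "g p (nabla Z1 Z2 p) (X p) = ?w2 Z1 * \<alpha>1 p (X p)" by (metis metric.bilin(9) metric_reeb(3))
    then show ?thesis
      using ext_d_nabla[OF dual(2) that reeb_closed(1), of p] by (simp add: reeb_ext_d' metric_reeb)
  qed
  have "?w1 Z2 = 0" using sum[OF reeb_closed(2)] w2[OF reeb_closed(2)] by (simp add: form_reeb)
  then have "?w1 X = 0" "?w2 X = 0" using w1[OF X] sum[OF X] by auto
  then show "nabla X Z1 p = - \<phi> p (pr1 p (X p))" "nabla X Z2 p = - \<phi> p (pr2 p (X p))"
    using N1[OF X] N2[OF X] by simp_all
qed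

lemma formula_ext_d:
  "2 * ext_d A \<alpha>1 p x y = g p (pr1 p x) (\<phi> p y) - g p (pr1 p y) (\<phi> p x)"
  "2 * ext_d A \<alpha>2 p x y = g p (pr2 p x) (\<phi> p y) - g p (pr2 p y) (\<phi> p x)"
proof -
  obtain X where X: "X \<in> V" "X p = x" by (rule vector_field_through)
  obtain Y where Y: "Y \<in> V" "Y p = y" by (rule vector_field_through)
  show "2 * ext_d A \<alpha>1 p x y = g p (pr1 p x) (\<phi> p y) - g p (pr1 p y) (\<phi> p x)"
    using ext_d_nabla[OF dual(1) X(1) Y(1), of p] X Y by (simp add: nabla_reeb metric.bilin phi_skew)
  show "2 * ext_d A \<alpha>2 p x y = g p (pr2 p x) (\<phi> p y) - g p (pr2 p y) (\<phi> p x)"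
    using ext_d_nabla[OF dual(2) X(1) Y(1), of p] X Y by (simp add: nabla_reeb metric.bilin phi_skew)
qed

text \<open>For \<open>u\<close> in \<open>K1\<close> and \<open>v\<close> in \<open>K2\<close>, the
  left side of \<open>formula_ext_d\<close> is 0 and the right side is twice
  \<open>g p u (\<phi> p v)\<close>. As \<open>\<phi>\<close> preserves \<open>K2\<close>, the same
  applies to \<open>\<phi> p v\<close>, and the square of \<open>\<phi>\<close> leads back to
  \<open>v\<close>.\<close>

lemma formula_perp:
  assumes u: "u \<in> K1 p" and v: "v \<in> K2 p" shows "g p u v = 0"
proof -
  have *: "g p u (\<phi> p v) = 0" if v: "v \<in> K2 p" for v
    using formula_ext_d(1)[of p u v] u v pr_metric'(1)[OF phi_K(2)[OF v], of u] phi_skew[of p u v]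
      metric.g_sym[of p v "\<phi> p u"]
    by (simp add: K_iff pr_same)
  show ?thesis
    using *[OF phi_K(2)[OF v]] u v by (simp add: phi_phi metric.bilin metric_reeb K_iff)
qed

lemma formula_decomposition: "v = pr1 p v + pr2 p v"
  by (rule orthogonal_decomposition[OF formula_perp])

lemma formula_associated: "g p u (\<phi> p v) = ext_d A \<alpha>1 p u v + ext_d A \<alpha>2 p u v"
proof -
  have "g p u (\<phi> p v) = g p (pr1 p u) (\<phi> p v) + g p (pr2 p u) (\<phi> p v)" for u v
    using arg_cong[OF formula_decomposition[of u p], of "\<lambda>x. g p x (\<phi> p v)"] by (simp add: metric.bilin)
  from this[of u v] this[of v u] show ?thesis
    using formula_ext_d[of p u v] phi_skew[of p u v] metric.g_sym[of p v "\<phi> p u"] by linarith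
qed

text \<open>The two right-hand sides add up to \<open>J p x\<close> and lie in the orthogonal spaces
  \<open>K2\<close> and \<open>K1\<close>, so they are its projections. Each picks up the Reeb
  coefficient of the other index, since \<open>J\<close> exchanges the Reeb directions.\<close>

lemma pr_J: "pr1 p (J p x) = \<phi> p (pr1 p x) - \<alpha>2 p x *\<^sub>R Z1 p"
  "pr2 p (J p x) = \<phi> p (pr2 p x) + \<alpha>1 p x *\<^sub>R Z2 p"
proof -
  have J: "J p x = (\<phi> p (pr1 p x) - \<alpha>2 p x *\<^sub>R Z1 p) + (\<phi> p (pr2 p x) + \<alpha>1 p x *\<^sub>R Z2 p)"
    using arg_cong[OF formula_decomposition[of x p], of "\<phi> p"] by (simp add: J_def phi_lin)
  have in2: "\<phi> p (pr1 p x) - \<alpha>2 p x *\<^sub>R Z1 p \<in> K2 p"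
    by (intro subspace_diff subspace_scale subspace_K phi_K pr_in reeb_in_K)
  have in1: "\<phi> p (pr2 p x) + \<alpha>1 p x *\<^sub>R Z2 p \<in> K1 p"
    by (intro subspace_add subspace_scale subspace_K phi_K pr_in reeb_in_K)
  show "pr1 p (J p x) = \<phi> p (pr1 p x) - \<alpha>2 p x *\<^sub>R Z1 p" unfolding pr1_def[of p, THEN fun_cong, of "J p x"]
    by (rule metric.orth_proj_eq[OF subspace_K(2) in2])
      (simp only: J add_diff_cancel_left' formula_perp[OF in1])
  show "pr2 p (J p x) = \<phi> p (pr2 p x) + \<alpha>1 p x *\<^sub>R Z2 p" unfolding pr2_def[of p, THEN fun_cong, of "J p x"]
    by (rule metric.orth_proj_eq[OF subspace_K(1) in1])
      (simp only: J add_diff_cancel_right' metric.g_sym[of p "\<phi> p (pr1 p x) - \<alpha>2 p x *\<^sub>R Z1 p"] formula_perp[OF _ in2])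
qed

text \<open>The formula and \<open>nabla_reeb\<close> express both sides algebraically through
  projections, forms and \<open>\<phi>\<close>. With this identity the four terms of
  \<open>nijenhuis_nabla\<close> cancel in pairs.\<close>

lemma nabla_J_commute:
  assumes X: "X \<in> V" and Y: "Y \<in> V"
  shows "nabla_tensor11 nabla J (\<lambda>q. J q (X q)) Y p = J p (nabla_tensor11 nabla J X Y p)"
proof -
  have JX: "(\<lambda>q. J q (X q)) \<in> V" using tensor_J X by (simp add: tensor11_def)
  have m: "g p (pr1 p x) (pr1 p y) = g p (pr1 p x) y" "g p (pr2 p x) (pr2 p y) = g p (pr2 p x) y"
    "g p (\<phi> p (pr1 p x)) (pr1 p y) = g p (\<phi> p (pr1 p x)) y" "g p (\<phi> p (pr2 p x)) (pr2 p y) = g p (\<phi> p (pr2 p x)) y" for x y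
    by (simp_all add: pr_metric pr_in phi_K)
  show ?thesis
    unfolding nabla_J[OF JX Y] nabla_J[OF X Y] formula[OF JX Y] formula[OF X Y] nabla_reeb[OF JX] nabla_reeb[OF X]
    unfolding rhs_def pr_J
    by (simp add: J_def phi_lin form_lin metric.bilin phi_phi phi_Z form_phi form_reeb form_pr m metric_reeb algebra_simps)
qed

lemma nijenhuis_J:
  assumes "X \<in> V" "Y \<in> V" shows "nijenhuis A J X Y p = 0"
  using assms by (simp add: nijenhuis_nabla[OF tensor_J] nabla_J_commute)

end

section \<open>Both implications, with T treated as the structure J of the exchanged pair\<close>

definition T :: "'m \<Rightarrow> 'e \<Rightarrow> 'e" where "T p v = \<phi> p v + \<alpha>2 p v *\<^sub>R Z1 p - \<alpha>1 p v *\<^sub>R Z2 p"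

lemma normal_iff: "normal_structure A \<alpha>1 \<alpha>2 Z1 Z2 \<phi> \<longleftrightarrow>
    integrable_almost_complex A J \<and> integrable_almost_complex A T"
  by (simp add: normal_structure_def J_def[abs_def] T_def[abs_def])

lemma covariant_derivative_of_normal:
  assumes assoc: "\<And>p u v. g p u (\<phi> p v) = ext_d A \<alpha>1 p u v + ext_d A \<alpha>2 p u v"
    and normal: "normal_structure A \<alpha>1 \<alpha>2 Z1 Z2 \<phi>" and XY: "X \<in> V" "Y \<in> V"
  shows "nabla_tensor11 nabla \<phi> X Y p = rhs p (X p) (Y p)"
proof (rule metric.eqI[of p])
  fix w
  interpret s: contact_metric A g nabla k h \<alpha>2 \<alpha>1 Z2 Z1 \<phi> by (rule swap)
  have sJ: "s.J = T" by (simp add: fun_eq_iff s.J_def T_def)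
  have pr: "s.pr1 = pr2" by (simp add: fun_eq_iff s.pr1_def pr2_def)
  have assoc': "g p u (\<phi> p v) = ext_d A \<alpha>2 p u v + ext_d A \<alpha>1 p u v" for p u v
    by (simp add: assoc)
  obtain W where W: "W \<in> V" "W p = w" by (rule vector_field_through)
  have NJ: "nijenhuis A J X Y p = 0" and NT: "nijenhuis A s.J X Y p = 0" if "X \<in> V" "Y \<in> V" for X Y p
    using normal that by (auto simp: normal_iff integrable_almost_complex_def sJ)
  define x y where "x = X p" and "y = Y p"
  \<comment> \<open>The corrections that distinguish \<open>J\<close> and \<open>T\<close> from
    \<open>\<phi>\<close> are opposite, so they cancel in the sum.\<close>
  have "2 * g p (nabla_tensor11 nabla \<phi> X Y p) w =
      g p (nabla_tensor11 nabla J X Y p) w + g p (nabla_tensor11 nabla s.J X Y p) w"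
    unfolding nabla_J[OF XY] s.nabla_J[OF XY] by (simp add: metric.bilin)
  \<comment> \<open>The terms in which a form is multiplied by the exterior derivative of the other
    form change sign under the exchange of indices and drop out.\<close>
  also have "\<dots> = - 2 * (ext_d A \<alpha>1 p x (\<phi> p y) * \<alpha>1 p w + ext_d A \<alpha>2 p x (\<phi> p y) * \<alpha>2 p w
      + ext_d A \<alpha>1 p (\<phi> p w) x * \<alpha>1 p y + ext_d A \<alpha>2 p (\<phi> p w) x * \<alpha>2 p y)"
    using nabla_J_integrable[OF assoc NJ XY W(1), of p] s.nabla_J_integrable[OF assoc' NT XY W(1), of p]
    unfolding W(2) x_def[symmetric] y_def[symmetric] by (simp add: algebra_simps)
  also have "\<dots> = 2 * (ext_d A \<alpha>1 p x (\<phi> p w) * \<alpha>1 p y + ext_d A \<alpha>2 p x (\<phi> p w) * \<alpha>2 p y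
      - ext_d A \<alpha>1 p x (\<phi> p y) * \<alpha>1 p w - ext_d A \<alpha>2 p x (\<phi> p y) * \<alpha>2 p w)"
    by (simp add: ext_d_skew[OF dual(1), of p "\<phi> p w" x] ext_d_skew[OF dual(2), of p "\<phi> p w" x])
  finally have *: "g p (nabla_tensor11 nabla \<phi> X Y p) w = ext_d A \<alpha>1 p x (\<phi> p w) * \<alpha>1 p y + ext_d A \<alpha>2 p x (\<phi> p w) * \<alpha>2 p y
      - ext_d A \<alpha>1 p x (\<phi> p y) * \<alpha>1 p w - ext_d A \<alpha>2 p x (\<phi> p y) * \<alpha>2 p w"
    by simp
  have m: "g p (pr1 p x) (pr1 p w) = g p (pr1 p x) w" "g p (pr2 p x) (pr2 p w) = g p (pr2 p x) w"
    by (simp_all add: pr_metric pr_in)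
  show "g p (nabla_tensor11 nabla \<phi> X Y p) w = g p (rhs p (X p) (Y p)) w"
    \<comment> \<open>The triple products of forms produced by \<open>ext_d_phi\<close> cancel
      between the two halves, leaving only metric terms.\<close>
    unfolding * ext_d_phi[OF assoc] s.ext_d_phi[OF assoc'] pr x_def[symmetric] y_def[symmetric] rhs_def m
    by (simp add: metric.bilin metric_reeb form_pr algebra_simps)
qed

lemma normal_of_covariant_derivative:
  assumes formula: "\<And>X Y p. X \<in> V \<Longrightarrow> Y \<in> V \<Longrightarrow> nabla_tensor11 nabla \<phi> X Y p = rhs p (X p) (Y p)"
  shows "normal_structure A \<alpha>1 \<alpha>2 Z1 Z2 \<phi>"
proof -
  interpret s: contact_metric A g nabla k h \<alpha>2 \<alpha>1 Z2 Z1 \<phi> by (rule swap)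
  have sJ: "s.J = T" by (simp add: fun_eq_iff s.J_def T_def)
  have pr: "s.pr1 = pr2" "s.pr2 = pr1" by (simp_all add: fun_eq_iff s.pr1_def pr2_def s.pr2_def pr1_def)
  have rhs: "s.rhs p x y = rhs p x y" for p x y by (simp add: s.rhs_def rhs_def pr)
  have "nijenhuis A J X Y p = 0" "nijenhuis A T X Y p = 0" if "X \<in> V" "Y \<in> V" for X Y p
    using nijenhuis_J[OF formula that] s.nijenhuis_J[OF _ that, of p] formula by (simp_all add: sJ rhs)
  moreover have "almost_complex A J" "almost_complex A T"
    unfolding sJ[symmetric] almost_complex_def
    by (simp_all add: tensor_J s.tensor_J J_J s.J_J)
  ultimately show ?thesis by (simp add: normal_iff integrable_almost_complex_def)
qed

end

section \<open>Normality and the covariant derivative formula\<close>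

theorem theorem5:
  fixes A :: "('m::{t2_space, second_countable_topology}, 'e::euclidean_space) chart set"
    and h k :: nat
    and \<alpha>1 \<alpha>2 :: "'m \<Rightarrow> 'e \<Rightarrow> real"
    and Z1 Z2 :: "'m \<Rightarrow> 'e"
    and \<phi> :: "'m \<Rightarrow> 'e \<Rightarrow> 'e"
    and g :: "'m \<Rightarrow> 'e \<Rightarrow> 'e \<Rightarrow> real"
    and nabla :: "('m \<Rightarrow> 'e) \<Rightarrow> ('m \<Rightarrow> 'e) \<Rightarrow> 'm \<Rightarrow> 'e"
  assumes "smooth_manifold A"
    and "contact_pair_structure A h k \<alpha>1 \<alpha>2 Z1 Z2 \<phi>"
    and "decomposable A \<alpha>1 \<alpha>2 \<phi>"
    and "compatible_metric A \<alpha>1 \<alpha>2 \<phi> g"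
    and "levi_civita A g nabla"
  shows "metric_contact_pair A h k \<alpha>1 \<alpha>2 Z1 Z2 \<phi> g \<and> normal_structure A \<alpha>1 \<alpha>2 Z1 Z2 \<phi> \<longleftrightarrow>
    (\<forall>X\<in>vector_fields A. \<forall>Y\<in>vector_fields A. \<forall>p.
       let X1 = field_proj g (char_foliation A \<alpha>2) X;
           X2 = field_proj g (char_foliation A \<alpha>1) X;
           Y1 = field_proj g (char_foliation A \<alpha>2) Y;
           Y2 = field_proj g (char_foliation A \<alpha>1) Y
       in nabla_tensor11 nabla \<phi> X Y p =
            (g p (X1 p) (Y1 p) *\<^sub>R Z1 p - \<alpha>1 p (Y1 p) *\<^sub>R X1 p) +
            (g p (X2 p) (Y2 p) *\<^sub>R Z2 p - \<alpha>2 p (Y2 p) *\<^sub>R X2 p))"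
proof -
  have cps: "contact_pair A h k \<alpha>1 \<alpha>2" "reeb_fields A \<alpha>1 \<alpha>2 Z1 Z2" "tensor11 A \<phi>"
    "\<And>p v. \<phi> p (\<phi> p v) = - v + \<alpha>1 p v *\<^sub>R Z1 p + \<alpha>2 p v *\<^sub>R Z2 p"
    "\<And>p. \<phi> p (Z1 p) = 0" "\<And>p. \<phi> p (Z2 p) = 0"
    using assms(2) by (simp_all add: contact_pair_structure_def)
  have cp: "one_form A \<alpha>1" "one_form A \<alpha>2" "DIM('e) = 2 * h + 2 * k + 2"
    "\<And>p v. wedge_power2 (ext_d A \<alpha>1 p) (h + 1) v = 0" "\<And>p v. wedge_power2 (ext_d A \<alpha>2 p) (k + 1) v = 0"
    using cps(1) unfolding contact_pair_def by blast+
  have riem: "riemannian_metric A g" using assms(4) by (simp add: compatible_metric_def)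
  interpret contact_metric A g nabla h k \<alpha>1 \<alpha>2 Z1 Z2 \<phi>
    by (intro contact_metric.intro contact_metric_axioms.intro metric_connection.intro
        metric_connection_axioms.intro smooth_atlas.intro assms cps cp riem)
  \<comment> \<open>By \<open>metric_reeb\<close> compatibility already gives duality of forms and
    Reeb fields, so being a metric contact pair reduces to the identity for the fundamental
    form.\<close>
  have "metric_contact_pair A h k \<alpha>1 \<alpha>2 Z1 Z2 \<phi> g \<longleftrightarrow>
      (\<forall>p u v. g p u (\<phi> p v) = ext_d A \<alpha>1 p u v + ext_d A \<alpha>2 p u v)"
    using assms(2) riem by (simp add: metric_contact_pair_def associated_metric_def metric_reeb)
  then have "metric_contact_pair A h k \<alpha>1 \<alpha>2 Z1 Z2 \<phi> g \<and> normal_structure A \<alpha>1 \<alpha>2 Z1 Z2 \<phi> \<longleftrightarrow>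
      (\<forall>X\<in>V. \<forall>Y\<in>V. \<forall>p. nabla_tensor11 nabla \<phi> X Y p = rhs p (X p) (Y p))"
    using covariant_derivative_of_normal normal_of_covariant_derivative formula_associated by blast
  then show ?thesis
    by (simp add: Let_def rhs_def field_proj_def pr1_def pr2_def)
qed

end
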